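(* Assume Assumption A1 (stated in the context). Let $h,r,M$ be positive constants, put $\lambda=h^{2m}$, and suppose $c_K^2\sqrt{M}\,r\,h^{-1/2}A(h)\le 1/2$. Then $$\sup_{f\in H^m(1)}P_f\Big(\|\widehat f_{n,\lambda}-f\|\ge \delta_n(M,r)\Big)\le 2\exp(-Mnhr^2),$$ where $\delta_n(M,r)=2h^m+c_K\big(\sqrt{2M}\,r+(nh)^{-1/2}\big)$.
   Context: Fix an integer $m\ge1$ and $\mathbb{I}=[0,1]$. $S^m(\mathbb{I})$ is the Sobolev space of $f\in L^2(\mathbb{I})$ such that $f^{(j)}$ is absolutely continuous for $j=0,\dots,m-1$ and $\int_0^1|f^{(m)}(x)|^2dx<\infty$. Data $(Y_i,X_i)$, $i=1,\dots,n$, are i.i.d. copies of $(Y,X)$ with $Y=f(X)+\epsilon$, where $X\sim\mathrm{Unif}[0,1]$, $\epsilon\sim N(0,1)$ is independent of $X$, and $f\in S^m(\mathbb{I})$; $P_f$ denotes probability when $f$ is the true regression function, and $\epsilon_i=Y_i-f(X_i)$. Let $J(f,g)=\int_0^1f^{(m)}(x)g^{(m)}(x)dx$ and $V(f,g)=E\{f(X)g(X)\}$. For $\lambda>0$ let $\langle f,g\rangle=V(f,g)+\lambda J(f,g)$ with norm $\|\cdot\|$; $(S^m(\mathbb{I}),\langle\cdot,\cdot\rangle)$ is a reproducing kernel Hilbert space with kernel $K$, $K_x=K(x,\cdot)$, $\langle K_x,f\rangle=f(x)$. The smoothing spline estimator is $\widehat f_{n,\lambda}=\arg\max_{f\in S^m(\mathbb{I})}\{-\frac{1}{2n}\sum_{i=1}^n(Y_i-f(X_i))^2-\frac{\lambda}{2}J(f,f)\}$.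 Assumption A1: there exist $\varphi_\nu\in S^m(\mathbb{I})$, $\nu\ge1$, with $\sup_{\nu}\|\varphi_\nu\|_{\sup}<\infty$, and a nondecreasing sequence $\rho_\nu$ with $\rho_\nu/(c_\rho\nu)^{2m}\to1$ for some constant $c_\rho>0$, such that $V(\varphi_\mu,\varphi_\nu)=\delta_{\mu\nu}$, $J(\varphi_\mu,\varphi_\nu)=\rho_\mu\delta_{\mu\nu}$, and every $g\in S^m(\mathbb{I})$ satisfies $g=\sum_\nu V(g,\varphi_\nu)\varphi_\nu$ with convergence in $\|\cdot\|$. With $h=\lambda^{1/(2m)}$, let $c_K=\sup_{x\in\mathbb{I}}\sqrt{hK(x,x)}$ (finite under A1), $H^m(1)=\{f\in S^m(\mathbb{I}):J(f,f)\le1\}$, $\mathcal{G}=\{g\in S^m(\mathbb{I}):\|g\|_{\sup}\le1,\ J(g,g)\le c_K^{-2}h^{-2m+1}\}$, and let $c_0>0$ be a constant such that $\log N(\varepsilon,\mathcal{G},\|\cdot\|_{\sup})\le c_0h^{-(2m-1)/(2m)}\varepsilon^{-1/m}$ for all $\varepsilon>0$, where $N$ is the $\varepsilon$-packing number. Let $\tau=\sqrt{\log1.5}$, $\Psi(r)=\int_0^r\sqrt{\log(1+\exp(x^{-1/m}))}\,dx$, $$A(h,\varepsilon)=\frac{32\sqrt6}{\tau}c_K^{-1}c_0^mh^{-(2m-1)/2}\Psi\Big(\tfrac12c_Kc_0^{-m}h^{(2m-1)/2}\varepsilon\Big)+\frac{20\sqrt6\,\varepsilon}{\tau}\sqrt{\log\Big(1+\exp\big(2c_0(c_Kh^{(2m-1)/2}\varepsilon)^{-1/m}\big)\Big)},$$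 and $A(h)=A(h,2)$. *)

theory Defs
  imports "HOL-Probability.Probability"
begin

definition abs_cont_on :: "real set \<Rightarrow> (real \<Rightarrow> real) \<Rightarrow> bool" where
  "abs_cont_on S f \<longleftrightarrow>
     (\<forall>e>0. \<exists>d>0. \<forall>(k::nat) (a::nat \<Rightarrow> real) (b::nat \<Rightarrow> real).
        (\<forall>i<k. a i \<le> b i \<and> a i \<in> S \<and> b i \<in> S) \<and>
        (\<forall>i<k. \<forall>j<k. i \<noteq> j \<longrightarrow> b i \<le> a j \<or> b j \<le> a i) \<and>
        (\<Sum>i<k. b i - a i) < d
        \<longrightarrow> (\<Sum>i<k. \<bar>f (b i) - f (a i)\<bar>) < e)"

definition sobolev_witness :: "nat \<Rightarrow> (real \<Rightarrow> real) \<Rightarrow> (nat \<Rightarrow> real \<Rightarrow> real) \<Rightarrow> bool" where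
  "sobolev_witness m f D \<longleftrightarrow>
     (\<forall>x\<in>{0..1}. D 0 x = f x) \<and>
     (\<forall>j<m. abs_cont_on {0..1} (D j) \<and>
        (AE x in lborel. x \<in> {0..1} \<longrightarrow> (D j has_real_derivative D (Suc j) x) (at x))) \<and>
     D m \<in> borel_measurable lborel \<and>
     set_integrable lborel {0..1} (\<lambda>x. (D m x)\<^sup>2)"

definition sobolev :: "nat \<Rightarrow> (real \<Rightarrow> real) set" where
  "sobolev m = {f. \<exists>D. sobolev_witness m f D}"

text \<open>The m-th (weak) derivative f^(m) (determined a.e. on I for f in S^m).\<close>
definition sderiv :: "nat \<Rightarrow> (real \<Rightarrow> real) \<Rightarrow> real \<Rightarrow> real" where
  "sderiv m f = (SOME D. sobolev_witness m f D) m"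

definition Jf :: "nat \<Rightarrow> (real \<Rightarrow> real) \<Rightarrow> (real \<Rightarrow> real) \<Rightarrow> real" where
  "Jf m f g = (LINT x:{0..1}|lborel. sderiv m f x * sderiv m g x)"

definition unifI :: "real measure" where
  "unifI = uniform_measure lborel {0..1}"

definition Vf :: "(real \<Rightarrow> real) \<Rightarrow> (real \<Rightarrow> real) \<Rightarrow> real" where
  "Vf f g = (\<integral>x. f x * g x \<partial>unifI)"

definition sinner :: "nat \<Rightarrow> real \<Rightarrow> (real \<Rightarrow> real) \<Rightarrow> (real \<Rightarrow> real) \<Rightarrow> real" where
  "sinner m lam f g = Vf f g + lam * Jf m f g"

definition snorm :: "nat \<Rightarrow> real \<Rightarrow> (real \<Rightarrow> real) \<Rightarrow> real" where
  "snorm m lam f = sqrt (sinner m lam f f)"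

definition supnorm :: "(real \<Rightarrow> real) \<Rightarrow> real" where
  "supnorm f = (SUP x\<in>{0..1}. \<bar>f x\<bar>)"

definition assumption_A1 :: "nat \<Rightarrow> real \<Rightarrow> bool" where
  "assumption_A1 m lam \<longleftrightarrow>
    (\<exists>(\<phi>::nat \<Rightarrow> real \<Rightarrow> real) (\<rho>::nat \<Rightarrow> real) (c\<rho>::real).
       (\<forall>\<nu>\<ge>1. \<phi> \<nu> \<in> sobolev m) \<and>
       (\<exists>C. \<forall>\<nu>\<ge>1. supnorm (\<phi> \<nu>) \<le> C) \<and>
       (\<forall>\<mu> \<nu>. 1 \<le> \<mu> \<longrightarrow> \<mu> \<le> \<nu> \<longrightarrow> \<rho> \<mu> \<le> \<rho> \<nu>) \<and>
       c\<rho> > 0 \<and>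
       ((\<lambda>\<nu>. \<rho> \<nu> / (c\<rho> * real \<nu>) ^ (2 * m)) \<longlongrightarrow> 1) sequentially \<and>
       (\<forall>\<mu>\<ge>1. \<forall>\<nu>\<ge>1. Vf (\<phi> \<mu>) (\<phi> \<nu>) = (if \<mu> = \<nu> then 1 else 0)) \<and>
       (\<forall>\<mu>\<ge>1. \<forall>\<nu>\<ge>1. Jf m (\<phi> \<mu>) (\<phi> \<nu>) = (if \<mu> = \<nu> then \<rho> \<mu> else 0)) \<and>
       (\<forall>g\<in>sobolev m.
          ((\<lambda>N. snorm m lam (\<lambda>x. g x - (\<Sum>\<nu>=1..N. Vf g (\<phi> \<nu>) * \<phi> \<nu> x))) \<longlongrightarrow> 0)
            sequentially))"

definition is_rep_kernel :: "nat \<Rightarrow> real \<Rightarrow> (real \<Rightarrow> real \<Rightarrow> real) \<Rightarrow> bool" where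
  "is_rep_kernel m lam K \<longleftrightarrow>
     (\<forall>x\<in>{0..1}. K x \<in> sobolev m \<and> (\<forall>f\<in>sobolev m. sinner m lam (K x) f = f x))"

definition cK :: "real \<Rightarrow> (real \<Rightarrow> real \<Rightarrow> real) \<Rightarrow> real" where
  "cK h K = (SUP x\<in>{0..1}. sqrt (h * K x x))"

definition Hm1 :: "nat \<Rightarrow> (real \<Rightarrow> real) set" where
  "Hm1 m = {f \<in> sobolev m. Jf m f f \<le> 1}"

definition Gclass :: "nat \<Rightarrow> real \<Rightarrow> real \<Rightarrow> (real \<Rightarrow> real) set" where
  "Gclass m h c = {g \<in> sobolev m. supnorm g \<le> 1 \<and> Jf m g g \<le> c powr (-2) * h powr (- 2 * real m + 1)}"

text \<open>log N(eps, G, sup-norm) \<le> B with N the eps-packing number (maximal number of points of G with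
  pairwise sup-distance > eps): every finite eps-separated subset has log-cardinality \<le> B.\<close>
definition log_packing_le :: "(real \<Rightarrow> real) set \<Rightarrow> real \<Rightarrow> real \<Rightarrow> bool" where
  "log_packing_le G eps B \<longleftrightarrow>
     (\<forall>P. P \<subseteq> G \<longrightarrow> (\<forall>p\<in>P. \<forall>q\<in>P. p \<noteq> q \<longrightarrow> supnorm (\<lambda>x. p x - q x) > eps) \<longrightarrow>
        finite P \<and> ln (real (card P)) \<le> B)"

definition entropy_const :: "nat \<Rightarrow> real \<Rightarrow> real \<Rightarrow> real \<Rightarrow> bool" where
  "entropy_const m h c c0 \<longleftrightarrow> c0 > 0 \<and>
     (\<forall>eps>0. log_packing_le (Gclass m h c) eps
                (c0 * h powr (- (2 * real m - 1) / (2 * real m)) * eps powr (- 1 / real m)))"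

definition Psi :: "nat \<Rightarrow> real \<Rightarrow> real" where
  "Psi m r = integral {0..r} (\<lambda>x. sqrt (ln (1 + exp (x powr (- 1 / real m)))))"

definition Afun :: "nat \<Rightarrow> real \<Rightarrow> real \<Rightarrow> real \<Rightarrow> real \<Rightarrow> real" where
  "Afun m c c0 h eps =
     32 * sqrt 6 / sqrt (ln 1.5) * (1 / c) * c0 ^ m * h powr (- (2 * real m - 1) / 2)
       * Psi m (1 / 2 * c * c0 powr (- real m) * h powr ((2 * real m - 1) / 2) * eps)
     + 20 * sqrt 6 * eps / sqrt (ln 1.5)
       * sqrt (ln (1 + exp (2 * c0 * (c * h powr ((2 * real m - 1) / 2) * eps) powr (- 1 / real m))))"

definition obs_dist :: "(real \<times> real) measure" where
  "obs_dist = unifI \<Otimes>\<^sub>M density lborel std_normal_density"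

definition sample_space :: "nat \<Rightarrow> (nat \<Rightarrow> real \<times> real) measure" where
  "sample_space n = PiM {..<n} (\<lambda>_. obs_dist)"

definition data_of :: "(real \<Rightarrow> real) \<Rightarrow> (nat \<Rightarrow> real \<times> real) \<Rightarrow> nat \<Rightarrow> real \<times> real" where
  "data_of f \<omega> i = (f (fst (\<omega> i)) + snd (\<omega> i), fst (\<omega> i))"

definition pls_objective :: "nat \<Rightarrow> nat \<Rightarrow> real \<Rightarrow> (nat \<Rightarrow> real \<times> real) \<Rightarrow> (real \<Rightarrow> real) \<Rightarrow> real" where
  "pls_objective m n lam d g =
     - 1 / (2 * real n) * (\<Sum>i<n. (fst (d i) - g (snd (d i)))\<^sup>2) - lam / 2 * Jf m g g"

definition is_smoothing_spline :: "nat \<Rightarrow> nat \<Rightarrow> real \<Rightarrow> ((nat \<Rightarrow> real \<times> real) \<Rightarrow> real \<Rightarrow> real) \<Rightarrow> bool" where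
  "is_smoothing_spline m n lam fhat \<longleftrightarrow>
     (\<forall>d. (\<forall>i<n. snd (d i) \<in> {0..1}) \<longrightarrow>
        fhat d \<in> sobolev m \<and> (\<forall>g\<in>sobolev m. pls_objective m n lam d g \<le> pls_objective m n lam d (fhat d)))"

definition outer_prob :: "'a measure \<Rightarrow> 'a set \<Rightarrow> real" where
  "outer_prob M A = (INF B\<in>{B \<in> sets M. A \<subseteq> B}. measure M B)"

end

theory Submission
  imports Defs
begin

text \<open>
  Since \<open>96 \<le> A(h)\<close>, the smallness hypothesis gives \<open>n \<ge> 36864 \<kappa>\<^sup>4 X\<close> with \<open>\<kappa> = c\<^sub>K / sqrt h\<close>, \<open>K x x \<le> \<kappa>\<^sup>2\<close>
  and \<open>X = M n h r\<^sup>2\<close>, and quadratic exponential moments replace the chaining argument.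
  For \<open>g\<close> the estimation error, the first-order condition of the penalised least squares problem reads
  \<open>P\<^sub>n g\<^sup>2 + \<lambda> J(g, g) = P\<^sub>n (\<epsilon> g) - \<lambda> J(f, g)\<close>. Two bounds hold off an event of probability \<open>2 exp (- X)\<close>:
  the empirical second moment operator is within \<open>1/8\<close> of its mean in Hilbert-Schmidt norm, which gives
  \<open>V(g, g) - P\<^sub>n g\<^sup>2 \<le> \<parallel>g\<parallel>\<^sup>2 / 8\<close>; and, given the design, the norm of \<open>P\<^sub>n (\<epsilon> K)\<close> is a Gaussian chaos
  whose operator norm is controlled by the first bound. Both exponential moments are computed by integrating
  out one observation at a time, along a Gram-Schmidt basis of the (separable) Sobolev space. If \<open>\<kappa> < 2\<close>, the
  chaos bound is too weak, but testing the kernel on \<open>x\<^sup>2\<close> shows \<open>h ^ m > 1/9\<close>, and the bias term dominates.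
\<close>

section \<open>Absolutely continuous functions\<close>

text \<open>With u = sqrt (M * h) * r the smallness hypothesis reads \<kappa>^2 * u * A(h) \<le> 1/2
  and X = n * u^2, so the constant 36864 is (2 * 96)^2. In these terms the radius to be reached is 2
  * h^m + \<kappa> * (1 + sqrt (2 * X)) / sqrt n. The deviation 1/8 of the second moments costs a
  factor 8/7, which the bias part can afford because 8/7 < 2. Both exponential moments are taken at
  half of their critical parameter. The noise then has a tail exponent of leading order 49/144 *
  \<kappa>^2 * X, which beats X only for \<kappa>^2 above a fixed number; hence the case
  distinction. Two obstacles shape the formal proof. Members of \<open>sobolev m\<close> are
  arbitrary off the unit interval, so convergence in \<open>snorm\<close> certifies only its energy
  part, and polynomials must supply the rest. The estimator is an arbitrary choice of maximisers, so
  its error is bounded deterministically outside a measurable event in which it does not occur. That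
  event is a union over finite dimensions, and it costs nothing because every bound is free of the
  dimension.\<close>

lemma abs_cont_onD:
  assumes "abs_cont_on S f" "e > 0"
  shows "\<exists>d>0. \<forall>(k::nat) a b.
      (\<forall>i<k. a i \<le> b i \<and> a i \<in> S \<and> b i \<in> S) \<and>
      (\<forall>i<k. \<forall>j<k. i \<noteq> j \<longrightarrow> b i \<le> a j \<or> b j \<le> a i) \<and>
      (\<Sum>i<k. b i - a i) < d \<longrightarrow> (\<Sum>i<k. \<bar>f (b i) - f (a i)\<bar>) < e"
  using assms unfolding abs_cont_on_def by simp

lemma abs_cont_on_subset: "abs_cont_on S f \<Longrightarrow> T \<subseteq> S \<Longrightarrow> abs_cont_on T f"
proof -
  assume ac: "abs_cont_on S f" and TS: "T \<subseteq> S"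
  show ?thesis
    unfolding abs_cont_on_def
  proof (intro allI impI)
    fix e :: real assume "e > 0"
    from abs_cont_onD[OF ac this] obtain d where "d > 0" and d: "\<forall>(k::nat) a b.
        (\<forall>i<k. a i \<le> b i \<and> a i \<in> S \<and> b i \<in> S) \<and>
        (\<forall>i<k. \<forall>j<k. i \<noteq> j \<longrightarrow> b i \<le> a j \<or> b j \<le> a i) \<and>
        (\<Sum>i<k. b i - a i) < d \<longrightarrow> (\<Sum>i<k. \<bar>f (b i) - f (a i)\<bar>) < e" by (elim exE conjE)
    show "\<exists>d>0. \<forall>(k::nat) a b. (\<forall>i<k. a i \<le> b i \<and> a i \<in> T \<and> b i \<in> T) \<and>
         (\<forall>i<k. \<forall>j<k. i \<noteq> j \<longrightarrow> b i \<le> a j \<or> b j \<le> a i) \<and> (\<Sum>i<k. b i - a i) < d \<longrightarrow>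
         (\<Sum>i<k. \<bar>f (b i) - f (a i)\<bar>) < e"
    proof (intro exI[of _ d] conjI allI impI \<open>d > 0\<close>)
      fix k :: nat and a b
      assume A: "(\<forall>i<k. a i \<le> b i \<and> a i \<in> T \<and> b i \<in> T) \<and>
         (\<forall>i<k. \<forall>j<k. i \<noteq> j \<longrightarrow> b i \<le> a j \<or> b j \<le> a i) \<and> (\<Sum>i<k. b i - a i) < d"
      show "(\<Sum>i<k. \<bar>f (b i) - f (a i)\<bar>) < e"
        by (rule d[rule_format]) (use A TS in blast)
    qed
  qed
qed

text \<open>The tag x lies between u and v, so the two differentiability errors, at most e * (x - u)
  and e * (v - x), add up to e * (v - u). Summed over a division this gives e times the total
  length.\<close>

lemma straddle_estimate:
  fixes f :: "real \<Rightarrow> real"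
  assumes "(f has_real_derivative f') (at x)" "e > 0"
  shows "\<exists>d>0. \<forall>u v. u \<le> x \<longrightarrow> x \<le> v \<longrightarrow> {u..v} \<subseteq> ball x d \<longrightarrow>
           \<bar>f v - f u - f' * (v - u)\<bar> \<le> e * (v - u)"
proof -
  from assms obtain d where d: "d > 0"
    "\<And>y. norm (y - x) < d \<Longrightarrow> norm (f y - f x - f' * (y - x)) \<le> e * norm (y - x)"
    unfolding has_field_derivative_def has_derivative_at_alt by blast
  show ?thesis
  proof (intro exI[of _ d] conjI allI impI d)
    fix u v assume uv: "u \<le> x" "x \<le> v" "{u..v} \<subseteq> ball x d"
    then have "u \<in> ball x d" "v \<in> ball x d" by (meson atLeastAtMost_iff order_refl order_trans subsetD)+
    then have "norm (u - x) < d" "norm (v - x) < d"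
      by (auto simp: dist_real_def abs_minus_commute)
    from d(2)[OF this(1)] d(2)[OF this(2)] uv
    have A: "\<bar>f u - f x - f' * (u - x)\<bar> \<le> e * (x - u)" "\<bar>f v - f x - f' * (v - x)\<bar> \<le> e * (v - x)" by auto
    have "f v - f u - f' * (v - u) = (f v - f x - f' * (v - x)) - (f u - f x - f' * (u - x))"
      by (simp add: algebra_simps)
    then have "\<bar>f v - f u - f' * (v - u)\<bar> \<le> \<bar>f v - f x - f' * (v - x)\<bar> + \<bar>f u - f x - f' * (u - x)\<bar>"
      by linarith
    also have "\<dots> \<le> e * (v - u)" using A by (simp add: algebra_simps)
    finally show "\<bar>f v - f u - f' * (v - u)\<bar> \<le> e * (v - u)" .
  qed
qed

lemma interior_disjoint_intervals_ordered:
  fixes a b c d :: real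
  assumes "a < b" "c < d" "interior {a..b} \<inter> interior {c..d} = {}"
  shows "b \<le> c \<or> d \<le> a"
proof (rule ccontr)
  assume "\<not> ?thesis"
  then have "max a c < min b d" using assms by auto
  then obtain z where "max a c < z" "z < min b d" using dense by blast
  then have "z \<in> interior {a..b} \<inter> interior {c..d}" by auto
  with assms(3) show False by blast
qed

text \<open>The Henstock-Kurzweil gauge: away from the exceptional null set the straddle estimate controls the
  Riemann sums; the intervals tagged inside it lie in an open set of small measure, where absolute continuity applies.\<close>

lemma abs_cont_has_integral:
  fixes f g :: "real \<Rightarrow> real"
  assumes ac: "abs_cont_on {a..b} f" and ab: "a \<le> b"
    and der: "AE x in lborel. x \<in> {a..b} \<longrightarrow> (f has_real_derivative g x) (at x)"
  shows "(g has_integral f b - f a) {a..b}"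
proof -
  obtain N where N: "\<And>x. x \<in> {a..b} \<Longrightarrow> x \<notin> N \<Longrightarrow> (f has_real_derivative g x) (at x)"
      "N \<in> null_sets lborel"
  proof (rule AE_E3[OF der])
    fix N assume N: "\<And>x. x \<in> space lborel - N \<Longrightarrow> x \<in> {a..b} \<longrightarrow> (f has_real_derivative g x) (at x)"
      "N \<in> null_sets lborel"
    show ?thesis by (rule that[of N]) (use N in auto)
  qed
  \<comment> \<open>With the value 0 on N, an interval tagged in N contributes only the increment of
    \<open>f\<close>. The spike rule returns to \<open>g\<close> at the end.\<close>
  define g' where "g' = (\<lambda>x. if x \<in> N then 0 else g x)"
  have "(g' has_integral f b - f a) {a..b}"
    unfolding has_integral_real
  proof (intro allI impI)
    fix e :: real assume e: "e > 0"
    \<comment> \<open>The summand 1 keeps the denominator positive when a = b.\<close>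
    define e1 where "e1 = e / (2 * (b - a + 1))"
    have e1: "e1 > 0" "e1 * (b - a) < e / 2" using e ab by (auto simp: e1_def field_simps)
    from e have "e / 2 > 0" by simp
    from abs_cont_onD[OF ac this] obtain d where d: "d > 0" and dd: "\<forall>(k::nat) u v.
        (\<forall>i<k. u i \<le> v i \<and> u i \<in> {a..b} \<and> v i \<in> {a..b}) \<and>
        (\<forall>i<k. \<forall>j<k. i \<noteq> j \<longrightarrow> v i \<le> u j \<or> v j \<le> u i) \<and>
        (\<Sum>i<k. v i - u i) < d \<longrightarrow> (\<Sum>i<k. \<bar>f (v i) - f (u i)\<bar>) < e / 2" by (elim exE conjE)
    have Ns: "N \<in> sets borel" using N(2) by auto
    obtain U where U: "open U" "N \<subseteq> U" "emeasure lborel (U - N) < ennreal d"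
      using outer_regular_lborel[OF Ns, of d] d by auto
    have "emeasure lborel U = emeasure lborel (U - N)"
      using U(1) by (intro emeasure_Diff_null_set[symmetric] N(2)) auto
    with U have Um: "emeasure lborel U < ennreal d" by simp
    have "\<forall>x. \<exists>d>0. x \<in> {a..b} \<longrightarrow> x \<notin> N \<longrightarrow> (\<forall>u v. u \<le> x \<longrightarrow> x \<le> v \<longrightarrow> {u..v} \<subseteq> ball x d \<longrightarrow>
           \<bar>f v - f u - g x * (v - u)\<bar> \<le> e1 * (v - u))"
      using straddle_estimate[OF N(1) e1(1)] zero_less_one by meson
    then obtain \<delta> where \<delta>: "\<And>x. \<delta> x > 0" "\<And>x u v. x \<in> {a..b} \<Longrightarrow> x \<notin> N \<Longrightarrow> u \<le> x \<Longrightarrow> x \<le> v \<Longrightarrow> {u..v} \<subseteq> ball x (\<delta> x) \<Longrightarrow>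
           \<bar>f v - f u - g x * (v - u)\<bar> \<le> e1 * (v - u)"
      by metis
    define \<gamma> where "\<gamma> = (\<lambda>x. if x \<in> N then U else ball x (\<delta> x))"
    have gauge: "gauge \<gamma>" using U \<delta>(1) by (auto simp: gauge_def \<gamma>_def)
    have main: "norm ((\<Sum>(x, k)\<in>D. measure lborel k *\<^sub>R g' x) - (f b - f a)) < e"
      if D: "D tagged_division_of {a..b}" and fine: "\<gamma> fine D" for D
    proof -
      have finD: "finite D" using D by blast
      define lo up :: "real \<times> real set \<Rightarrow> real" where "lo = (\<lambda>p. Inf (snd p))" and "up = (\<lambda>p. Sup (snd p))"
      have intv: "snd p = {lo p..up p}" "lo p \<le> fst p" "fst p \<le> up p" "lo p \<in> {a..b}" "up p \<in> {a..b}"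
          "snd p \<subseteq> \<gamma> (fst p)" if pD: "p \<in> D" for p
      proof -
        obtain x k where p: "p = (x, k)" by (cases p)
        have xk: "x \<in> k" "k \<subseteq> {a..b}" using tagged_division_ofD(2,3)[OF D, of x k] pD p by simp_all
        obtain c d where "k = cbox c d" using tagged_division_ofD(4)[OF D, of x k] pD p by blast
        then have k: "k = {c..d}" by simp
        with xk have "c \<le> d" by auto
        then have "lo p = c" "up p = d" by (auto simp: lo_def up_def p k)
        then show "snd p = {lo p..up p}" "lo p \<le> fst p" "fst p \<le> up p" "lo p \<in> {a..b}" "up p \<in> {a..b}"
          "snd p \<subseteq> \<gamma> (fst p)" using xk \<open>c \<le> d\<close> fine pD p by (auto simp: k p fine_def)
      qed
      have cont: "measure lborel (snd p) = up p - lo p" if "p \<in> D" for p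
        using intv[OF that] by (metis content_real order_trans)
      have tot: "(\<Sum>p\<in>D. up p - lo p) = b - a"
        using additive_tagged_division_1[OF ab D, of "\<lambda>x. x"]
        by (simp add: up_def lo_def case_prod_unfold)
      have tel: "(\<Sum>p\<in>D. f (up p) - f (lo p)) = f b - f a"
        using additive_tagged_division_1[OF ab D, of f]
        by (simp add: up_def lo_def case_prod_unfold)
      \<comment> \<open>Degenerate intervals have increment 0 and are left out: disjoint interiors
        order two intervals only if both have positive length.\<close>
      define B where "B = {p \<in> D. fst p \<in> N \<and> lo p < up p}"
      have finB: "finite B" using finD B_def by auto
      obtain w where w: "bij_betw w {..<card B} B"
        using ex_bij_betw_nat_finite[OF finB] atLeast0LessThan by metis
      have ord: "up p \<le> lo q \<or> up q \<le> lo p" if "p \<in> B" "q \<in> B" "p \<noteq> q" for p q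
      proof -
        have pq: "p \<in> D" "q \<in> D" using that B_def by auto
        then have "interior (snd p) \<inter> interior (snd q) = {}"
          using tagged_division_ofD(5)[OF D, of "fst p" "snd p" "fst q" "snd q"] that by (simp add: prod_eq_iff)
        then show ?thesis using interior_disjoint_intervals_ordered[of "lo p" "up p" "lo q" "up q"]
            that intv(1)[OF pq(1)] intv(1)[OF pq(2)] B_def by auto
      qed
      have reB: "(\<Sum>i<card B. F (w i)) = (\<Sum>p\<in>B. F p)" for F :: "_ \<Rightarrow> real"
        using sum.reindex_bij_betw[OF w, of F] by simp
      have wB: "w i \<in> B" if "i < card B" for i using w that bij_betwE by blast
      have winj: "w i \<noteq> w j" if "i < card B" "j < card B" "i \<noteq> j" for i j
        using w that unfolding bij_betw_def inj_on_def by auto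
      have "(\<Sum>p\<in>B. up p - lo p) = (\<Sum>p\<in>B. measure lborel {lo p<..<up p})"
        by (intro sum.cong) (auto simp: B_def)
      also have "\<dots> = measure lborel (\<Union>p\<in>B. {lo p<..<up p})"
      proof (rule measure_finite_Union[symmetric, OF finB])
        show "disjoint_family_on (\<lambda>p. {lo p<..<up p}) B"
          unfolding disjoint_family_on_def using ord by fastforce
      qed (auto simp: B_def)
      also have "\<dots> \<le> measure lborel U"
      proof (rule measure_mono_fmeasurable)
        show "(\<Union>p\<in>B. {lo p<..<up p}) \<subseteq> U"
        proof safe
          fix x k y assume "(x, k) \<in> B" "y \<in> {lo (x, k)<..<up (x, k)}"
          then show "y \<in> U" using intv[of "(x,k)"] by (auto simp: B_def \<gamma>_def)
        qed
        show "U \<in> fmeasurable lborel" using Um U(1)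
          by (intro fmeasurableI) (auto simp: less_top[symmetric] intro: order_less_trans)
      qed (auto intro!: borel_open open_UN)
      also have "\<dots> < d" using Um d by (metis emeasure_eq_ennreal_measure ennreal_less_iff measure_nonneg top.not_eq_extremum order_less_trans ennreal_less_top)
      finally have lt: "(\<Sum>p\<in>B. up p - lo p) < d" .
      have "(\<Sum>i<card B. \<bar>f (up (w i)) - f (lo (w i))\<bar>) < e / 2"
      proof (rule dd[rule_format], intro conjI)
        show "\<forall>i<card B. lo (w i) \<le> up (w i) \<and> lo (w i) \<in> {a..b} \<and> up (w i) \<in> {a..b}"
        proof (intro allI impI)
          fix i assume "i < card B"
          from wB[OF this] have "w i \<in> D" "lo (w i) < up (w i)" by (auto simp: B_def)
          with intv(4,5)[OF this(1)] show "lo (w i) \<le> up (w i) \<and> lo (w i) \<in> {a..b} \<and> up (w i) \<in> {a..b}"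
            by simp
        qed
        show "\<forall>i<card B. \<forall>j<card B. i \<noteq> j \<longrightarrow> up (w i) \<le> lo (w j) \<or> up (w j) \<le> lo (w i)"
          using ord wB winj by blast
        show "(\<Sum>i<card B. up (w i) - lo (w i)) < d" using lt reB[of "\<lambda>p. up p - lo p"] by simp
      qed
      then have Bsum: "(\<Sum>p\<in>B. \<bar>f (up p) - f (lo p)\<bar>) < e / 2"
        using reB[of "\<lambda>p. \<bar>f (up p) - f (lo p)\<bar>"] by simp
      have tagged:  "\<bar>(up p - lo p) * g' (fst p) - (f (up p) - f (lo p))\<bar>
          \<le> e1 * (up p - lo p) + (if p \<in> B then \<bar>f (up p) - f (lo p)\<bar> else 0)" if p: "p \<in> D" for p
      proof (cases "fst p \<in> N")
        case True
        have "0 \<le> e1 * (up p - lo p)" using intv(2,3)[OF p] e1(1) by (intro mult_nonneg_nonneg) auto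
        moreover have "lo p < up p \<or> lo p = up p" using intv(2,3)[OF p] by linarith
        ultimately show ?thesis using True p
          by (cases "lo p < up p") (auto simp: g'_def B_def abs_minus_commute)
      next
        case False
        have "fst p \<in> {a..b}" using intv[OF p] by auto
        moreover have "{lo p..up p} \<subseteq> ball (fst p) (\<delta> (fst p))"
          using intv(1,6)[OF p] False by (simp add: \<gamma>_def)
        ultimately have "\<bar>f (up p) - f (lo p) - g (fst p) * (up p - lo p)\<bar> \<le> e1 * (up p - lo p)"
          using \<delta>(2) False intv[OF p] by blast
        then show ?thesis using False by (auto simp: g'_def B_def abs_minus_commute mult.commute)
      qed
      have "(\<Sum>(x, k)\<in>D. measure lborel k *\<^sub>R g' x) - (f b - f a)
          = (\<Sum>p\<in>D. (up p - lo p) * g' (fst p) - (f (up p) - f (lo p)))"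
        unfolding sum_subtractf tel[symmetric] case_prod_unfold using cont by simp
      also have "norm \<dots> \<le> (\<Sum>p\<in>D. e1 * (up p - lo p) + (if p \<in> B then \<bar>f (up p) - f (lo p)\<bar> else 0))"
        using tagged by (intro sum_norm_le) auto
      also have "\<dots> = e1 * (b - a) + (\<Sum>p\<in>B. \<bar>f (up p) - f (lo p)\<bar>)"
      proof -
        have "D \<inter> B = B" by (auto simp: B_def)
        then show ?thesis using finD
          by (simp add: sum.distrib sum_distrib_left[symmetric] tot sum.inter_restrict[symmetric])
      qed
      also have "\<dots> < e" using Bsum e1 by linarith
      finally show ?thesis .
    qed
    show "\<exists>\<gamma>. gauge \<gamma> \<and> (\<forall>D. D tagged_division_of {a..b} \<and> \<gamma> fine D \<longrightarrow>
        norm ((\<Sum>(x, k)\<in>D. measure lborel k *\<^sub>R g' x) - (f b - f a)) < e)"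
      by (intro exI[of _ \<gamma>] conjI gauge allI impI) (elim conjE, rule main)
  qed
  moreover have "negligible N"
    using N(2) by (simp add: negligible_iff_null_sets null_sets_completionI)
  ultimately show ?thesis
    by (rule has_integral_spike[rotated 2]) (auto simp: g'_def)
qed

lemma abs_cont_on_lincomb:
  assumes f: "abs_cont_on S f" and g: "abs_cont_on S g"
  shows "abs_cont_on S (\<lambda>x. f x + c * g x)"
  unfolding abs_cont_on_def
proof (intro allI impI)
  fix e :: real assume e: "e > 0"
  have e1: "e / 2 > 0" and e2: "e / (2 * (\<bar>c\<bar> + 1)) > 0" using e by (auto intro!: divide_pos_pos)
  from abs_cont_onD[OF f e1] obtain d1 where d1: "d1 > 0" and D1: "\<forall>(k::nat) a b.
        (\<forall>i<k. a i \<le> b i \<and> a i \<in> S \<and> b i \<in> S) \<and>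
        (\<forall>i<k. \<forall>j<k. i \<noteq> j \<longrightarrow> b i \<le> a j \<or> b j \<le> a i) \<and>
        (\<Sum>i<k. b i - a i) < d1 \<longrightarrow> (\<Sum>i<k. \<bar>f (b i) - f (a i)\<bar>) < e / 2" by (elim exE conjE)
  from abs_cont_onD[OF g e2] obtain d2 where d2: "d2 > 0" and D2: "\<forall>(k::nat) a b.
        (\<forall>i<k. a i \<le> b i \<and> a i \<in> S \<and> b i \<in> S) \<and>
        (\<forall>i<k. \<forall>j<k. i \<noteq> j \<longrightarrow> b i \<le> a j \<or> b j \<le> a i) \<and>
        (\<Sum>i<k. b i - a i) < d2 \<longrightarrow> (\<Sum>i<k. \<bar>g (b i) - g (a i)\<bar>) < e / (2 * (\<bar>c\<bar> + 1))" by (elim exE conjE)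
  show "\<exists>d>0. \<forall>(k::nat) a b. (\<forall>i<k. a i \<le> b i \<and> a i \<in> S \<and> b i \<in> S) \<and>
         (\<forall>i<k. \<forall>j<k. i \<noteq> j \<longrightarrow> b i \<le> a j \<or> b j \<le> a i) \<and> (\<Sum>i<k. b i - a i) < d \<longrightarrow>
         (\<Sum>i<k. \<bar>(f (b i) + c * g (b i)) - (f (a i) + c * g (a i))\<bar>) < e"
  proof (intro exI[of _ "min d1 d2"] conjI allI impI)
    fix k :: nat and a b
    assume A: "(\<forall>i<k. a i \<le> b i \<and> a i \<in> S \<and> b i \<in> S) \<and>
         (\<forall>i<k. \<forall>j<k. i \<noteq> j \<longrightarrow> b i \<le> a j \<or> b j \<le> a i) \<and> (\<Sum>i<k. b i - a i) < min d1 d2"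
    have 1: "(\<Sum>i<k. \<bar>f (b i) - f (a i)\<bar>) < e / 2" by (rule D1[rule_format]) (use A in simp)
    have 2: "(\<Sum>i<k. \<bar>g (b i) - g (a i)\<bar>) < e / (2 * (\<bar>c\<bar> + 1))" by (rule D2[rule_format]) (use A in simp)
    have "(\<Sum>i<k. \<bar>(f (b i) + c * g (b i)) - (f (a i) + c * g (a i))\<bar>)
        \<le> (\<Sum>i<k. \<bar>f (b i) - f (a i)\<bar> + \<bar>c\<bar> * \<bar>g (b i) - g (a i)\<bar>)"
    proof (rule sum_mono)
      fix i
      have "(f (b i) + c * g (b i)) - (f (a i) + c * g (a i)) = (f (b i) - f (a i)) + c * (g (b i) - g (a i))"
        by (simp add: algebra_simps)
      then show "\<bar>(f (b i) + c * g (b i)) - (f (a i) + c * g (a i))\<bar> \<le> \<bar>f (b i) - f (a i)\<bar> + \<bar>c\<bar> * \<bar>g (b i) - g (a i)\<bar>"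
        by (metis abs_mult abs_triangle_ineq)
    qed
    also have "\<dots> = (\<Sum>i<k. \<bar>f (b i) - f (a i)\<bar>) + \<bar>c\<bar> * (\<Sum>i<k. \<bar>g (b i) - g (a i)\<bar>)"
      by (simp add: sum.distrib sum_distrib_left)
    also have "\<dots> \<le> (\<Sum>i<k. \<bar>f (b i) - f (a i)\<bar>) + (\<bar>c\<bar> + 1) * (e / (2 * (\<bar>c\<bar> + 1)))"
      using 2 by (intro add_left_mono mult_mono) (auto intro: sum_nonneg)
    also have "(\<bar>c\<bar> + 1) * (e / (2 * (\<bar>c\<bar> + 1))) = e / 2"
    proof -
      have "\<bar>c\<bar> + 1 \<noteq> 0" by (metis abs_ge_zero add_nonneg_eq_0_iff zero_le_one zero_neq_one)
      then show ?thesis by (simp add: field_simps)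
    qed
    finally show "(\<Sum>i<k. \<bar>(f (b i) + c * g (b i)) - (f (a i) + c * g (a i))\<bar>) < e" using 1 by linarith
  qed (use d1 d2 in simp)
qed

lemma abs_cont_on_Lipschitz:
  assumes "\<And>x y. x \<in> S \<Longrightarrow> y \<in> S \<Longrightarrow> \<bar>f x - f y\<bar> \<le> L * \<bar>x - y\<bar>" "0 \<le> L"
  shows "abs_cont_on S f"
  unfolding abs_cont_on_def
proof (intro allI impI)
  fix e :: real assume e: "e > 0"
  show "\<exists>d>0. \<forall>(k::nat) a b. (\<forall>i<k. a i \<le> b i \<and> a i \<in> S \<and> b i \<in> S) \<and>
         (\<forall>i<k. \<forall>j<k. i \<noteq> j \<longrightarrow> b i \<le> a j \<or> b j \<le> a i) \<and> (\<Sum>i<k. b i - a i) < d \<longrightarrow>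
         (\<Sum>i<k. \<bar>f (b i) - f (a i)\<bar>) < e"
  proof (intro exI[of _ "e / (L + 1)"] conjI allI impI)
    fix k :: nat and a b
    assume A: "(\<forall>i<k. a i \<le> b i \<and> a i \<in> S \<and> b i \<in> S) \<and>
         (\<forall>i<k. \<forall>j<k. i \<noteq> j \<longrightarrow> b i \<le> a j \<or> b j \<le> a i) \<and> (\<Sum>i<k. b i - a i) < e / (L + 1)"
    have "(\<Sum>i<k. \<bar>f (b i) - f (a i)\<bar>) \<le> (\<Sum>i<k. L * (b i - a i))"
    proof (rule sum_mono)
      fix i assume "i \<in> {..<k}"
      with A assms(1)[of "b i" "a i"] show "\<bar>f (b i) - f (a i)\<bar> \<le> L * (b i - a i)" by auto
    qed
    also have "\<dots> = L * (\<Sum>i<k. b i - a i)" by (simp add: sum_distrib_left)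
    also have "\<dots> \<le> L * (e / (L + 1))" using A assms(2) by (intro mult_left_mono) auto
    also have "\<dots> < e" using e assms(2) by (simp add: field_simps)
    finally show "(\<Sum>i<k. \<bar>f (b i) - f (a i)\<bar>) < e" .
  qed (use e assms(2) in auto)
qed

lemma abs_cont_on_imp_continuous_on:
  assumes "abs_cont_on S f"
  shows "continuous_on S f"
  unfolding continuous_on_iff
proof (intro ballI allI impI)
  fix x e :: real assume x: "x \<in> S" and e: "e > 0"
  from abs_cont_onD[OF assms e] obtain d where d: "d > 0" and D: "\<forall>(k::nat) a b.
        (\<forall>i<k. a i \<le> b i \<and> a i \<in> S \<and> b i \<in> S) \<and>
        (\<forall>i<k. \<forall>j<k. i \<noteq> j \<longrightarrow> b i \<le> a j \<or> b j \<le> a i) \<and>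
        (\<Sum>i<k. b i - a i) < d \<longrightarrow> (\<Sum>i<k. \<bar>f (b i) - f (a i)\<bar>) < e" by (elim exE conjE)
  show "\<exists>d>0. \<forall>x'\<in>S. dist x' x < d \<longrightarrow> dist (f x') (f x) < e"
  proof (intro exI[of _ d] conjI ballI impI d)
    fix x' assume x': "x' \<in> S" "dist x' x < d"
    have "\<bar>f (max x x') - f (min x x')\<bar> < e"
      using D[rule_format, of 1 "\<lambda>_::nat. min x x'" "\<lambda>_. max x x'"] x x'
      by (cases "x \<le> x'") (simp_all add: dist_real_def max_def min_def)
    then show "dist (f x') (f x) < e"
      by (simp add: dist_real_def max_def min_def abs_minus_commute split: if_splits)
  qed
qed

lemma AE_lborel_imp_negligible:
  assumes "AE x in lborel. P x"
  obtains N where "negligible N" "\<And>x::real. x \<notin> N \<Longrightarrow> P x"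
proof (rule AE_E3[OF assms])
  fix N assume N: "\<And>x. x \<in> space lborel - N \<Longrightarrow> P x" "N \<in> null_sets lborel"
  show ?thesis
    by (rule that[of N]) (use N in \<open>auto simp: negligible_iff_null_sets null_sets_completionI\<close>)
qed

lemma continuous_on_AE_eq_imp_eq:
  fixes u v :: "real \<Rightarrow> real"
  assumes "continuous_on {0..1} u" "continuous_on {0..1} v"
    and ae: "AE x in lborel. x \<in> {0..1} \<longrightarrow> u x = v x" and "x \<in> {0..1}"
  shows "u x = v x"
proof -
  obtain N where N: "negligible N" "\<And>x. x \<notin> N \<Longrightarrow> x \<in> {0..1} \<longrightarrow> u x = v x"
    using AE_lborel_imp_negligible[OF ae] by blast
  have "((\<lambda>x. \<bar>u x - v x\<bar>) has_integral 0) {0..1}"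
    by (rule has_integral_spike[OF N(1) _ has_integral_0]) (use N(2) in auto)
  then have "integral {0..1} (\<lambda>x. \<bar>u x - v x\<bar>) = 0" by (rule integral_unique)
  moreover have "continuous_on {0..1} (\<lambda>x. \<bar>u x - v x\<bar>)" using assms by (intro continuous_intros)
  ultimately have "\<forall>x\<in>{0..1}. \<bar>u x - v x\<bar> = 0" by (subst (asm) integral_eq_0_iff) auto
  with assms show ?thesis by auto
qed

section \<open>Weak derivatives\<close>

lemma sobolev_witnessD:
  assumes "sobolev_witness m f D"
  shows "x \<in> {0..1} \<Longrightarrow> D 0 x = f x"
    and "j < m \<Longrightarrow> abs_cont_on {0..1} (D j)"
    and "j < m \<Longrightarrow> AE x in lborel. x \<in> {0..1} \<longrightarrow> (D j has_real_derivative D (Suc j) x) (at x)"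
    and "D m \<in> borel_measurable lborel"
    and "set_integrable lborel {0..1} (\<lambda>x. (D m x)\<^sup>2)"
  using assms unfolding sobolev_witness_def by simp_all

lemma sobolev_witness_cong:
  assumes "sobolev_witness m f D" "\<And>x. x \<in> {0..1} \<Longrightarrow> f x = g x"
  shows "sobolev_witness m g D"
  using assms unfolding sobolev_witness_def by simp

text \<open>Induction on j: if the j-th derivatives agree on the whole interval, the next ones agree
  almost everywhere, and below order m continuity upgrades this to all points. Hence the choice
  hidden in \<open>sderiv\<close> affects no integral over the interval.\<close>

lemma sobolev_witness_unique:
  assumes D: "sobolev_witness m f D" and E: "sobolev_witness m f E" and j: "j \<le> m"
  shows "AE x in lborel. x \<in> {0..1} \<longrightarrow> D j x = E j x"
    and "j < m \<Longrightarrow> x \<in> {0..1} \<Longrightarrow> D j x = E j x"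
proof -
  have "(AE x in lborel. x \<in> {0..1} \<longrightarrow> D j x = E j x) \<and> (j < m \<longrightarrow> (\<forall>x\<in>{0..1}. D j x = E j x))"
    using j
  proof (induction j)
    case 0
    have "D 0 x = E 0 x" if "x \<in> {0..1}" for x
      using sobolev_witnessD(1)[OF D that] sobolev_witnessD(1)[OF E that] by simp
    then show ?case by auto
  next
    case (Suc j)
    then have j: "j < m" and eq: "\<forall>x\<in>{0..1}. D j x = E j x" by auto
    \<comment> \<open>The derivatives of a witness are two-sided while agreement is known only on
      the interval, so at an endpoint they need not coincide.\<close>
    have "AE x in lborel. x \<noteq> (0::real)" "AE x in lborel. x \<noteq> (1::real)"
      by (rule AE_lborel_singleton)+
    with sobolev_witnessD(3)[OF D j] sobolev_witnessD(3)[OF E j]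
    have ae: "AE x in lborel. x \<in> {0..1} \<longrightarrow> D (Suc j) x = E (Suc j) x"
    proof eventually_elim
      case (elim x)
      show ?case
      proof
        assume x: "x \<in> {0..1}"
        with elim have xo: "x \<in> {0<..<1}" by auto
        have "(D j has_real_derivative D (Suc j) x) (at x)" using elim x by simp
        then have "(E j has_real_derivative D (Suc j) x) (at x)"
          by (rule has_field_derivative_transform_within_open[OF _ open_greaterThanLessThan xo]) (use eq in simp)
        moreover have "(E j has_real_derivative E (Suc j) x) (at x)" using elim x by simp
        ultimately show "D (Suc j) x = E (Suc j) x" by (rule DERIV_unique)
      qed
    qed
    moreover have "\<forall>x\<in>{0..1}. D (Suc j) x = E (Suc j) x" if "Suc j < m"
      using continuous_on_AE_eq_imp_eq[OF _ _ ae] that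
        abs_cont_on_imp_continuous_on[OF sobolev_witnessD(2)[OF D that]]
        abs_cont_on_imp_continuous_on[OF sobolev_witnessD(2)[OF E that]] by blast
    ultimately show ?case by blast
  qed
  then show "AE x in lborel. x \<in> {0..1} \<longrightarrow> D j x = E j x" "j < m \<Longrightarrow> x \<in> {0..1} \<Longrightarrow> D j x = E j x" by auto
qed

lemma set_integrable_mult_of_squares:
  fixes u v :: "real \<Rightarrow> real"
  assumes [measurable]: "u \<in> borel_measurable lborel" "v \<in> borel_measurable lborel" and A [measurable]: "A \<in> sets lborel"
    and "set_integrable lborel A (\<lambda>x. (u x)\<^sup>2)" "set_integrable lborel A (\<lambda>x. (v x)\<^sup>2)"
  shows "set_integrable lborel A (\<lambda>x. u x * v x)"
proof -
  have "set_integrable lborel A (\<lambda>x. (u x)\<^sup>2 + (v x)\<^sup>2)" using assms by (intro set_integral_add)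
  then show ?thesis
  proof (rule set_integrable_bound)
    show "set_borel_measurable lborel A (\<lambda>x. u x * v x)"
      unfolding set_borel_measurable_def by measurable
    have "norm (u x * v x) \<le> norm ((u x)\<^sup>2 + (v x)\<^sup>2)" for x
    proof -
      have "2 * \<bar>u x\<bar> * \<bar>v x\<bar> \<le> \<bar>u x\<bar>\<^sup>2 + \<bar>v x\<bar>\<^sup>2" by (rule sum_squares_bound)
      moreover have "0 \<le> \<bar>u x\<bar> * \<bar>v x\<bar>" by simp
      ultimately have "\<bar>u x\<bar> * \<bar>v x\<bar> \<le> (u x)\<^sup>2 + (v x)\<^sup>2" unfolding power2_abs by linarith
      then show ?thesis by (simp add: abs_mult)
    qed
    then show "AE x in lborel. x \<in> A \<longrightarrow> norm (u x * v x) \<le> norm ((u x)\<^sup>2 + (v x)\<^sup>2)" by simp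
  qed
qed

lemma sobolev_witness_lincomb:
  assumes D: "sobolev_witness m f D" and E: "sobolev_witness m g E"
  shows "sobolev_witness m (\<lambda>x. f x + c * g x) (\<lambda>j x. D j x + c * E j x)"
  unfolding sobolev_witness_def
proof (intro conjI ballI allI impI)
  show "D 0 x + c * E 0 x = f x + c * g x" if "x \<in> {0..1}" for x
    using sobolev_witnessD(1)[OF D that] sobolev_witnessD(1)[OF E that] by simp
  show "abs_cont_on {0..1} (\<lambda>x. D j x + c * E j x)" if "j < m" for j
    by (intro abs_cont_on_lincomb sobolev_witnessD(2)[OF D that] sobolev_witnessD(2)[OF E that])
  show "AE x in lborel. x \<in> {0..1} \<longrightarrow> ((\<lambda>x. D j x + c * E j x) has_real_derivative D (Suc j) x + c * E (Suc j) x) (at x)"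
    if "j < m" for j
    using sobolev_witnessD(3)[OF D that] sobolev_witnessD(3)[OF E that]
    by eventually_elim (auto intro!: derivative_eq_intros)
  note [measurable] = sobolev_witnessD(4)[OF D] sobolev_witnessD(4)[OF E]
  show "(\<lambda>x. D m x + c * E m x) \<in> borel_measurable lborel" by measurable
  have "set_integrable lborel {0..1} (\<lambda>x. (D m x)\<^sup>2 + (2 * c * (D m x * E m x) + c\<^sup>2 * (E m x)\<^sup>2))"
    using sobolev_witnessD(5)[OF D] sobolev_witnessD(5)[OF E]
    by (intro set_integral_add set_integrable_mult_right set_integrable_mult_of_squares) auto
  then show "set_integrable lborel {0..1} (\<lambda>x. (D m x + c * E m x)\<^sup>2)"
    by (simp add: power2_sum power_mult_distrib algebra_simps)
qed

lemma sobolevI: "sobolev_witness m f D \<Longrightarrow> f \<in> sobolev m"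
  by (auto simp: sobolev_def)

lemma sobolev_lincomb:
  assumes "f \<in> sobolev m" "g \<in> sobolev m"
  shows "(\<lambda>x. f x + c * g x) \<in> sobolev m"
  using assms unfolding sobolev_def by (auto intro: sobolev_witness_lincomb)

lemma sobolev_cong:
  assumes "f \<in> sobolev m" "\<And>x. x \<in> {0..1} \<Longrightarrow> f x = g x"
  shows "g \<in> sobolev m"
proof -
  obtain D where "sobolev_witness m f D" using assms by (auto simp: sobolev_def)
  from sobolev_witness_cong[OF this assms(2)] show ?thesis by (rule sobolevI)
qed

text \<open>By almost everywhere uniqueness any witnesses may stand in for the ones chosen in
  \<open>sderiv\<close>; this makes \<open>Jf\<close> computable from explicit derivatives.\<close>

lemma Jf_eq_integral:
  assumes D: "sobolev_witness m f D" and E: "sobolev_witness m g E"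
  shows "Jf m f g = (LINT x:{0..1}|lborel. D m x * E m x)"
proof -
  have sf: "sobolev_witness m f (SOME D. sobolev_witness m f D)" by (rule someI[of _ D]) fact
  have sg: "sobolev_witness m g (SOME D. sobolev_witness m g D)" by (rule someI[of _ E]) fact
  have mf [measurable]: "sderiv m f \<in> borel_measurable lborel" "sderiv m g \<in> borel_measurable lborel"
    unfolding sderiv_def using sobolev_witnessD(4)[OF sf] sobolev_witnessD(4)[OF sg] .
  note [measurable] = sobolev_witnessD(4)[OF D] sobolev_witnessD(4)[OF E]
  have "AE x in lborel. x \<in> {0..1} \<longrightarrow> sderiv m f x = D m x"
    unfolding sderiv_def by (rule sobolev_witness_unique(1)[OF sf D order_refl])
  moreover have "AE x in lborel. x \<in> {0..1} \<longrightarrow> sderiv m g x = E m x"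
    unfolding sderiv_def by (rule sobolev_witness_unique(1)[OF sg E order_refl])
  ultimately show ?thesis
    unfolding Jf_def set_lebesgue_integral_def
    by (intro integral_cong_AE) (measurable, auto elim!: eventually_rev_mp simp: indicator_def)
qed

lemma Jf_commute: "Jf m f g = Jf m g f"
  by (simp add: Jf_def mult.commute)

lemma Jf_nonneg: "0 \<le> Jf m f f"
  unfolding Jf_def set_lebesgue_integral_def by (rule Bochner_Integration.integral_nonneg) (simp add: indicator_def)

lemma Jf_lincomb:
  assumes "f \<in> sobolev m" "g \<in> sobolev m" "k \<in> sobolev m"
  shows "Jf m (\<lambda>x. f x + c * g x) k = Jf m f k + c * Jf m g k"
proof -
  obtain D E F where D: "sobolev_witness m f D" and E: "sobolev_witness m g E" and F: "sobolev_witness m k F"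
    using assms by (auto simp: sobolev_def)
  note [measurable] = sobolev_witnessD(4)[OF D] sobolev_witnessD(4)[OF E] sobolev_witnessD(4)[OF F]
  have i: "set_integrable lborel {0..1} (\<lambda>x. D m x * F m x)" "set_integrable lborel {0..1} (\<lambda>x. E m x * F m x)"
    using sobolev_witnessD(5)[OF D] sobolev_witnessD(5)[OF E] sobolev_witnessD(5)[OF F]
    by (auto intro!: set_integrable_mult_of_squares)
  have "Jf m (\<lambda>x. f x + c * g x) k = (LINT x:{0..1}|lborel. D m x * F m x + c * (E m x * F m x))"
    unfolding Jf_eq_integral[OF sobolev_witness_lincomb[OF D E] F] by (simp add: algebra_simps)
  also have "\<dots> = Jf m f k + c * Jf m g k"
    using i by (simp add: Jf_eq_integral[OF D F] Jf_eq_integral[OF E F] set_integral_add)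
  finally show ?thesis .
qed

lemma Jf_cong:
  assumes "f \<in> sobolev m" "g \<in> sobolev m"
    and "\<And>x. x \<in> {0..1} \<Longrightarrow> f x = f' x" "\<And>x. x \<in> {0..1} \<Longrightarrow> g x = g' x"
  shows "Jf m f' g' = Jf m f g"
proof -
  obtain D E where D: "sobolev_witness m f D" and E: "sobolev_witness m g E"
    using assms by (auto simp: sobolev_def)
  show ?thesis
    using Jf_eq_integral[OF D E] Jf_eq_integral[OF sobolev_witness_cong[OF D, of f'] sobolev_witness_cong[OF E, of g']] assms by simp
qed

lemma sobolev_continuous_on:
  assumes "f \<in> sobolev m" "m \<ge> 1"
  shows "continuous_on {0..1} f"
proof -
  obtain D where D: "sobolev_witness m f D" using assms by (auto simp: sobolev_def)
  have "continuous_on {0..1} (D 0)"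
    using assms by (intro abs_cont_on_imp_continuous_on sobolev_witnessD(2)[OF D]) auto
  then show ?thesis by (rule continuous_on_eq) (rule sobolev_witnessD(1)[OF D])
qed

lemma poly_sobolev_witness:
  fixes p :: "real poly"
  shows "sobolev_witness m (poly p) (\<lambda>j. poly ((pderiv ^^ j) p))"
  unfolding sobolev_witness_def
proof (intro conjI ballI allI impI)
  fix j
  let ?q = "(pderiv ^^ j) p"
  have "bounded (poly (pderiv ?q) ` {0..1})"
    by (intro compact_imp_bounded compact_continuous_image continuous_intros) auto
  then obtain L where L: "\<And>x. x \<in> {0..1} \<Longrightarrow> \<bar>poly (pderiv ?q) x\<bar> \<le> L"
    unfolding bounded_iff by (metis imageI real_norm_def)
  show "abs_cont_on {0..1} (poly ?q)"
  proof (rule abs_cont_on_Lipschitz)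
    show "0 \<le> L" using L[of 0] by simp
    fix x y :: real assume "x \<in> {0..1}" "y \<in> {0..1}"
    then show "\<bar>poly ?q x - poly ?q y\<bar> \<le> L * \<bar>x - y\<bar>"
      using field_differentiable_bound[of "{0..1}" "poly ?q" "poly (pderiv ?q)" L x y] L
      by (simp add: has_field_derivative_at_within[OF poly_DERIV])
  qed
  show "AE x in lborel. x \<in> {0..1} \<longrightarrow> (poly ((pderiv ^^ j) p) has_real_derivative poly ((pderiv ^^ Suc j) p) x) (at x)"
    by (simp add: poly_DERIV)
next
  let ?q = "(pderiv ^^ m) p"
  have c: "continuous_on UNIV (poly ?q)" by (intro continuous_intros)
  show "poly ?q \<in> borel_measurable lborel" using borel_measurable_continuous_onI[OF c] by simp
  show "set_integrable lborel {0..1} (\<lambda>x. (poly ?q x)\<^sup>2)"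
    by (intro borel_integrable_atLeastAtMost' continuous_intros)
qed simp

section \<open>Taylor remainder and the cut-off Sobolev space\<close>

text \<open>Cauchy-Schwarz on an interval of length 1: the variance of \<bar>u\<bar> is nonnegative,
  so the square of its mean c is at most the mean of u^2. The hypothesis is a gauge integral, the
  form in which increments of absolutely continuous functions are available.\<close>

lemma has_integral_abs_le_sqrt:
  fixes u :: "real \<Rightarrow> real"
  assumes [measurable]: "u \<in> borel_measurable lborel" and sq: "set_integrable lborel {0..1} (\<lambda>x. (u x)\<^sup>2)"
    and x: "x \<in> {0..1}" and s: "(u has_integral s) {0..x}"
  shows "\<bar>s\<bar> \<le> sqrt (LINT x:{0..1}|lborel. (u x)\<^sup>2)"
proof -
  have const: "set_integrable lborel {0..1::real} (\<lambda>x. c)" for c :: real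
    by (intro borel_integrable_atLeastAtMost' continuous_intros)
  have i1: "set_integrable lborel {0..1} (\<lambda>x. u x * 1)"
    using set_integrable_mult_of_squares[of u "\<lambda>_. 1" "{0..1}"] sq const[of 1] by simp
  then have i: "set_integrable lborel {0..1} u" by simp
  then have ia: "set_integrable lborel {0..1} (\<lambda>x. \<bar>u x\<bar>)" by (rule set_integrable_abs)
  define c where "c = (LINT x:{0..1}|lborel. \<bar>u x\<bar>)"
  have c0: "0 \<le> c" unfolding c_def set_lebesgue_integral_def
    by (rule Bochner_Integration.integral_nonneg) (simp add: indicator_def)
  have iac: "set_integrable lborel {0..1} (\<lambda>x. (- 2 * c) * \<bar>u x\<bar>)"
    using ia by (intro set_integrable_mult_right) auto
  have "0 \<le> (LINT x:{0..1}|lborel. (\<bar>u x\<bar> - c)\<^sup>2)"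
    unfolding set_lebesgue_integral_def by (rule Bochner_Integration.integral_nonneg) (simp add: indicator_def)
  also have "\<dots> = (LINT x:{0..1}|lborel. ((u x)\<^sup>2 + (- 2 * c) * \<bar>u x\<bar>) + c\<^sup>2)"
    by (simp add: power2_diff algebra_simps)
  also have "\<dots> = (LINT x:{0..1}|lborel. (u x)\<^sup>2 + (- 2 * c) * \<bar>u x\<bar>) + (LINT x:{0..1::real}|lborel. c\<^sup>2)"
    by (rule set_integral_add(2)[OF set_integral_add(1)[OF sq iac] const])
  also have "(LINT x:{0..1}|lborel. (u x)\<^sup>2 + (- 2 * c) * \<bar>u x\<bar>) = (LINT x:{0..1}|lborel. (u x)\<^sup>2) + (LINT x:{0..1}|lborel. (- 2 * c) * \<bar>u x\<bar>)"
    by (rule set_integral_add(2)[OF sq iac])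
  also have "(LINT x:{0..1}|lborel. (- 2 * c) * \<bar>u x\<bar>) = (- 2 * c) * c"
    unfolding c_def by (rule set_integral_mult_right)
  also have "(LINT x:{0..1::real}|lborel. c\<^sup>2) = c\<^sup>2"
    by (simp add: set_lebesgue_integral_def)
  finally have "c\<^sup>2 \<le> (LINT x:{0..1}|lborel. (u x)\<^sup>2)" by (simp add: power2_eq_square)
  then have c: "c \<le> sqrt (LINT x:{0..1}|lborel. (u x)\<^sup>2)" using c0 by (simp add: real_le_rsqrt)
  have ix: "set_integrable lborel {0..x} u" using x by (intro set_integrable_subset[OF i]) auto
  have iax: "set_integrable lborel {0..x} (\<lambda>x. \<bar>u x\<bar>)" by (rule set_integrable_abs[OF ix])
  have "s = (LINT x:{0..x}|lborel. u x)"
    using set_borel_integral_eq_integral(2)[OF ix] integral_unique[OF s] by simp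
  also have "\<bar>\<dots>\<bar> \<le> (LINT x:{0..x}|lborel. \<bar>u x\<bar>)"
    using integral_norm_bound[of lborel "\<lambda>y. indicator {0..x} y *\<^sub>R u y"]
    by (simp add: set_lebesgue_integral_def abs_mult)
  also have "\<dots> \<le> c"
    unfolding c_def set_lebesgue_integral_def
    using ia iax x unfolding set_integrable_def by (intro integral_mono) (auto simp: indicator_def)
  finally show ?thesis using c by linarith
qed

text \<open>Descending from the m-th derivative, each integration from 0 raises the degree of the
  approximating polynomial by one. The error bound survives unchanged because the intervals {0..x}
  have length at most 1.\<close>

lemma sobolev_Taylor:
  assumes f: "f \<in> sobolev m" and m: "m \<ge> 1"
  shows "\<exists>c. \<forall>x\<in>{0..1}. \<bar>f x - (\<Sum>i<m. c i * x ^ i)\<bar> \<le> sqrt (Jf m f f)"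
proof -
  obtain D where D: "sobolev_witness m f D" using f by (auto simp: sobolev_def)
  define R where "R = sqrt (Jf m f f)"
  have R0: "R \<ge> 0" using Jf_nonneg by (simp add: R_def)
  have R: "R = sqrt (LINT x:{0..1}|lborel. (D m x)\<^sup>2)"
    by (simp add: R_def Jf_eq_integral[OF D D] power2_eq_square)
  have ftc: "(D (Suc j) has_integral D j x - D j 0) {0..x}" if j: "j < m" and x: "x \<in> {0..1}" for j x
  proof (rule abs_cont_has_integral)
    show "abs_cont_on {0..x} (D j)" by (rule abs_cont_on_subset[OF sobolev_witnessD(2)[OF D j]]) (use x in auto)
    show "AE x' in lborel. x' \<in> {0..x} \<longrightarrow> (D j has_real_derivative D (Suc j) x') (at x')"
      using sobolev_witnessD(3)[OF D j] x by (auto elim!: eventually_mono)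
  qed (use x in auto)
  have "\<exists>c. \<forall>x\<in>{0..1}. \<bar>D (m - k) x - (\<Sum>i<k. c i * x ^ i)\<bar> \<le> R" if "1 \<le> k" "k \<le> m" for k
    using that
  proof (induction k rule: nat_induct_at_least)
    case base
    show ?case
    proof (intro exI[of _ "\<lambda>_. D (m - 1) 0"] ballI)
      fix x :: real assume x: "x \<in> {0..1}"
      have "(D m has_integral D (m - 1) x - D (m - 1) 0) {0..x}" using ftc[of "m - 1" x] x m by simp
      from has_integral_abs_le_sqrt[OF sobolev_witnessD(4,5)[OF D] x this]
      show "\<bar>D (m - 1) x - (\<Sum>i<1. D (m - 1) 0 * x ^ i)\<bar> \<le> R" by (simp add: R)
    qed
  next
    case (Suc k)
    then obtain c where c: "\<And>x. x \<in> {0..1} \<Longrightarrow> \<bar>D (m - k) x - (\<Sum>i<k. c i * x ^ i)\<bar> \<le> R" by (meson Suc_leD)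
    define j where "j = m - Suc k"
    have j: "j < m" "Suc j = m - k" using Suc by (auto simp: j_def)
    \<comment> \<open>Coefficients of the antiderivative of the previous polynomial, with
      \<open>D j 0\<close> as the new constant term.\<close>
    define c' where "c' = (\<lambda>i. case i of 0 \<Rightarrow> D j 0 | Suc i \<Rightarrow> c i / (real i + 1))"
    show ?case
    proof (intro exI[of _ c'] ballI)
      fix x :: real assume x: "x \<in> {0..1}"
      define Q where "Q = (\<lambda>x. \<Sum>i<k. c i / (real i + 1) * x ^ Suc i)"
      have "(Q has_real_derivative (\<Sum>i<k. c i * y ^ i)) (at y within S)" for y S
        unfolding Q_def
        by (rule DERIV_sum) (auto intro!: derivative_eq_intros simp del: power_Suc simp: add.commute)
      then have "((\<lambda>y. \<Sum>i<k. c i * y ^ i) has_integral (Q x - Q 0)) {0..x}"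
        using x by (intro fundamental_theorem_of_calculus)
          (auto simp: has_real_derivative_iff_has_vector_derivative[symmetric])
      then have "((\<lambda>y. D (Suc j) y - (\<Sum>i<k. c i * y ^ i)) has_integral (D j x - D j 0 - (Q x - Q 0))) {0..x}"
        by (intro has_integral_diff ftc j x)
      then have "norm (D j x - D j 0 - (Q x - Q 0)) \<le> R * measure lborel {0..x}"
        by (rule has_integral_bound_real[OF R0 finite.emptyI]) (use c j x in auto)
      also have "\<dots> \<le> R" using x R0 by (simp add: mult_left_le)
      finally have "\<bar>D j x - D j 0 - (Q x - Q 0)\<bar> \<le> R" by simp
      moreover have "(\<Sum>i<Suc k. c' i * x ^ i) = D j 0 + Q x"
        by (subst sum.lessThan_Suc_shift) (simp add: c'_def Q_def)
      moreover have "Q 0 = 0" by (simp add: Q_def)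
      ultimately show "\<bar>D (m - Suc k) x - (\<Sum>i<Suc k. c' i * x ^ i)\<bar> \<le> R"
        by (simp add: j_def[symmetric] algebra_simps)
    qed
  qed
  from this[of m] m obtain c where "\<forall>x\<in>{0..1}. \<bar>D 0 x - (\<Sum>i<m. c i * x ^ i)\<bar> \<le> R" by auto
  then have "\<bar>f x - (\<Sum>i<m. c i * x ^ i)\<bar> \<le> R" if "x \<in> {0..1}" for x
    using sobolev_witnessD(1)[OF D that] that by metis
  then show ?thesis unfolding R_def by blast
qed

text \<open>Members of \<open>sobolev m\<close> are unconstrained, possibly not even measurable, outside the unit interval,
  where the integral \<open>Vf\<close> may then be the junk value 0. Cutting them off repairs this.\<close>

definition cut01 :: "(real \<Rightarrow> real) \<Rightarrow> real \<Rightarrow> real" where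
  "cut01 f x = (if x \<in> {0..1} then f x else 0)"

definition sobolev0 :: "nat \<Rightarrow> (real \<Rightarrow> real) set" where
  "sobolev0 m = {f \<in> sobolev m. \<forall>x. x \<notin> {0..1} \<longrightarrow> f x = 0}"

lemma cut01_eq [simp]: "x \<in> {0..1} \<Longrightarrow> cut01 f x = f x"
  by (simp add: cut01_def)

lemma sobolev0D: "f \<in> sobolev0 m \<Longrightarrow> f \<in> sobolev m" "f \<in> sobolev0 m \<Longrightarrow> x \<notin> {0..1} \<Longrightarrow> f x = 0"
  by (auto simp: sobolev0_def)

lemma cut01_in_sobolev0: "f \<in> sobolev m \<Longrightarrow> cut01 f \<in> sobolev0 m"
  unfolding sobolev0_def by (auto intro: sobolev_cong simp: cut01_def)

lemma sobolev0_lincomb: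
  "f \<in> sobolev0 m \<Longrightarrow> g \<in> sobolev0 m \<Longrightarrow> (\<lambda>x. f x + c * g x) \<in> sobolev0 m"
  unfolding sobolev0_def by (simp add: sobolev_lincomb)

section \<open>The uniform design and the form \<open>Vf\<close>\<close>

lemma prob_space_unifI: "prob_space unifI"
  unfolding unifI_def by (rule prob_space_uniform_measure) auto

lemma sets_unifI [measurable_cong, simp]: "sets unifI = sets borel"
  by (simp add: unifI_def)

lemma space_unifI [simp]: "space unifI = UNIV"
  by (simp add: unifI_def)

lemma AE_unifI: "AE x in unifI. x \<in> {0..1}"
  unfolding unifI_def by (rule AE_uniform_measureI) auto

lemma sobolev0_measurable [measurable_dest]:
  assumes "f \<in> sobolev0 m" "m \<ge> 1"
  shows "f \<in> borel_measurable borel"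
proof -
  have "(\<lambda>x. indicator {0..1} x *\<^sub>R f x) \<in> borel_measurable borel"
    using assms by (intro borel_measurable_continuous_on_indicator sobolev_continuous_on[of _ m]) (auto dest: sobolev0D)
  also have "(\<lambda>x. indicator {0..1} x *\<^sub>R f x) = f"
    using assms(1) by (auto simp: fun_eq_iff indicator_def sobolev0_def)
  finally show ?thesis .
qed

lemma sobolev0_bounded:
  assumes "f \<in> sobolev0 m" "m \<ge> 1"
  shows "\<exists>C\<ge>0. \<forall>x. \<bar>f x\<bar> \<le> C"
proof -
  have "bounded (f ` {0..1})"
    using sobolev_continuous_on[OF sobolev0D(1)[OF assms(1)] assms(2)]
    by (intro compact_imp_bounded compact_continuous_image) auto
  then obtain C where C: "\<And>x. x \<in> {0..1} \<Longrightarrow> \<bar>f x\<bar> \<le> C"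
    unfolding bounded_iff by (metis imageI real_norm_def)
  have C0: "0 \<le> C" using C[of 0] by simp
  have "\<bar>f x\<bar> \<le> C" for x
    using C[of x] sobolev0D(2)[OF assms(1), of x] C0 by (cases "x \<in> {0..1}") auto
  with C0 show ?thesis by blast
qed

lemma sobolev0_integrable_mult:
  assumes "f \<in> sobolev0 m" "g \<in> sobolev0 m" "m \<ge> 1"
  shows "integrable unifI (\<lambda>x. f x * g x)"
proof -
  interpret prob_space unifI by (rule prob_space_unifI)
  obtain C where C: "C \<ge> 0" "\<And>x. \<bar>f x\<bar> \<le> C" using sobolev0_bounded[OF assms(1,3)] by blast
  obtain C' where C': "C' \<ge> 0" "\<And>x. \<bar>g x\<bar> \<le> C'" using sobolev0_bounded[OF assms(2,3)] by blast
  have [measurable]: "f \<in> borel_measurable borel" "g \<in> borel_measurable borel"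
    using assms by (auto intro: sobolev0_measurable)
  show ?thesis
    by (rule integrable_const_bound[of _ "C * C'"])
       (auto simp: abs_mult intro!: mult_mono C C' AE_I2)
qed

lemma Vf_commute: "Vf f g = Vf g f"
  by (simp add: Vf_def mult.commute)

lemma Vf_nonneg: "0 \<le> Vf f f"
  unfolding Vf_def by (rule Bochner_Integration.integral_nonneg) simp

lemma Vf_lincomb:
  assumes "f \<in> sobolev0 m" "g \<in> sobolev0 m" "k \<in> sobolev0 m" "m \<ge> 1"
  shows "Vf (\<lambda>x. f x + c * g x) k = Vf f k + c * Vf g k"
proof -
  have "Vf (\<lambda>x. f x + c * g x) k = (\<integral>x. f x * k x + c * (g x * k x) \<partial>unifI)"
    by (simp add: Vf_def algebra_simps)
  also have "\<dots> = Vf f k + c * Vf g k"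
    unfolding Vf_def using sobolev0_integrable_mult assms by (subst Bochner_Integration.integral_add) auto
  finally show ?thesis .
qed

text \<open>The second factor already kills the product off the interval, so equality holds even
  when \<open>f\<close> is not measurable.\<close>

lemma Vf_cut01_right:
  assumes "g \<in> sobolev0 m"
  shows "Vf f g = Vf (cut01 f) g"
proof -
  have "(\<lambda>x. f x * g x) = (\<lambda>x. cut01 f x * g x)"
    using assms by (auto simp: fun_eq_iff cut01_def sobolev0_def)
  then show ?thesis by (simp add: Vf_def)
qed

text \<open>Either the square is measurable and both sides agree, or the left side is the default
  value 0 of a non-integrable function. In this direction a norm bound for the cut-off error carries
  over to the error itself.\<close>

lemma Vf_le_cut01:
  assumes "f \<in> sobolev m" "m \<ge> 1"
  shows "Vf f f \<le> Vf (cut01 f) (cut01 f)"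
proof (cases "(\<lambda>x. f x * f x) \<in> borel_measurable unifI")
  case True
  have [measurable]: "cut01 f \<in> borel_measurable borel"
    by (rule sobolev0_measurable[OF cut01_in_sobolev0[OF assms(1)] assms(2)])
  have "Vf f f = Vf (cut01 f) (cut01 f)"
    unfolding Vf_def
  proof (rule integral_cong_AE)
    show "AE x in unifI. f x * f x = cut01 f x * cut01 f x" using AE_unifI by eventually_elim simp
  qed (use True in auto)
  then show ?thesis by simp
next
  case False
  then have "\<not> integrable unifI (\<lambda>x. f x * f x)" using borel_measurable_integrable by blast
  then have "Vf f f = 0" unfolding Vf_def by (rule not_integrable_integral_eq)
  then show ?thesis using Vf_nonneg[of "cut01 f"] by simp
qed

lemma Vf_le_square:
  assumes "f \<in> sobolev0 m" "m \<ge> 1" "\<And>x. x \<in> {0..1} \<Longrightarrow> \<bar>f x\<bar> \<le> c"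
  shows "Vf f f \<le> c\<^sup>2"
proof -
  interpret prob_space unifI by (rule prob_space_unifI)
  have "Vf f f \<le> (\<integral>x. c\<^sup>2 \<partial>unifI)"
    unfolding Vf_def
  proof (rule integral_mono_AE)
    show "AE x in unifI. f x * f x \<le> c\<^sup>2"
      using AE_unifI
    proof eventually_elim
      case (elim x)
      from power_mono[OF assms(3)[OF elim], of 2] show ?case by (simp add: power2_eq_square)
    qed
  qed (use sobolev0_integrable_mult assms in auto)
  also have "\<dots> = c\<^sup>2" using prob_space by simp
  finally show ?thesis .
qed

section \<open>Orthonormal sequences of functions\<close>

text \<open>The inner product lives on a set of functions rather than on a type, because the space
  depends on \<open>m\<close> and the form also on \<open>lam\<close>. Definiteness as an identity
  on the whole line is met by functions that vanish off the interval.\<close>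

locale function_inner_space =
  fixes W :: "(real \<Rightarrow> real) set" and ip :: "(real \<Rightarrow> real) \<Rightarrow> (real \<Rightarrow> real) \<Rightarrow> real"
  assumes zero_mem: "(\<lambda>_. 0) \<in> W"
    and lincomb_mem: "f \<in> W \<Longrightarrow> g \<in> W \<Longrightarrow> (\<lambda>x. f x + c * g x) \<in> W"
    and ip_lincomb: "f \<in> W \<Longrightarrow> g \<in> W \<Longrightarrow> k \<in> W \<Longrightarrow> ip (\<lambda>x. f x + c * g x) k = ip f k + c * ip g k"
    and ip_commute: "ip f g = ip g f"
    and ip_nonneg: "0 \<le> ip f f"
    and ip_definite: "f \<in> W \<Longrightarrow> ip f f = 0 \<Longrightarrow> f = (\<lambda>_. 0)"
begin

lemma scale_mem: "f \<in> W \<Longrightarrow> (\<lambda>x. c * f x) \<in> W"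
  using lincomb_mem[OF zero_mem, of f c] by simp

lemma diff_mem: "f \<in> W \<Longrightarrow> g \<in> W \<Longrightarrow> (\<lambda>x. f x - g x) \<in> W"
  using lincomb_mem[of f g "-1"] by simp

lemma ip_zero: "k \<in> W \<Longrightarrow> ip (\<lambda>_. 0) k = 0"
  using ip_lincomb[OF zero_mem zero_mem, of k 1] by simp

lemma ip_scale: "f \<in> W \<Longrightarrow> k \<in> W \<Longrightarrow> ip (\<lambda>x. c * f x) k = c * ip f k"
  using ip_lincomb[OF zero_mem, of f k c] ip_zero[of k] by simp

lemma ip_diff: "f \<in> W \<Longrightarrow> g \<in> W \<Longrightarrow> k \<in> W \<Longrightarrow> ip (\<lambda>x. f x - g x) k = ip f k - ip g k"
  using ip_lincomb[of f g k "-1"] by simp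

lemma sum_mem: "(\<And>i. i \<in> A \<Longrightarrow> f i \<in> W) \<Longrightarrow> (\<lambda>x. \<Sum>i\<in>A. c i * f i x) \<in> W"
proof (induction A rule: infinite_finite_induct)
  case (insert a A)
  then have "(\<lambda>x. (\<Sum>i\<in>A. c i * f i x) + c a * f a x) \<in> W" by (intro lincomb_mem) auto
  with insert show ?case by (simp add: add.commute)
qed (simp_all add: zero_mem)

lemma ip_sum:
  "(\<And>i. i \<in> A \<Longrightarrow> f i \<in> W) \<Longrightarrow> k \<in> W \<Longrightarrow> ip (\<lambda>x. \<Sum>i\<in>A. c i * f i x) k = (\<Sum>i\<in>A. c i * ip (f i) k)"
proof (induction A rule: infinite_finite_induct)
  case (insert a A)
  have "ip (\<lambda>x. (\<Sum>i\<in>A. c i * f i x) + c a * f a x) k = ip (\<lambda>x. \<Sum>i\<in>A. c i * f i x) k + c a * ip (f a) k"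
    using insert by (intro ip_lincomb sum_mem) auto
  with insert show ?case by (simp add: add.commute)
qed (simp_all add: ip_zero)

lemma ip_diff_self:
  assumes "f \<in> W" "g \<in> W"
  shows "ip (\<lambda>x. f x - g x) (\<lambda>x. f x - g x) = ip f f - 2 * ip f g + ip g g"
  using assms
  by (simp add: ip_diff diff_mem ip_commute[of f "\<lambda>x. f x - g x"] ip_commute[of g "\<lambda>x. f x - g x"] ip_commute[of g f])

lemma ip_Cauchy_Schwarz:
  assumes "f \<in> W" "g \<in> W"
  shows "(ip f g)\<^sup>2 \<le> ip f f * ip g g"
proof (cases "ip g g = 0")
  case True
  from ip_definite[OF assms(2) True] have "ip f g = 0"
    using ip_zero[OF assms(1)] ip_commute[of f g] by simp
  with True show ?thesis by simp
next
  case False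
  then have pos: "ip g g > 0" using ip_nonneg[of g] by simp
  define c where "c = ip f g / ip g g"
  have "0 \<le> ip (\<lambda>x. f x - c * g x) (\<lambda>x. f x - c * g x)" by (rule ip_nonneg)
  also have "\<dots> = ip f f - 2 * ip f (\<lambda>x. c * g x) + ip (\<lambda>x. c * g x) (\<lambda>x. c * g x)"
    using assms by (intro ip_diff_self scale_mem)
  also have "ip f (\<lambda>x. c * g x) = c * ip f g"
    using assms ip_scale[of g f c] by (simp add: ip_commute[of f])
  also have "ip (\<lambda>x. c * g x) (\<lambda>x. c * g x) = c * (c * ip g g)"
    using assms ip_scale[of g g c] ip_scale[of g "\<lambda>x. c * g x" c] by (simp add: scale_mem ip_commute[of g "\<lambda>x. c * g x"])
  finally have "0 \<le> ip f f - (ip f g)\<^sup>2 / ip g g" using pos by (simp add: c_def power2_eq_square)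
  then show ?thesis using pos by (simp add: field_simps)
qed

lemma ip_Cauchy_Schwarz_abs: "f \<in> W \<Longrightarrow> g \<in> W \<Longrightarrow> \<bar>ip f g\<bar> \<le> sqrt (ip f f) * sqrt (ip g g)"
  using ip_Cauchy_Schwarz[of f g] by (metis real_sqrt_abs real_sqrt_le_mono real_sqrt_mult)

end

text \<open>Gram-Schmidt. A vector depending on its predecessors is mapped to 0, because \<open>x / 0 = 0\<close>.\<close>

function gram_schmidt :: "((real \<Rightarrow> real) \<Rightarrow> (real \<Rightarrow> real) \<Rightarrow> real) \<Rightarrow> (nat \<Rightarrow> real \<Rightarrow> real) \<Rightarrow> nat \<Rightarrow> real \<Rightarrow> real" where
  "gram_schmidt ip b n =
     (let r = (\<lambda>x. b n x - (\<Sum>j\<in>{..<n}. ip (b n) (gram_schmidt ip b j) * gram_schmidt ip b j x))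
      in (\<lambda>x. 1 / sqrt (ip r r) * r x))"
  by auto
termination by (relation "Wellfounded.measure (\<lambda>(_, _, n). n)") auto

declare gram_schmidt.simps [simp del]

locale gram_schmidt_basis = function_inner_space +
  fixes b :: "nat \<Rightarrow> real \<Rightarrow> real"
  assumes b_mem: "b n \<in> W"
begin

abbreviation e :: "nat \<Rightarrow> real \<Rightarrow> real" where "e \<equiv> gram_schmidt ip b"

definition residual :: "nat \<Rightarrow> real \<Rightarrow> real" where
  "residual n = (\<lambda>x. b n x - (\<Sum>j<n. ip (b n) (e j) * e j x))"

lemma e_eq: "e n = (\<lambda>x. 1 / sqrt (ip (residual n) (residual n)) * residual n x)"
  by (subst gram_schmidt.simps) (simp add: residual_def Let_def)

lemma e_mem: "e n \<in> W"
proof (induction n rule: less_induct)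
  case (less n)
  have "residual n \<in> W" unfolding residual_def using less by (intro diff_mem sum_mem b_mem) auto
  then show ?case unfolding e_eq by (rule scale_mem)
qed

lemma residual_mem: "residual n \<in> W"
  unfolding residual_def by (intro diff_mem sum_mem b_mem e_mem)

lemma residual_eq: "residual n x = sqrt (ip (residual n) (residual n)) * e n x"
proof (cases "ip (residual n) (residual n) = 0")
  case True
  then show ?thesis using ip_definite[OF residual_mem True] by simp
qed (simp add: e_eq[of n])

lemma ip_e_self: "ip (e n) (e n) = 1 \<or> e n = (\<lambda>_. 0)"
proof (cases "ip (residual n) (residual n) = 0")
  case True
  then show ?thesis by (simp add: e_eq[of n])
next
  case False
  define c where "c = 1 / sqrt (ip (residual n) (residual n))"
  have pos: "ip (residual n) (residual n) > 0" using False ip_nonneg[of "residual n"] by simp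
  have "ip (e n) (e n) = c * (c * ip (residual n) (residual n))"
    unfolding e_eq c_def[symmetric]
    using ip_scale[OF residual_mem scale_mem[OF residual_mem], of c n c n] ip_scale[OF residual_mem residual_mem, of c n n]
    by (simp add: ip_commute[of "residual n" "\<lambda>x. c * residual n x"])
  also have "\<dots> = 1" using pos by (simp add: c_def field_simps)
  finally show ?thesis by simp
qed

lemma ip_e_orthogonal: "i < j \<Longrightarrow> ip (e j) (e i) = 0"
proof (induction j arbitrary: i rule: less_induct)
  case (less j)
  have orth: "ip (e k) (e i) = 0" if "k < j" "k \<noteq> i" for k
    using less.IH[of k i] less.IH[of i k] less.prems that ip_commute[of "e k" "e i"] by (cases "k < i") auto
  have "ip (residual j) (e i) = ip (b j) (e i) - (\<Sum>k<j. ip (b j) (e k) * ip (e k) (e i))"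
    unfolding residual_def by (subst ip_diff) (auto intro!: sum_mem b_mem e_mem ip_sum)
  also have "(\<Sum>k<j. ip (b j) (e k) * ip (e k) (e i)) = (\<Sum>k\<in>{i}. ip (b j) (e k) * ip (e k) (e i))"
    using less.prems orth by (intro sum.mono_neutral_right) auto
  also have "\<dots> = ip (b j) (e i)"
    using ip_e_self[of i] ip_zero[OF b_mem, of j] ip_commute[of "b j" "e i"] by auto
  finally have "ip (residual j) (e i) = 0" by simp
  then show ?case unfolding e_eq[of j] ip_scale[OF residual_mem e_mem] by simp
qed

lemma ip_e: "i \<noteq> j \<Longrightarrow> ip (e i) (e j) = 0"
  using ip_e_orthogonal[of i j] ip_e_orthogonal[of j i] ip_commute[of "e i" "e j"] by (cases "i < j") auto

lemma ip_e_self_le: "0 \<le> ip (e n) (e n)" "ip (e n) (e n) \<le> 1"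
  using ip_e_self[of n] ip_nonneg[of "e n"] ip_zero[OF zero_mem] by auto

text \<open>A Gram-Schmidt vector has squared norm 1 or is zero, and in the latter case its
  coefficient vanishes too. Absorbing the factor keeps the expansion formulas uniform over both
  cases.\<close>

lemma ip_e_absorb: "f \<in> W \<Longrightarrow> ip f (e n) * ip (e n) (e n) = ip f (e n)"
  using ip_e_self[of n] ip_zero[of f] ip_commute[of f "e n"] by auto

lemma b_eq: "b n x = (\<Sum>j<Suc n. (if j = n then sqrt (ip (residual n) (residual n)) else ip (b n) (e j)) * e j x)"
  using residual_eq[of n x] by (simp add: residual_def)

definition comb :: "nat \<Rightarrow> (nat \<Rightarrow> real) \<Rightarrow> real \<Rightarrow> real" where
  "comb N c = (\<lambda>x. \<Sum>k<N. c k * e k x)"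

lemma comb_mem: "comb N c \<in> W"
  unfolding comb_def by (intro sum_mem e_mem)

lemma ip_comb: "f \<in> W \<Longrightarrow> ip (comb N c) f = (\<Sum>k<N. c k * ip (e k) f)"
  unfolding comb_def by (intro ip_sum e_mem)

lemma ip_comb_e: "k < N \<Longrightarrow> ip (comb N c) (e k) = c k * ip (e k) (e k)"
proof -
  assume k: "k < N"
  have "ip (comb N c) (e k) = (\<Sum>j<N. c j * ip (e j) (e k))" by (intro ip_comb e_mem)
  also have "\<dots> = (\<Sum>j\<in>{k}. c j * ip (e j) (e k))"
    using k by (intro sum.mono_neutral_right) (auto simp: ip_e)
  finally show ?thesis by simp
qed

lemma ip_comb_self: "ip (comb N c) (comb N c) = (\<Sum>k<N. (c k)\<^sup>2 * ip (e k) (e k))"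
  by (simp add: ip_comb[OF comb_mem] ip_commute[of "e _" "comb N c"] ip_comb_e power2_eq_square mult.assoc)

lemma ip_comb_self_le: "ip (comb N c) (comb N c) \<le> (\<Sum>k<N. (c k)\<^sup>2)"
  unfolding ip_comb_self using ip_e_self_le by (intro sum_mono mult_left_le) auto

definition proj :: "nat \<Rightarrow> (real \<Rightarrow> real) \<Rightarrow> real \<Rightarrow> real" where
  "proj N f = comb N (\<lambda>k. ip f (e k))"

lemma ip_proj_self: "f \<in> W \<Longrightarrow> ip (proj N f) (proj N f) = (\<Sum>k<N. (ip f (e k))\<^sup>2)"
  unfolding proj_def ip_comb_self by (intro sum.cong) (simp_all add: power2_eq_square ip_e_absorb mult.assoc)

lemma ip_diff_proj_e:
  assumes "f \<in> W" "k < N"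
  shows "ip (\<lambda>x. f x - proj N f x) (e k) = 0"
  using assms ip_diff[OF assms(1) comb_mem e_mem] by (simp add: proj_def ip_comb_e ip_e_absorb)

text \<open>Pythagoras: the remainder of the projection is orthogonal to every combination of the
  first N vectors. Thus approximability by arbitrary combinations makes the projections
  converge.\<close>

lemma ip_diff_proj_le:
  assumes f: "f \<in> W"
  shows "ip (\<lambda>x. f x - proj N f x) (\<lambda>x. f x - proj N f x) \<le> ip (\<lambda>x. f x - comb N c x) (\<lambda>x. f x - comb N c x)"
proof -
  define p where "p = (\<lambda>x. f x - proj N f x)"
  define d where "d = (\<lambda>k. c k - ip f (e k))"
  have p: "p \<in> W" unfolding p_def proj_def by (intro diff_mem f comb_mem)
  have "(\<lambda>x. f x - comb N c x) = (\<lambda>x. p x - comb N d x)"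
    by (simp add: fun_eq_iff p_def proj_def comb_def d_def algebra_simps sum_subtractf)
  then have "ip (\<lambda>x. f x - comb N c x) (\<lambda>x. f x - comb N c x) = ip p p - 2 * ip p (comb N d) + ip (comb N d) (comb N d)"
    by (simp add: ip_diff_self p comb_mem)
  moreover have "ip p (comb N d) = 0"
  proof -
    have "ip (e k) p = 0" if "k < N" for k
      using ip_diff_proj_e[OF f that] by (simp add: p_def ip_commute[of "e k"])
    then show ?thesis by (simp add: ip_commute[of p "comb N d"] ip_comb[OF p])
  qed
  ultimately show ?thesis using ip_nonneg[of "comb N d"] by (simp add: p_def)
qed

lemma Bessel:
  assumes f: "f \<in> W"
  shows "(\<Sum>k<N. (ip f (e k))\<^sup>2) \<le> ip f f"
proof -
  have "ip f (proj N f) = (\<Sum>k<N. (ip f (e k))\<^sup>2)"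
    using f by (simp add: proj_def ip_commute[of f "comb N _"] ip_comb ip_commute[of "e _" f] power2_eq_square)
  then have "ip (\<lambda>x. f x - proj N f x) (\<lambda>x. f x - proj N f x) = ip f f - (\<Sum>k<N. (ip f (e k))\<^sup>2)"
    using ip_diff_self[OF f, of "proj N f"] ip_proj_self[OF f, of N] comb_mem by (simp add: proj_def)
  then show ?thesis using ip_nonneg[of "\<lambda>x. f x - proj N f x"] by simp
qed

lemma lincomb_b_eq_comb: "\<exists>d. (\<lambda>x. \<Sum>k<N. c k * b k x) = comb N d"
proof (induction N)
  case 0
  show ?case by (simp add: comb_def)
next
  case (Suc N)
  then obtain d where d: "(\<lambda>x. \<Sum>k<N. c k * b k x) = comb N d" by auto
  define s where "s = (\<lambda>j. if j = N then sqrt (ip (residual N) (residual N)) else ip (b N) (e j))"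
  have "(\<lambda>x. \<Sum>k<Suc N. c k * b k x) = (\<lambda>x. comb N d x + c N * (\<Sum>j<Suc N. s j * e j x))"
    using d b_eq[of N] by (simp add: fun_eq_iff s_def)
  also have "\<dots> = comb (Suc N) (\<lambda>j. (if j = N then 0 else d j) + c N * s j)"
    by (simp add: comb_def fun_eq_iff sum.distrib sum_distrib_left algebra_simps)
  finally show ?case by blast
qed

lemma comb_mono: "N \<le> N' \<Longrightarrow> comb N c = comb N' (\<lambda>k. if k < N then c k else 0)"
  unfolding comb_def
  by (intro ext sum.mono_neutral_cong_left) auto

end

section \<open>Exponential moments of quadratic forms\<close>

text \<open>The left side is exp y * (1 - y) - n * y * exp y, where the first term is at most 1 and
  exp y \<ge> 1 + y in the second. With y = 2 * a * B this closes an induction over the sample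
  size.\<close>

lemma exp_mult_one_minus_le:
  fixes y :: real
  assumes "0 \<le> y"
  shows "exp y * (1 - (real n + 1) * y) \<le> 1 - real n * (y * (1 + y))"
proof -
  have e: "1 + y \<le> exp y" by (rule exp_ge_add_one_self)
  have "1 + (- y) \<le> exp (- y)" by (rule exp_ge_add_one_self)
  then have "exp y * (1 - y) \<le> exp y * exp (- y)" by (intro mult_left_mono) auto
  then have 1: "exp y * (1 - y) \<le> 1" by (simp add: exp_minus)
  have "real n * y * (1 + y) \<le> real n * y * exp y"
    using e assms by (intro mult_left_mono) auto
  with 1 show ?thesis by (simp add: algebra_simps)
qed

lemma (in prob_space) bounded_mean_zero_exp_le:
  assumes [measurable]: "f \<in> borel_measurable M"
    and bd: "\<And>z. z \<in> space M \<Longrightarrow> \<bar>f z\<bar> \<le> c" and mean: "expectation f = 0"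
  shows "(\<integral>\<^sup>+z. ennreal (exp (f z)) \<partial>M) \<le> ennreal (exp (c\<^sup>2 / 2))"
proof -
  interpret interval_bounded_random_variable M f "- c" c
  proof
    show "AE z in M. f z \<in> {- c..c}"
    proof (rule AE_I2)
      fix z assume "z \<in> space M"
      from bd[OF this] show "f z \<in> {- c..c}" by auto
    qed
  qed simp
  have "(\<integral>\<^sup>+z. ennreal (exp (1 * f z)) \<partial>M) \<le> ennreal (exp (1\<^sup>2 * (c - - c)\<^sup>2 / 8))"
    by (rule Hoeffdings_lemma_nn_integral_0) (simp_all add: mean)
  moreover have "1\<^sup>2 * (c - - c)\<^sup>2 / 8 = c\<^sup>2 / 2" by (simp add: power2_eq_square)
  ultimately show ?thesis by simp
qed

text \<open>Adding one summand replaces \<open>a\<close> by \<open>a (1 + 2 a B)\<close> at the price of a factor \<open>exp (a B)\<close>;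
  no dimension of the index set enters.\<close>

lemma (in prob_space) exp_square_norm_sum_le:
  fixes y :: "'p \<Rightarrow> 'a \<Rightarrow> real"
  assumes fin: "finite P" and [measurable]: "\<And>p. p \<in> P \<Longrightarrow> y p \<in> borel_measurable M"
    and bd: "\<And>z. z \<in> space M \<Longrightarrow> (\<Sum>p\<in>P. (y p z)\<^sup>2) \<le> B"
    and mean: "\<And>p. p \<in> P \<Longrightarrow> expectation (y p) = 0"
    and a: "0 \<le> a" "2 * real n * a * B < 1"
  shows "(\<integral>\<^sup>+x. ennreal (exp (a * (\<Sum>p\<in>P. (\<Sum>i<n. y p (x i))\<^sup>2))) \<partial>PiM {..<n} (\<lambda>_. M))
           \<le> ennreal (1 / sqrt (1 - 2 * real n * a * B))"
  using a
proof (induction n arbitrary: a)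
  case 0
  interpret P: prob_space "PiM {} (\<lambda>_::nat. M)"
    by (intro prob_space_PiM) (rule prob_space_axioms)
  show ?case by (simp add: P.emeasure_space_1)
next
  case (Suc n)
  interpret product_sigma_finite "\<lambda>_::nat. M" by unfold_locales
  obtain z0 where "z0 \<in> space M" using not_empty by blast
  have B0: "0 \<le> B" by (rule order_trans[OF sum_nonneg bd[OF \<open>z0 \<in> space M\<close>]]) simp
  have a0: "0 \<le> a" using Suc.prems by simp
  define a' where "a' = a * (1 + 2 * a * B)"
  have a'0: "0 \<le> a'" using a0 B0 by (simp add: a'_def)
  have key: "exp (2 * a * B) * (1 - 2 * real (Suc n) * a * B) \<le> 1 - 2 * real n * a' * B"
    using exp_mult_one_minus_le[of "2 * a * B" n] a0 B0 by (simp add: a'_def algebra_simps)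
  have pos: "0 < 1 - 2 * real (Suc n) * a * B" using Suc.prems by simp
  then have "0 < exp (2 * a * B) * (1 - 2 * real (Suc n) * a * B)" by simp
  with key have pos': "0 < 1 - 2 * real n * a' * B" by linarith
  let ?S = "\<lambda>p x. \<Sum>i<n. y p (x (i::nat))"
  have [measurable]: "(\<lambda>x. y p (x i)) \<in> borel_measurable (PiM J (\<lambda>_. M))" if "p \<in> P" "i \<in> J" for p i and J :: "nat set"
    using measurable_compose[OF measurable_component_singleton[OF that(2), of "\<lambda>_. M"] assms(2)[OF that(1)]] .
  have meas: "(\<lambda>x. ennreal (exp (a * (\<Sum>p\<in>P. (\<Sum>i<Suc n. y p (x i))\<^sup>2)))) \<in> borel_measurable (PiM {..<Suc n} (\<lambda>_. M))"
    by measurable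
  have meas': "(\<lambda>x. ennreal (exp (a' * (\<Sum>p\<in>P. (?S p x)\<^sup>2)))) \<in> borel_measurable (PiM {..<n} (\<lambda>_. M))"
    by measurable
  have inner: "(\<integral>\<^sup>+z. ennreal (exp (a * (\<Sum>p\<in>P. (\<Sum>i<Suc n. y p ((x(n := z)) i))\<^sup>2))) \<partial>M)
      \<le> ennreal (exp (a * B)) * ennreal (exp (a' * (\<Sum>p\<in>P. (?S p x)\<^sup>2)))" for x
  proof -
    define s where "s = (\<lambda>p. ?S p x)"
    define T where "T = (\<Sum>p\<in>P. (s p)\<^sup>2)"
    have T0: "T \<ge> 0" by (simp add: T_def sum_nonneg)
    \<comment> \<open>The cross term is centred and, by Cauchy-Schwarz, at most 2 * a * sqrt (T * B)
      in absolute value. Hoeffding's lemma turns it into the factor exp (2 * a^2 * B * T), which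
      changes a * T into a' * T.\<close>
    define \<xi> where "\<xi> = (\<lambda>z. 2 * a * (\<Sum>p\<in>P. s p * y p z))"
    have [measurable]: "\<xi> \<in> borel_measurable M" unfolding \<xi>_def by measurable
    have eq: "(\<Sum>i<Suc n. y p ((x(n := z)) i)) = s p + y p z" for p z
      by (simp add: s_def)
    have "exp (a * (\<Sum>p\<in>P. (\<Sum>i<Suc n. y p ((x(n := z)) i))\<^sup>2)) \<le> exp (a * B + a * T) * exp (\<xi> z)"
      if "z \<in> space M" for z
    proof -
      have "(\<Sum>p\<in>P. (s p + y p z)\<^sup>2) = T + 2 * (\<Sum>p\<in>P. s p * y p z) + (\<Sum>p\<in>P. (y p z)\<^sup>2)"
        by (simp add: T_def power2_sum sum.distrib sum_distrib_left algebra_simps)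
      also have "\<dots> \<le> T + 2 * (\<Sum>p\<in>P. s p * y p z) + B" using bd[OF that] by simp
      finally have "a * (\<Sum>p\<in>P. (s p + y p z)\<^sup>2) \<le> a * (T + 2 * (\<Sum>p\<in>P. s p * y p z) + B)"
        using a0 by (rule mult_left_mono)
      then show ?thesis unfolding eq exp_add[symmetric] by (simp add: \<xi>_def algebra_simps)
    qed
    then have "(\<integral>\<^sup>+z. ennreal (exp (a * (\<Sum>p\<in>P. (\<Sum>i<Suc n. y p ((x(n := z)) i))\<^sup>2))) \<partial>M)
        \<le> (\<integral>\<^sup>+z. ennreal (exp (a * B + a * T)) * ennreal (exp (\<xi> z)) \<partial>M)"
      by (intro nn_integral_mono) (simp add: ennreal_mult[symmetric] ennreal_leI)
    also have "\<dots> = ennreal (exp (a * B + a * T)) * (\<integral>\<^sup>+z. ennreal (exp (\<xi> z)) \<partial>M)"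
      by (intro nn_integral_cmult) measurable
    also have "\<dots> \<le> ennreal (exp (a * B + a * T)) * ennreal (exp ((2 * a * sqrt (T * B))\<^sup>2 / 2))"
    proof (rule mult_left_mono[OF bounded_mean_zero_exp_le])
      fix z assume z: "z \<in> space M"
      have "(\<Sum>p\<in>P. s p * y p z)\<^sup>2 \<le> T * (\<Sum>p\<in>P. (y p z)\<^sup>2)"
        unfolding T_def by (rule Cauchy_Schwarz_ineq_sum)
      also have "\<dots> \<le> T * B" using T0 bd[OF z] by (intro mult_left_mono) auto
      finally have "\<bar>\<Sum>p\<in>P. s p * y p z\<bar> \<le> sqrt (T * B)"
        by (metis real_sqrt_abs real_sqrt_le_mono)
      then show "\<bar>\<xi> z\<bar> \<le> 2 * a * sqrt (T * B)"
        using a0 by (simp add: \<xi>_def abs_mult mult_left_mono)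
    next
      have "integrable M (y p)" if "p \<in> P" for p
      proof (rule integrable_const_bound[of _ "sqrt B"])
        show "AE z in M. norm (y p z) \<le> sqrt B"
        proof (rule AE_I2)
          fix z assume z: "z \<in> space M"
          have "(y p z)\<^sup>2 \<le> (\<Sum>p\<in>P. (y p z)\<^sup>2)" using that fin by (intro member_le_sum) auto
          also have "\<dots> \<le> B" by (rule bd[OF z])
          finally show "norm (y p z) \<le> sqrt B" by (metis real_sqrt_abs real_sqrt_le_mono real_norm_def)
        qed
      qed (use that in measurable)
      then show "expectation \<xi> = 0"
        unfolding \<xi>_def by (subst integral_mult_right_zero, subst Bochner_Integration.integral_sum) (auto simp: mean)
    qed simp_all
    also have "(2 * a * sqrt (T * B))\<^sup>2 / 2 = 2 * a\<^sup>2 * B * T"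
      using T0 B0 by (simp add: power_mult_distrib)
    also have "ennreal (exp (a * B + a * T)) * ennreal (exp (2 * a\<^sup>2 * B * T)) = ennreal (exp (a * B)) * ennreal (exp (a' * T))"
      by (simp add: ennreal_mult[symmetric] exp_add[symmetric] a'_def power2_eq_square algebra_simps)
    finally show ?thesis by (simp only: T_def s_def)
  qed
  have "(\<integral>\<^sup>+x. ennreal (exp (a * (\<Sum>p\<in>P. (\<Sum>i<Suc n. y p (x i))\<^sup>2))) \<partial>PiM {..<Suc n} (\<lambda>_. M))
     = (\<integral>\<^sup>+x. \<integral>\<^sup>+z. ennreal (exp (a * (\<Sum>p\<in>P. (\<Sum>i<Suc n. y p ((x(n := z)) i))\<^sup>2))) \<partial>M \<partial>PiM {..<n} (\<lambda>_. M))"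
    using meas unfolding lessThan_Suc by (subst product_nn_integral_insert) auto
  also have "\<dots> \<le> (\<integral>\<^sup>+x. ennreal (exp (a * B)) * ennreal (exp (a' * (\<Sum>p\<in>P. (?S p x)\<^sup>2))) \<partial>PiM {..<n} (\<lambda>_. M))"
    by (intro nn_integral_mono inner)
  also have "\<dots> = ennreal (exp (a * B)) * (\<integral>\<^sup>+x. ennreal (exp (a' * (\<Sum>p\<in>P. (?S p x)\<^sup>2))) \<partial>PiM {..<n} (\<lambda>_. M))"
    by (intro nn_integral_cmult meas')
  also have "\<dots> \<le> ennreal (exp (a * B)) * ennreal (1 / sqrt (1 - 2 * real n * a' * B))"
    using pos' a'0 by (intro mult_left_mono Suc.IH) auto
  also have "\<dots> = ennreal (exp (a * B) / sqrt (1 - 2 * real n * a' * B))"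
    using pos' by (simp add: ennreal_mult[symmetric])
  also have "\<dots> \<le> ennreal (1 / sqrt (1 - 2 * real (Suc n) * a * B))"
  proof (rule ennreal_leI)
    have "exp (a * B) * sqrt (1 - 2 * real (Suc n) * a * B) = sqrt (exp (2 * a * B) * (1 - 2 * real (Suc n) * a * B))"
    proof -
      have "exp (2 * a * B) = (exp (a * B))\<^sup>2" by (simp add: power2_eq_square exp_add[symmetric])
      then show ?thesis by (simp add: real_sqrt_mult)
    qed
    also have "\<dots> \<le> sqrt (1 - 2 * real n * a' * B)" using key by simp
    finally show "exp (a * B) / sqrt (1 - 2 * real n * a' * B) \<le> 1 / sqrt (1 - 2 * real (Suc n) * a * B)"
      using pos pos' by (simp add: divide_simps mult.commute)
  qed
  finally show ?case .
qed

text \<open>Completing the square: the integrand times the Gaussian density is a constant multiple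
  of the normal density with mean 2 * a * b / w and variance 1 / w, where w = 1 - 2 * a * g.\<close>

lemma std_normal_exp_quadratic:
  assumes "2 * a * g < 1"
  shows "(\<integral>\<^sup>+t. ennreal (exp (a * (g * t\<^sup>2 + 2 * b * t))) \<partial>density lborel std_normal_density)
     = ennreal (exp (2 * a\<^sup>2 * b\<^sup>2 / (1 - 2 * a * g)) / sqrt (1 - 2 * a * g))"
proof -
  define w where "w = 1 - 2 * a * g"
  define \<sigma> where "\<sigma> = 1 / sqrt w"
  define \<mu> where "\<mu> = 2 * a * b / w"
  define C where "C = exp (2 * a\<^sup>2 * b\<^sup>2 / w) / sqrt w"
  have w: "w > 0" using assms by (simp add: w_def)
  have \<sigma>: "\<sigma> > 0" "\<sigma>\<^sup>2 = 1 / w" using w by (auto simp: \<sigma>_def power_divide)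
  have C: "C \<ge> 0" using w by (simp add: C_def)
  have pt: "std_normal_density t * exp (a * (g * t\<^sup>2 + 2 * b * t)) = C * normal_density \<mu> \<sigma> t" for t
  proof -
    have e: "- t\<^sup>2 / 2 + a * (g * t\<^sup>2 + 2 * b * t) = 2 * a\<^sup>2 * b\<^sup>2 / w + (- (t - \<mu>)\<^sup>2 / (2 * \<sigma>\<^sup>2))"
    proof -
      have "2 * a * g = 1 - w" by (simp add: w_def)
      then have "(2 * a * g) * t\<^sup>2 = (1 - w) * t\<^sup>2" by simp
      then have "a * (g * t\<^sup>2 + 2 * b * t) = (1 - w) * t\<^sup>2 / 2 + 2 * a * b * t" by (simp add: algebra_simps)
      moreover have "- (t - \<mu>)\<^sup>2 / (2 * \<sigma>\<^sup>2) = - w * (t - \<mu>)\<^sup>2 / 2" using \<sigma> w by simp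
      moreover have "w * (t - \<mu>)\<^sup>2 = w * t\<^sup>2 - 4 * a * b * t + 4 * a\<^sup>2 * b\<^sup>2 / w"
        using w by (simp add: \<mu>_def field_simps power2_eq_square)
      ultimately show ?thesis by (simp add: field_simps)
    qed
    have s: "sqrt (2 * pi * \<sigma>\<^sup>2) = sqrt (2 * pi) / sqrt w" using \<sigma> by (simp add: real_sqrt_divide)
    have "std_normal_density t * exp (a * (g * t\<^sup>2 + 2 * b * t)) = 1 / sqrt (2 * pi) * exp (- t\<^sup>2 / 2 + a * (g * t\<^sup>2 + 2 * b * t))"
      unfolding std_normal_density_def exp_add by simp
    also have "\<dots> = C * normal_density \<mu> \<sigma> t"
      unfolding e exp_add normal_density_def s C_def using w by (simp add: field_simps)
    finally show ?thesis .
  qed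
  have "(\<integral>\<^sup>+t. ennreal (exp (a * (g * t\<^sup>2 + 2 * b * t))) \<partial>density lborel std_normal_density)
      = (\<integral>\<^sup>+t. ennreal C * ennreal (normal_density \<mu> \<sigma> t) \<partial>lborel)"
    by (subst nn_integral_density) (auto simp: pt ennreal_mult[symmetric] C)
  also have "\<dots> = ennreal C * (\<integral>\<^sup>+t. ennreal (normal_density \<mu> \<sigma> t) \<partial>lborel)"
    by (intro nn_integral_cmult) measurable
  also have "(\<integral>\<^sup>+t. ennreal (normal_density \<mu> \<sigma> t) \<partial>lborel) = 1"
    using prob_space.emeasure_space_1[OF prob_space_normal_density[OF \<sigma>(1), of \<mu>]]
    by (simp add: emeasure_density)
  finally show ?thesis by (simp add: C_def w_def)
qed

text \<open>Integrating out the last Gaussian coordinate replaces the form by a Schur-type complement, which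
  keeps the bound \<open>L\<close>; the inequality \<open>\<Sum>i<n. (G i n)\<^sup>2 \<le> G n n * (L - G n n)\<close> pays for the change of trace.\<close>

lemma gaussian_quadratic_form_exp_le:
  fixes G :: "nat \<Rightarrow> nat \<Rightarrow> real"
  assumes sym: "\<And>i j. G i j = G j i"
    and lower: "\<And>v. 0 \<le> (\<Sum>i<n. \<Sum>j<n. G i j * v i * v j)"
    and upper: "\<And>v. (\<Sum>i<n. \<Sum>j<n. G i j * v i * v j) \<le> L * (\<Sum>i<n. (v i)\<^sup>2)"
    and L: "0 < L" and a: "0 \<le> a" "2 * a * L < 1"
  shows "(\<integral>\<^sup>+v. ennreal (exp (a * (\<Sum>i<n. \<Sum>j<n. G i j * v i * v j)))
             \<partial>PiM {..<n} (\<lambda>_. density lborel std_normal_density))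
           \<le> ennreal (exp (a * (\<Sum>i<n. G i i) / (1 - 2 * a * L)))"
  using sym lower upper
proof (induction n arbitrary: G)
  case 0
  interpret P: prob_space "PiM {} (\<lambda>_::nat. density lborel std_normal_density)"
    by (intro prob_space_PiM prob_space_normal_density) simp
  show ?case by (simp add: P.emeasure_space_1)
next
  case (Suc n)
  note sym = Suc.prems(1) and lower = Suc.prems(2) and upper = Suc.prems(3)
  let ?N = "density lborel std_normal_density"
  interpret N: prob_space ?N by (rule prob_space_normal_density) simp
  interpret product_sigma_finite "\<lambda>_::nat. ?N" by unfold_locales
  define g where "g = G n n"
  define b where "b = (\<lambda>v. \<Sum>i<n. G i n * v i)"
  define q where "q = (\<lambda>v. \<Sum>i<n. \<Sum>j<n. G i j * v i * v j)"
  define w where "w = 1 - 2 * a * g"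
  have split: "(\<Sum>i<Suc n. \<Sum>j<Suc n. G i j * (v(n := t)) i * (v(n := t)) j) = q v + 2 * b v * t + g * t\<^sup>2" for v t
  proof -
    have "(\<Sum>j<n. G n j * t * v j) = b v * t" unfolding b_def sum_distrib_right
      by (intro sum.cong) (simp_all add: sym[of n])
    moreover have "(\<Sum>i<n. G i n * v i * t) = b v * t" by (simp add: b_def sum_distrib_right)
    ultimately show ?thesis
      by (simp add: q_def g_def sum.distrib power2_eq_square algebra_simps)
  qed
  have low: "0 \<le> q v + 2 * b v * t + g * t\<^sup>2" for v t
    using lower[of "v(n := t)"] by (simp only: split)
  have up: "q v + 2 * b v * t + g * t\<^sup>2 \<le> L * ((\<Sum>i<n. (v i)\<^sup>2) + t\<^sup>2)" for v t
    using upper[of "v(n := t)"] by (simp only: split) simp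
  have g: "0 \<le> g" "g \<le> L"
    using low[of "\<lambda>_. 0" 1] up[of "\<lambda>_. 0" 1] by (auto simp: q_def b_def)
  have "2 * a * g \<le> 2 * a * L" using g a by (intro mult_left_mono) auto
  then have w: "w > 0" "w \<ge> 1 - 2 * a * L" using a by (auto simp: w_def)
  define \<beta> where "\<beta> = (\<Sum>i<n. (G i n)\<^sup>2)"
  have \<beta>: "\<beta> \<le> g * (L - g)"
  proof -
    have b: "b (\<lambda>i. G i n) = \<beta>" by (simp add: b_def \<beta>_def power2_eq_square)
    \<comment> \<open>A corner entry of the matrix inequality G^2 \<le> L * G. Both test vectors
      extend the last column; the last entry is g - L for positivity and g for the upper
      bound.\<close>
    have "L * \<beta> \<le> L * (g * (L - g))"
      using low[of "\<lambda>i. G i n" "g - L"] up[of "\<lambda>i. G i n" g]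
      unfolding b \<beta>_def[symmetric] by (simp add: power2_eq_square algebra_simps)
    then show ?thesis using L by simp
  qed
  define G' where "G' = (\<lambda>i j. G i j + 2 * a * G i n * G j n / w)"
  have q': "(\<Sum>i<n. \<Sum>j<n. G' i j * v i * v j) = q v + 2 * a * (b v)\<^sup>2 / w" for v
  proof -
    have "(\<Sum>i<n. \<Sum>j<n. G' i j * v i * v j)
      = q v + (\<Sum>i<n. \<Sum>j<n. 2 * a / w * ((G i n * v i) * (G j n * v j)))"
      unfolding q_def G'_def by (simp add: sum.distrib[symmetric] algebra_simps)
    also have "(\<Sum>i<n. \<Sum>j<n. 2 * a / w * ((G i n * v i) * (G j n * v j))) = 2 * a / w * (b v * b v)"
      unfolding b_def sum_product by (simp add: sum_distrib_left)
    finally show ?thesis by (simp add: power2_eq_square)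
  qed
  have tr': "(\<Sum>i<n. G' i i) = (\<Sum>i<n. G i i) + 2 * a / w * \<beta>"
    by (simp add: G'_def \<beta>_def sum.distrib sum_distrib_left power2_eq_square mult.assoc)
  have IH: "(\<integral>\<^sup>+v. ennreal (exp (a * (\<Sum>i<n. \<Sum>j<n. G' i j * v i * v j))) \<partial>PiM {..<n} (\<lambda>_. ?N))
           \<le> ennreal (exp (a * (\<Sum>i<n. G' i i) / (1 - 2 * a * L)))"
  proof (rule Suc.IH)
    show "G' i j = G' j i" for i j using sym[of i j] by (simp add: G'_def)
    show "0 \<le> (\<Sum>i<n. \<Sum>j<n. G' i j * v i * v j)" for v
      unfolding q' using low[of v 0] a w by simp
    show "(\<Sum>i<n. \<Sum>j<n. G' i j * v i * v j) \<le> L * (\<Sum>i<n. (v i)\<^sup>2)" for v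
    proof -
      \<comment> \<open>The last coordinate at which the old upper bound is tested. The correction 2
        * a * (b v)^2 / w equals b v * t, which is at most 2 * b v * t + g * t^2 - L * t^2 because 2
        * a * L < 1.\<close>
      define t where "t = 2 * a * b v / w"
      have bt: "b v = w * t / (2 * a)" if "a \<noteq> 0" using that w by (simp add: t_def)
      have "2 * a * (b v)\<^sup>2 / w = b v * t" by (simp add: t_def power2_eq_square)
      moreover have "L * t\<^sup>2 - g * t\<^sup>2 - b v * t \<le> 0"
      proof (cases "a = 0")
        case False
        with a have ap: "a > 0" by simp
        have "L * t\<^sup>2 - g * t\<^sup>2 - b v * t = (2 * a * L - 1) * t\<^sup>2 / (2 * a)"
          unfolding bt[OF False] w_def using ap by (simp add: field_simps power2_eq_square)
        also have "\<dots> \<le> 0" using ap a by (intro divide_nonpos_pos mult_nonpos_nonneg) auto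
        finally show ?thesis .
      qed (simp add: t_def)
      ultimately show ?thesis unfolding q' using up[of v t] by (simp add: algebra_simps)
    qed
  qed
  have inner: "(\<integral>\<^sup>+t. ennreal (exp (a * (\<Sum>i<Suc n. \<Sum>j<Suc n. G i j * (v(n := t)) i * (v(n := t)) j))) \<partial>?N)
     = ennreal (1 / sqrt w) * ennreal (exp (a * (\<Sum>i<n. \<Sum>j<n. G' i j * v i * v j)))" for v
  proof -
    have "(\<integral>\<^sup>+t. ennreal (exp (a * (\<Sum>i<Suc n. \<Sum>j<Suc n. G i j * (v(n := t)) i * (v(n := t)) j))) \<partial>?N)
      = (\<integral>\<^sup>+t. ennreal (exp (a * q v)) * ennreal (exp (a * (g * t\<^sup>2 + 2 * b v * t))) \<partial>?N)"
      unfolding split by (intro nn_integral_cong) (simp add: ennreal_mult[symmetric] exp_add[symmetric] algebra_simps)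
    also have "\<dots> = ennreal (exp (a * q v)) * (\<integral>\<^sup>+t. ennreal (exp (a * (g * t\<^sup>2 + 2 * b v * t))) \<partial>?N)"
      by (intro nn_integral_cmult) measurable
    also have "\<dots> = ennreal (exp (a * q v)) * ennreal (exp (2 * a\<^sup>2 * (b v)\<^sup>2 / w) / sqrt w)"
      using w by (subst std_normal_exp_quadratic) (simp_all add: w_def)
    finally show ?thesis unfolding q' using w
      by (simp add: ennreal_mult[symmetric] exp_add[symmetric] power2_eq_square algebra_simps)
  qed
  have "(\<integral>\<^sup>+v. ennreal (exp (a * (\<Sum>i<Suc n. \<Sum>j<Suc n. G i j * v i * v j))) \<partial>PiM {..<Suc n} (\<lambda>_. ?N))
    = (\<integral>\<^sup>+v. \<integral>\<^sup>+t. ennreal (exp (a * (\<Sum>i<Suc n. \<Sum>j<Suc n. G i j * (v(n := t)) i * (v(n := t)) j))) \<partial>?N \<partial>PiM {..<n} (\<lambda>_. ?N))"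
  proof -
    have "(\<lambda>v. ennreal (exp (a * (\<Sum>i<Suc n. \<Sum>j<Suc n. G i j * v i * v j)))) \<in> borel_measurable (PiM {..<Suc n} (\<lambda>_. ?N))"
      by measurable
    then show ?thesis unfolding lessThan_Suc by (subst product_nn_integral_insert) auto
  qed
  also have "\<dots> = ennreal (1 / sqrt w) * (\<integral>\<^sup>+v. ennreal (exp (a * (\<Sum>i<n. \<Sum>j<n. G' i j * v i * v j))) \<partial>PiM {..<n} (\<lambda>_. ?N))"
    unfolding inner by (intro nn_integral_cmult) measurable
  also have "\<dots> \<le> ennreal (1 / sqrt w) * ennreal (exp (a * (\<Sum>i<n. G' i i) / (1 - 2 * a * L)))"
    by (intro mult_left_mono IH) simp
  also have "\<dots> = ennreal (1 / sqrt w * exp (a * (\<Sum>i<n. G' i i) / (1 - 2 * a * L)))"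
    using w by (simp add: ennreal_mult[symmetric])
  also have "\<dots> \<le> ennreal (exp (a * (\<Sum>i<Suc n. G i i) / (1 - 2 * a * L)))"
  proof (rule ennreal_leI)
    define u where "u = 1 - 2 * a * L"
    have u: "u > 0" using a by (simp add: u_def)
    \<comment> \<open>Since 1 - w = 2 * a * g, this bounds the normalising factor 1 / sqrt w of the
      integrated coordinate by exp (a * g / w).\<close>
    have "ln (1 / w) \<le> 1 / w - 1" using w by (intro ln_le_minus_one) auto
    then have "- ln w / 2 \<le> a * g / w" using w by (simp add: ln_div w_def field_simps)
    then have le: "exp (- ln w / 2) \<le> exp (a * g / w)" by (simp only: exp_le_cancel_iff)
    have eq: "exp (- ln w / 2) = 1 / sqrt w"
      using w by (simp add: exp_minus inverse_eq_divide ln_sqrt[symmetric])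
    have 1: "1 / sqrt w \<le> exp (a * g / w)" using le unfolding eq .
    \<comment> \<open>As w - u = 2 * a * (L - g), the growth of the trace costs at most a * g / u -
      a * g / w. With the a * g / w of the normalising factor this is exactly the share a * g / u of
      the removed diagonal entry.\<close>
    have "a * (2 * a / w * \<beta>) / u \<le> a * (2 * a / w * (g * (L - g))) / u"
      using a w u \<beta> by (intro divide_right_mono mult_left_mono) auto
    also have "\<dots> = a * g / u - a * g / w"
    proof -
      have "2 * a * (L - g) = w - u" by (simp add: w_def u_def algebra_simps)
      then have "a * (2 * a / w * (g * (L - g))) / u = a * g * (w - u) / (w * u)"
        by (metis (no_types, lifting) mult.assoc mult.left_commute times_divide_eq_left times_divide_eq_right divide_divide_eq_left)
      also have "\<dots> = a * g / u - a * g / w" using w u by (simp add: field_simps)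
      finally show ?thesis .
    qed
    finally have 2: "a * g / w + a * (\<Sum>i<n. G' i i) / u \<le> a * (\<Sum>i<Suc n. G i i) / u"
      unfolding tr' by (simp add: g_def algebra_simps add_divide_distrib)
    have "1 / sqrt w * exp (a * (\<Sum>i<n. G' i i) / u) \<le> exp (a * g / w) * exp (a * (\<Sum>i<n. G' i i) / u)"
      using 1 by (intro mult_right_mono) auto
    also have "\<dots> \<le> exp (a * (\<Sum>i<Suc n. G i i) / u)"
      unfolding exp_add[symmetric] using 2 by simp
    finally show "1 / sqrt w * exp (a * (\<Sum>i<n. G' i i) / (1 - 2 * a * L)) \<le> exp (a * (\<Sum>i<Suc n. G i i) / (1 - 2 * a * L))"
      by (simp add: u_def)
  qed
  finally show ?case .
qed

text \<open>Separates a sample of pairs into design and noise, so that the noise can be integrated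
  with the design held fixed. In the induction the new design point is exchanged with the earlier
  noise by Fubini; the restriction to \<open>{..<n}\<close> yields the extensional functions of
  which a product space consists.\<close>

lemma nn_integral_PiM_pair:
  fixes f :: "(nat \<Rightarrow> 'a \<times> 'b) \<Rightarrow> ennreal"
  assumes "prob_space A" "prob_space B"
    and "f \<in> borel_measurable (PiM {..<n} (\<lambda>_. A \<Otimes>\<^sub>M B))"
  shows "(\<integral>\<^sup>+q. f q \<partial>PiM {..<n} (\<lambda>_. A \<Otimes>\<^sub>M B))
    = (\<integral>\<^sup>+x. \<integral>\<^sup>+y. f (\<lambda>i\<in>{..<n}. (x i, y i)) \<partial>PiM {..<n} (\<lambda>_. B) \<partial>PiM {..<n} (\<lambda>_. A))"
  using assms(3)
proof (induction n arbitrary: f)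
  case 0
  interpret A: prob_space A by fact
  interpret B: prob_space B by fact
  interpret AB: pair_prob_space A B ..
  show ?case
    by (simp add: PiM_empty nn_integral_count_space_finite restrict_def)
next
  case (Suc n)
  interpret A: prob_space A by fact
  interpret B: prob_space B by fact
  interpret AB: pair_prob_space A B ..
  interpret pA: product_sigma_finite "\<lambda>_::nat. A" by unfold_locales
  interpret pB: product_sigma_finite "\<lambda>_::nat. B" by unfold_locales
  interpret pAB: product_sigma_finite "\<lambda>_::nat. A \<Otimes>\<^sub>M B" by unfold_locales
  let ?A = "PiM {..<n} (\<lambda>_. A)" and ?B = "PiM {..<n} (\<lambda>_. B)"
  interpret QA: prob_space ?A by (rule prob_space_PiM) (rule A.prob_space_axioms)
  interpret QB: prob_space ?B by (rule prob_space_PiM) (rule B.prob_space_axioms)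
  interpret AQB: pair_sigma_finite A ?B ..
  note f [measurable] = Suc.prems
  let ?r = "\<lambda>x y. \<lambda>i\<in>{..<n}. (x i, y i)"
  have r [measurable]: "(\<lambda>p. ?r (fst p) (snd p)) \<in> ?A \<Otimes>\<^sub>M ?B \<rightarrow>\<^sub>M PiM {..<n} (\<lambda>_. A \<Otimes>\<^sub>M B)"
    by measurable
  have upd: "(\<lambda>p. (fst p)(n := snd p)) \<in> PiM {..<n} (\<lambda>_. M) \<Otimes>\<^sub>M M \<rightarrow>\<^sub>M PiM {..<Suc n} (\<lambda>_. M)" for M :: "'c measure"
    using measurable_add_dim[of n "{..<n}" "\<lambda>_. M"] by (simp add: lessThan_Suc case_prod_unfold)
  have eq: "(\<lambda>i\<in>{..<Suc n}. ((x(n := u)) i, (y(n := v)) i)) = (?r x y)(n := (u, v))" for x y u v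
    by (auto simp: restrict_def fun_eq_iff less_Suc_eq)
  have m: "(\<lambda>q. \<integral>\<^sup>+z. f (q(n := z)) \<partial>(A \<Otimes>\<^sub>M B)) \<in> borel_measurable (PiM {..<n} (\<lambda>_. A \<Otimes>\<^sub>M B))"
  proof -
    have [measurable]: "(\<lambda>p. f ((fst p)(n := snd p))) \<in> borel_measurable (PiM {..<n} (\<lambda>_. A \<Otimes>\<^sub>M B) \<Otimes>\<^sub>M (A \<Otimes>\<^sub>M B))"
      by (rule measurable_compose[OF upd f])
    show ?thesis
      using AB.borel_measurable_nn_integral_fst[of "\<lambda>p. f ((fst p)(n := snd p))" "PiM {..<n} (\<lambda>_. A \<Otimes>\<^sub>M B)"] by simp
  qed
  have "(\<integral>\<^sup>+q. f q \<partial>PiM {..<Suc n} (\<lambda>_. A \<Otimes>\<^sub>M B))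
      = (\<integral>\<^sup>+q. \<integral>\<^sup>+z. f (q(n := z)) \<partial>(A \<Otimes>\<^sub>M B) \<partial>PiM {..<n} (\<lambda>_. A \<Otimes>\<^sub>M B))"
    using f unfolding lessThan_Suc by (subst pAB.product_nn_integral_insert) auto
  also have "\<dots> = (\<integral>\<^sup>+x. \<integral>\<^sup>+y. \<integral>\<^sup>+z. f ((?r x y)(n := z)) \<partial>(A \<Otimes>\<^sub>M B) \<partial>?B \<partial>?A)"
    by (rule Suc.IH[OF m])
  also have "\<dots> = (\<integral>\<^sup>+x. \<integral>\<^sup>+y. \<integral>\<^sup>+u. \<integral>\<^sup>+v. f ((?r x y)(n := (u, v))) \<partial>B \<partial>A \<partial>?B \<partial>?A)"
  proof (intro nn_integral_cong)
    fix x y assume "x \<in> space ?A" "y \<in> space ?B"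
    then have "?r x y \<in> space (PiM {..<n} (\<lambda>_. A \<Otimes>\<^sub>M B))"
      by (auto simp: space_PiM space_pair_measure PiE_def Pi_def)
    then have "(\<lambda>z. f ((?r x y)(n := z))) \<in> borel_measurable (A \<Otimes>\<^sub>M B)"
      using f unfolding lessThan_Suc by (intro measurable_compose[OF measurable_component_update f[unfolded lessThan_Suc]]) auto
    then show "(\<integral>\<^sup>+z. f ((?r x y)(n := z)) \<partial>(A \<Otimes>\<^sub>M B)) = (\<integral>\<^sup>+u. \<integral>\<^sup>+v. f ((?r x y)(n := (u, v))) \<partial>B \<partial>A)"
      by (subst B.nn_integral_fst[symmetric]) auto
  qed
  also have "\<dots> = (\<integral>\<^sup>+x. \<integral>\<^sup>+u. \<integral>\<^sup>+y. \<integral>\<^sup>+v. f ((?r x y)(n := (u, v))) \<partial>B \<partial>?B \<partial>A \<partial>?A)"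
  proof (intro nn_integral_cong)
    fix x assume x: "x \<in> space ?A"
    have rx: "(\<lambda>y. ?r x y) \<in> ?B \<rightarrow>\<^sub>M PiM {..<n} (\<lambda>_. A \<Otimes>\<^sub>M B)"
      using measurable_compose[OF measurable_Pair1'[OF x] r] by simp
    have "(\<lambda>p. (?r x (snd (fst p)))(n := (fst (fst p), snd p))) \<in> (A \<Otimes>\<^sub>M ?B) \<Otimes>\<^sub>M B \<rightarrow>\<^sub>M PiM {..<Suc n} (\<lambda>_. A \<Otimes>\<^sub>M B)"
    proof -
      have "(\<lambda>p. (?r x (snd (fst p)), (fst (fst p), snd p))) \<in> (A \<Otimes>\<^sub>M ?B) \<Otimes>\<^sub>M B \<rightarrow>\<^sub>M PiM {..<n} (\<lambda>_. A \<Otimes>\<^sub>M B) \<Otimes>\<^sub>M (A \<Otimes>\<^sub>M B)"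
        by (intro measurable_Pair measurable_compose[OF _ rx]) measurable
      from measurable_compose[OF this upd] show ?thesis by simp
    qed
    from measurable_compose[OF this f]
    have mf: "(\<lambda>p. f ((?r x (snd (fst p)))(n := (fst (fst p), snd p)))) \<in> borel_measurable ((A \<Otimes>\<^sub>M ?B) \<Otimes>\<^sub>M B)" .
    have mm: "(\<lambda>p. \<integral>\<^sup>+v. f ((?r x (snd p))(n := (fst p, v))) \<partial>B) \<in> borel_measurable (A \<Otimes>\<^sub>M ?B)"
      using B.borel_measurable_nn_integral_fst[OF mf] by (simp only: fst_conv snd_conv)
    show "(\<integral>\<^sup>+y. \<integral>\<^sup>+u. \<integral>\<^sup>+v. f ((?r x y)(n := (u, v))) \<partial>B \<partial>A \<partial>?B)
       = (\<integral>\<^sup>+u. \<integral>\<^sup>+y. \<integral>\<^sup>+v. f ((?r x y)(n := (u, v))) \<partial>B \<partial>?B \<partial>A)"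
      using AQB.Fubini'[of "\<lambda>u y. \<integral>\<^sup>+v. f ((?r x y)(n := (u, v))) \<partial>B"] mm by (simp only: case_prod_unfold)
  qed
  also have "\<dots> = (\<integral>\<^sup>+x. \<integral>\<^sup>+u. \<integral>\<^sup>+y. f (\<lambda>i\<in>{..<Suc n}. ((x(n := u)) i, y i)) \<partial>PiM {..<Suc n} (\<lambda>_. B) \<partial>A \<partial>?A)"
  proof (intro nn_integral_cong)
    fix x u assume x: "x \<in> space ?A" and u: "u \<in> space A"
    have xu: "(x(n := u)) i \<in> space A" if "i < Suc n" for i
      using x u that by (auto simp: space_PiM PiE_def Pi_def less_Suc_eq)
    have "(\<lambda>y. \<lambda>i\<in>{..<Suc n}. ((x(n := u)) i, y i)) \<in> PiM {..<Suc n} (\<lambda>_. B) \<rightarrow>\<^sub>M PiM {..<Suc n} (\<lambda>_. A \<Otimes>\<^sub>M B)"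
      using xu by (intro measurable_restrict measurable_Pair measurable_const) auto
    from measurable_compose[OF this f]
    have m2: "(\<lambda>y. f (\<lambda>i\<in>{..<Suc n}. ((x(n := u)) i, y i))) \<in> borel_measurable (PiM {..<Suc n} (\<lambda>_. B))" .
    have "(\<integral>\<^sup>+y. f (\<lambda>i\<in>{..<Suc n}. ((x(n := u)) i, y i)) \<partial>PiM {..<Suc n} (\<lambda>_. B))
        = (\<integral>\<^sup>+y. \<integral>\<^sup>+v. f (\<lambda>i\<in>{..<Suc n}. ((x(n := u)) i, (y(n := v)) i)) \<partial>B \<partial>?B)"
      using m2 unfolding lessThan_Suc by (subst pB.product_nn_integral_insert) auto
    then show "(\<integral>\<^sup>+y. \<integral>\<^sup>+v. f ((?r x y)(n := (u, v))) \<partial>B \<partial>?B)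
      = (\<integral>\<^sup>+y. f (\<lambda>i\<in>{..<Suc n}. ((x(n := u)) i, y i)) \<partial>PiM {..<Suc n} (\<lambda>_. B))"
      by (simp only: eq)
  qed
  also have "\<dots> = (\<integral>\<^sup>+x. \<integral>\<^sup>+y. f (\<lambda>i\<in>{..<Suc n}. (x i, y i)) \<partial>PiM {..<Suc n} (\<lambda>_. B) \<partial>PiM {..<Suc n} (\<lambda>_. A))"
  proof -
    interpret QB': prob_space "PiM {..<Suc n} (\<lambda>_. B)" by (rule prob_space_PiM) (rule B.prob_space_axioms)
    have "(\<lambda>p. \<lambda>i\<in>{..<Suc n}. (fst p i, snd p i)) \<in> PiM {..<Suc n} (\<lambda>_. A) \<Otimes>\<^sub>M PiM {..<Suc n} (\<lambda>_. B) \<rightarrow>\<^sub>M PiM {..<Suc n} (\<lambda>_. A \<Otimes>\<^sub>M B)"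
      by measurable
    from QB'.borel_measurable_nn_integral_fst[OF measurable_compose[OF this f]]
    have "(\<lambda>x. \<integral>\<^sup>+y. f (\<lambda>i\<in>{..<Suc n}. (x i, y i)) \<partial>PiM {..<Suc n} (\<lambda>_. B)) \<in> borel_measurable (PiM {..<Suc n} (\<lambda>_. A))"
      by simp
    then show ?thesis
      by (subst (2) lessThan_Suc, subst pA.product_nn_integral_insert) (auto simp: lessThan_Suc)
  qed
  finally show ?case .
qed

section \<open>The reproducing kernel\<close>

lemma higher_pderiv_eq_0:
  fixes p :: "real poly"
  assumes "degree p < m"
  shows "(pderiv ^^ m) p = 0"
  using assms
proof (induction m arbitrary: p)
  case (Suc m)
  have z: "(pderiv ^^ m) (0 :: real poly) = 0" by (induction m) (simp_all add: pderiv_0)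
  show ?case
  proof (cases "degree p = 0")
    case True
    then have "pderiv p = 0" by (simp add: pderiv_eq_0_iff)
    then show ?thesis using z by (simp only: funpow_Suc_right o_apply)
  next
    case False
    then have "degree (pderiv p) < m" using Suc.prems by (simp add: degree_pderiv)
    from Suc.IH[OF this] show ?thesis by (simp only: funpow_Suc_right o_apply)
  qed
qed simp

lemma poly_in_sobolev: "poly p \<in> sobolev m"
  using poly_sobolev_witness by (rule sobolevI)

lemma Jf_poly_eq_0:
  assumes "degree p < m" "g \<in> sobolev m"
  shows "Jf m (poly p) g = 0"
proof -
  obtain E where E: "sobolev_witness m g E" using assms(2) by (auto simp: sobolev_def)
  show ?thesis unfolding Jf_eq_integral[OF poly_sobolev_witness E] higher_pderiv_eq_0[OF assms(1)]
    by (simp add: set_lebesgue_integral_def)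
qed

lemma Jf_cut01_poly_eq_0:
  assumes "degree p < m" "g \<in> sobolev m"
  shows "Jf m (cut01 (poly p)) g = 0"
  using Jf_poly_eq_0[OF assms] Jf_cong[OF poly_in_sobolev[of p m] assms(2), of "cut01 (poly p)" g] by simp

lemma power_eq_poly_monom: "(\<lambda>x. x ^ k) = poly (monom (1::real) k)"
  by (simp add: poly_monom fun_eq_iff)

locale spline_kernel =
  fixes m :: nat and lam :: real and K :: "real \<Rightarrow> real \<Rightarrow> real"
  assumes m: "m \<ge> 1" and lam: "lam > 0" and A1: "assumption_A1 m lam" and K: "is_rep_kernel m lam K"
begin

abbreviation W where "W \<equiv> sobolev0 m"
abbreviation ip where "ip \<equiv> sinner m lam"

lemma K_mem: "x \<in> {0..1} \<Longrightarrow> cut01 (K x) \<in> W"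
  using K by (intro cut01_in_sobolev0) (simp add: is_rep_kernel_def)

text \<open>The property is given for \<open>K x\<close> itself. It passes to the cut-off because
  the second argument vanishes off the interval and \<open>Jf\<close> sees only values on the
  interval.\<close>

lemma reproducing:
  assumes "x \<in> {0..1}" "f \<in> W"
  shows "ip (cut01 (K x)) f = f x"
proof -
  have Kx: "K x \<in> sobolev m" using K assms by (simp add: is_rep_kernel_def)
  have "Jf m (cut01 (K x)) f = Jf m (K x) f"
    by (rule Jf_cong[OF Kx sobolev0D(1)[OF assms(2)]]) auto
  then have "ip (cut01 (K x)) f = ip (K x) f"
    using Vf_cut01_right[OF assms(2), of "K x"] by (simp add: sinner_def)
  also have "\<dots> = f x" using K assms sobolev0D(1)[OF assms(2)] by (simp add: is_rep_kernel_def)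
  finally show ?thesis .
qed

lemma ip_lin:
  assumes "f \<in> W" "g \<in> W" "k \<in> W"
  shows "ip (\<lambda>x. f x + c * g x) k = ip f k + c * ip g k"
  using Vf_lincomb[OF assms m, of c] Jf_lincomb[OF assms[THEN sobolev0D(1)], of c]
  by (simp add: sinner_def algebra_simps)

lemma ip_sym: "ip f g = ip g f"
  by (simp add: sinner_def Vf_commute[of f] Jf_commute[of m f])

lemma ip_pos: "0 \<le> ip f f"
  using lam by (simp add: sinner_def Vf_nonneg Jf_nonneg)

lemma Vf_le_ip: "Vf f f \<le> ip f f" and Jf_le_ip: "lam * Jf m f f \<le> ip f f"
  using lam by (simp_all add: sinner_def Vf_nonneg Jf_nonneg)

sublocale function_inner_space W ip
proof
  have "poly 0 \<in> sobolev m" by (rule poly_in_sobolev)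
  then show "(\<lambda>_. 0) \<in> W" by (simp add: sobolev0_def poly_0[abs_def])
  show "f = (\<lambda>_. 0)" if f: "f \<in> W" and f0: "ip f f = 0" for f
  proof
    fix x
    show "f x = 0"
    proof (cases "x \<in> {0..1}")
      case True
      define g where "g = cut01 (K x)"
      have g: "g \<in> W" using K_mem[OF True] by (simp add: g_def)
      have "0 \<le> ip g g + 2 * t * ip g f" for t
      proof -
        define u where "u = (\<lambda>x. g x + t * f x)"
        have u: "u \<in> W" unfolding u_def by (rule sobolev0_lincomb[OF g f])
        have "ip u u = ip u g + t * ip u f"
          using ip_lin[OF g f u, of t] ip_sym[of g u] ip_sym[of f u] by (simp add: u_def)
        also have "ip u g = ip g g + t * ip g f" using ip_lin[OF g f g, of t] ip_sym[of f g] by (simp add: u_def)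
        also have "ip u f = ip g f" using ip_lin[OF g f f, of t] f0 by (simp add: u_def)
        finally show ?thesis using ip_pos[of u] by simp
      qed
      note nonneg = this
      have "ip g f = 0"
      proof (rule ccontr)
        assume "ip g f \<noteq> 0"
        then have "2 * (- (ip g g + 1) / (2 * ip g f)) * ip g f = - (ip g g + 1)" by simp
        with nonneg[of "- (ip g g + 1) / (2 * ip g f)"] show False by linarith
      qed
      then show ?thesis using reproducing[OF True f] by (simp add: g_def)
    qed (use sobolev0D(2)[OF f] in simp)
  qed
qed (fact sobolev0_lincomb ip_lin ip_sym ip_pos)+

lemma K_diag: "x \<in> {0..1} \<Longrightarrow> ip (cut01 (K x)) (cut01 (K x)) = K x x"
  using reproducing[OF _ K_mem] by simp

lemma K_diag_nonneg: "x \<in> {0..1} \<Longrightarrow> 0 \<le> K x x"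
  using K_diag ip_pos by metis

lemma point_evaluation_le:
  assumes "x \<in> {0..1}" "f \<in> W"
  shows "\<bar>f x\<bar> \<le> sqrt (K x x) * sqrt (ip f f)"
  using ip_Cauchy_Schwarz_abs[OF K_mem[OF assms(1)] assms(2)] unfolding reproducing[OF assms] K_diag[OF assms(1)] .

definition monomial01 :: "nat \<Rightarrow> real \<Rightarrow> real" where
  "monomial01 k = cut01 (\<lambda>x. x ^ k)"

lemma monomial01_mem: "monomial01 k \<in> W"
  unfolding monomial01_def power_eq_poly_monom by (intro cut01_in_sobolev0 poly_in_sobolev)

text \<open>The energy controls a function modulo polynomials of degree below m, on which it
  vanishes. The remainder therefore keeps the energy of \<open>f\<close>, and its \<open>Vf\<close>
  part is bounded through the supremum.\<close>

lemma Taylor_remainder: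
  assumes f: "f \<in> W"
  shows "\<exists>c. (\<forall>x\<in>{0..1}. \<bar>f x - (\<Sum>i<m. c i * monomial01 i x)\<bar> \<le> sqrt (Jf m f f)) \<and>
     ip (\<lambda>x. f x - (\<Sum>i<m. c i * monomial01 i x)) (\<lambda>x. f x - (\<Sum>i<m. c i * monomial01 i x)) \<le> (1 + lam) * Jf m f f"
proof -
  obtain c where c0: "\<forall>x\<in>{0..1}. \<bar>f x - (\<Sum>i<m. c i * x ^ i)\<bar> \<le> sqrt (Jf m f f)"
    using sobolev_Taylor[OF sobolev0D(1)[OF f] m] by auto
  define T where "T = (\<lambda>x. \<Sum>i<m. c i * monomial01 i x)"
  have c: "\<bar>f x - T x\<bar> \<le> sqrt (Jf m f f)" if "x \<in> {0..1}" for x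
    using c0 that by (simp add: monomial01_def T_def)
  have T: "T \<in> W" unfolding T_def by (intro sum_mem monomial01_mem)
  have T_eq: "x \<in> {0..1} \<Longrightarrow> poly (\<Sum>i<m. monom (c i) i) x = T x" for x
    by (simp add: T_def monomial01_def poly_sum poly_monom)
  have deg: "degree (\<Sum>i<m. monom (c i) i) < m"
    using m by (intro degree_sum_less) (auto intro: le_less_trans[OF degree_monom_le])
  have JT: "Jf m T g = 0" if "g \<in> W" for g
    using Jf_poly_eq_0[OF deg sobolev0D(1)[OF that]]
      Jf_cong[OF poly_in_sobolev[of "\<Sum>i<m. monom (c i) i" m] sobolev0D(1)[OF that], of T g] T_eq by simp
  define s where "s = (\<lambda>x. f x - T x)"
  have s: "s \<in> W" unfolding s_def by (intro diff_mem f T)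
  have s': "s = (\<lambda>x. f x + (- 1) * T x)" by (simp add: s_def)
  have "Jf m s k = Jf m f k" if "k \<in> W" for k
    unfolding s' using Jf_lincomb[OF sobolev0D(1)[OF f] sobolev0D(1)[OF T] sobolev0D(1)[OF that], of "- 1"] JT[OF that] by simp
  from this[OF s] this[OF f] have J: "Jf m s s = Jf m f f" by (simp add: Jf_commute[of m f s])
  have "Vf s s \<le> (sqrt (Jf m f f))\<^sup>2" by (rule Vf_le_square[OF s m]) (use c in \<open>simp add: s_def\<close>)
  then have "Vf s s \<le> Jf m f f" by (simp add: Jf_nonneg)
  then have "ip s s \<le> (1 + lam) * Jf m f f" by (simp add: sinner_def J algebra_simps)
  then show ?thesis using c by (intro exI[of _ c]) (simp add: s_def T_def)
qed

text \<open>A1 gives convergence in \<open>snorm\<close>, but its functions may be non-measurable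
  off the interval, and then the \<open>Vf\<close> part of that norm can be the default value 0.
  Only the energy part is extracted; monomials of degree below m approximate what is left. Their
  place at the start of the sequence also serves the boundedness of the kernel.\<close>

lemma ex_dense_sequence:
  "\<exists>b. (\<forall>k. b k \<in> W) \<and> (\<forall>k<m. b k = monomial01 k) \<and>
     (\<forall>g\<in>W. \<forall>\<delta>>0. \<exists>N c. ip (\<lambda>x. g x - (\<Sum>k<N. c k * b k x)) (\<lambda>x. g x - (\<Sum>k<N. c k * b k x)) < \<delta>)"
proof -
  obtain \<phi> :: "nat \<Rightarrow> real \<Rightarrow> real" where \<phi>: "\<And>\<nu>. 1 \<le> \<nu> \<Longrightarrow> \<phi> \<nu> \<in> sobolev m"
    and lim: "\<And>g. g \<in> sobolev m \<Longrightarrow> (\<lambda>N. snorm m lam (\<lambda>x. g x - (\<Sum>\<nu>=1..N. Vf g (\<phi> \<nu>) * \<phi> \<nu> x))) \<longlonglongrightarrow> 0"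
    using A1 unfolding assumption_A1_def by blast
  define b where "b = (\<lambda>k. if k < m then monomial01 k else cut01 (\<phi> (Suc (k - m))))"
  have b: "b k \<in> W" for k by (simp add: b_def monomial01_mem cut01_in_sobolev0 \<phi>)
  have "\<exists>N c. ip (\<lambda>x. g x - (\<Sum>k<N. c k * b k x)) (\<lambda>x. g x - (\<Sum>k<N. c k * b k x)) < \<delta>"
    if g: "g \<in> W" and \<delta>: "\<delta> > 0" for g \<delta>
  proof -
    \<comment> \<open>Chosen so that lam * J < \<eta>^2 means (1 + lam) * J < \<delta>, where the
      left side bounds the Taylor remainder.\<close>
    define \<eta> where "\<eta> = sqrt (\<delta> * lam / (1 + lam))"
    have \<eta>: "\<eta> > 0" using \<delta> lam by (simp add: \<eta>_def)
    obtain N where N: "\<bar>snorm m lam (\<lambda>x. g x - (\<Sum>\<nu>=1..N. Vf g (\<phi> \<nu>) * \<phi> \<nu> x))\<bar> < \<eta>"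
      using LIMSEQ_D[OF lim[OF sobolev0D(1)[OF g]] \<eta>] by auto
    define a where "a = (\<lambda>k. Vf g (\<phi> (Suc k)))"
    define r0 where "r0 = (\<lambda>x. g x - (\<Sum>\<nu>=1..N. Vf g (\<phi> \<nu>) * \<phi> \<nu> x))"
    define r where "r = (\<lambda>x. g x - (\<Sum>k<N. a k * b (m + k) x))"
    have r: "r \<in> W" unfolding r_def by (intro diff_mem sum_mem g b)
    have rr0: "r x = r0 x" if "x \<in> {0..1}" for x
      using that by (simp add: r_def r0_def a_def b_def sum.atLeast1_atMost_eq)
    have r0: "r0 \<in> sobolev m" by (rule sobolev_cong[OF sobolev0D(1)[OF r] rr0])
    have Jr: "Jf m r r = Jf m r0 r0" by (rule Jf_cong[OF r0 r0]) (simp_all add: rr0)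
    have "lam * Jf m r0 r0 \<le> ip r0 r0" by (rule Jf_le_ip)
    also have "ip r0 r0 = (snorm m lam r0)\<^sup>2" by (simp add: snorm_def ip_pos)
    also have "\<dots> < \<eta>\<^sup>2"
    proof -
      have "\<bar>snorm m lam r0\<bar> < \<eta>" using N by (simp add: r0_def)
      from power_strict_mono[OF this, of 2] show ?thesis by simp
    qed
    also have "\<eta>\<^sup>2 = \<delta> * lam / (1 + lam)" using \<delta> lam by (simp add: \<eta>_def)
    finally have "lam * ((1 + lam) * Jf m r r) < lam * \<delta>" using lam by (simp add: Jr field_simps)
    then have J: "(1 + lam) * Jf m r r < \<delta>" using lam by (simp only: mult_less_cancel_left_pos)
    obtain c where c: "ip (\<lambda>x. r x - (\<Sum>i<m. c i * monomial01 i x)) (\<lambda>x. r x - (\<Sum>i<m. c i * monomial01 i x)) \<le> (1 + lam) * Jf m r r"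
      using Taylor_remainder[OF r] by blast
    define d where "d = (\<lambda>k. if k < m then c k else a (k - m))"
    have "(\<Sum>k<m + N. d k * b k x) = (\<Sum>i<m. c i * monomial01 i x) + (\<Sum>k<N. a k * b (m + k) x)" for x
    proof -
      have "(\<Sum>k<m + n. d k * b k x) = (\<Sum>k<m. d k * b k x) + (\<Sum>k<n. d (m + k) * b (m + k) x)" for n
        by (induction n) simp_all
      then show ?thesis by (simp add: d_def b_def)
    qed
    then have "(\<lambda>x. g x - (\<Sum>k<m + N. d k * b k x)) = (\<lambda>x. r x - (\<Sum>i<m. c i * monomial01 i x))"
      by (simp add: r_def fun_eq_iff)
    then show ?thesis using c J by (intro exI[of _ "m + N"] exI[of _ d]) simp
  qed
  with b show ?thesis by (intro exI[of _ b]) (simp add: b_def)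
qed

end

section \<open>The orthonormalised dense sequence\<close>

locale spline_basis = spline_kernel +
  fixes b :: "nat \<Rightarrow> real \<Rightarrow> real"
  assumes b_in_W: "b k \<in> sobolev0 m"
    and b_mono: "k < m \<Longrightarrow> b k = cut01 (\<lambda>x. x ^ k)"
    and b_dense: "g \<in> sobolev0 m \<Longrightarrow> \<delta> > 0 \<Longrightarrow>
      \<exists>N c. sinner m lam (\<lambda>x. g x - (\<Sum>k<N. c k * b k x)) (\<lambda>x. g x - (\<Sum>k<N. c k * b k x)) < \<delta>"
begin

sublocale gram_schmidt_basis W ip b
  by unfold_locales (rule b_in_W)

lemma ip_diff_proj_tendsto:
  assumes g: "g \<in> W"
  shows "(\<lambda>N. ip (\<lambda>x. g x - proj N g x) (\<lambda>x. g x - proj N g x)) \<longlonglongrightarrow> 0"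
proof (rule LIMSEQ_I)
  fix r :: real assume "r > 0"
  from b_dense[OF g this] obtain N c where N: "ip (\<lambda>x. g x - (\<Sum>k<N. c k * b k x)) (\<lambda>x. g x - (\<Sum>k<N. c k * b k x)) < r" by blast
  obtain d where d: "(\<lambda>x. \<Sum>k<N. c k * b k x) = comb N d" using lincomb_b_eq_comb by blast
  then have Nd: "ip (\<lambda>x. g x - comb N d x) (\<lambda>x. g x - comb N d x) < r" using N by (simp add: fun_eq_iff)
  show "\<exists>no. \<forall>n\<ge>no. norm (ip (\<lambda>x. g x - proj n g x) (\<lambda>x. g x - proj n g x) - 0) < r"
  proof (intro exI[of _ N] allI impI)
    fix n assume "N \<le> n"
    from comb_mono[OF this, of d] ip_diff_proj_le[OF g, of n "\<lambda>k. if k < N then d k else 0"] Nd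
    have "ip (\<lambda>x. g x - proj n g x) (\<lambda>x. g x - proj n g x) < r" by simp
    then show "norm (ip (\<lambda>x. g x - proj n g x) (\<lambda>x. g x - proj n g x) - 0) < r" using ip_pos by simp
  qed
qed

text \<open>The supremum in \<open>cK\<close> bounds the kernel only if it is taken over a bounded
  set. Point evaluation is bounded uniformly in x: the Taylor polynomial lies in the span of m
  bounded vectors, and the remainder is controlled by its energy. Applied to the cut-off of
  \<open>K x\<close>, this bounds K x x by B times its own square root.\<close>

lemma K_diag_bounded: "\<exists>C. \<forall>x\<in>{0..1}. K x x \<le> C"
proof -
  have "\<exists>C. \<forall>x. \<bar>e k x\<bar> \<le> C" for k using sobolev0_bounded[OF e_mem m] by blast
  then obtain C where C: "\<And>k x. \<bar>e k x\<bar> \<le> C k" by metis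
  have C0: "0 \<le> C k" for k using C[of k 0] by simp
  \<comment> \<open>The polynomial part T = f - R has squared norm at most 2 * ip f f + 2 * ip R R,
    and ip R R \<le> (1 + lam) / lam * ip f f.\<close>
  define A where "A = 2 + 2 * (1 + lam) / lam"
  define B where "B = (\<Sum>k<m. C k) * sqrt A + 1 / sqrt lam"
  have A0: "A \<ge> 0" using lam by (simp add: A_def)
  have bd: "\<bar>f x\<bar> \<le> B * sqrt (ip f f)" if f: "f \<in> W" and x: "x \<in> {0..1}" for f x
  proof -
    obtain c where c: "\<forall>x\<in>{0..1}. \<bar>f x - (\<Sum>i<m. c i * monomial01 i x)\<bar> \<le> sqrt (Jf m f f)"
      "ip (\<lambda>x. f x - (\<Sum>i<m. c i * monomial01 i x)) (\<lambda>x. f x - (\<Sum>i<m. c i * monomial01 i x)) \<le> (1 + lam) * Jf m f f"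
      using Taylor_remainder[OF f] by blast
    obtain d where d: "(\<lambda>x. \<Sum>k<m. c k * b k x) = comb m d" using lincomb_b_eq_comb by blast
    have T: "(\<lambda>x. \<Sum>i<m. c i * monomial01 i x) = comb m d" using d b_mono by (simp add: fun_eq_iff monomial01_def)
    define T where "T = comb m d"
    have TW: "T \<in> W" by (simp add: T_def comb_mem)
    define R where "R = (\<lambda>x. f x - T x)"
    have RW: "R \<in> W" unfolding R_def by (intro diff_mem f TW)
    have Tx: "(\<Sum>i<m. c i * monomial01 i x) = T x" for x using T by (simp add: T_def fun_eq_iff)
    have JJ: "Jf m f f \<le> ip f f / lam" using Jf_le_ip[of f] lam by (simp add: field_simps)
    have "ip R R \<le> (1 + lam) * Jf m f f" using c(2) by (simp add: Tx R_def)
    also have "\<dots> \<le> (1 + lam) * (ip f f / lam)" using JJ lam by (intro mult_left_mono) auto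
    finally have R: "ip R R \<le> (1 + lam) / lam * ip f f" by simp
    have "ip T T \<le> 2 * ip f f + 2 * ip R R"
    proof -
      have TR: "T = (\<lambda>x. f x - R x)" by (simp add: R_def)
      \<comment> \<open>The squared norm of f + R; its nonnegativity bounds the cross term in the
        expansion of f - R, as in the parallelogram law.\<close>
      have "0 \<le> ip (\<lambda>x. f x - (- 1) * R x) (\<lambda>x. f x - (- 1) * R x)" by (rule ip_pos)
      also have "\<dots> = ip f f - 2 * ip f (\<lambda>x. (- 1) * R x) + ip (\<lambda>x. (- 1) * R x) (\<lambda>x. (- 1) * R x)"
        by (rule ip_diff_self[OF f scale_mem[OF RW]])
      also have "ip f (\<lambda>x. (- 1) * R x) = - ip f R"
        using ip_scale[OF RW f, of "- 1"] by (simp add: ip_commute[of f])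
      also have "ip (\<lambda>x. (- 1) * R x) (\<lambda>x. (- 1) * R x) = ip R R"
        using ip_scale[OF RW scale_mem[OF RW], of "- 1" "- 1"] ip_scale[OF RW RW, of "- 1"]
        by (simp add: ip_commute[of R "\<lambda>x. - R x"])
      finally have "0 \<le> ip f f + 2 * ip f R + ip R R" by simp
      moreover have "ip T T = ip f f - 2 * ip f R + ip R R"
        by (subst (1 2) TR) (rule ip_diff_self[OF f RW])
      ultimately show ?thesis by simp
    qed
    also have "\<dots> \<le> 2 * ip f f + 2 * ((1 + lam) / lam * ip f f)" using R by linarith
    also have "\<dots> = A * ip f f" unfolding A_def by (simp only: distrib_right mult.assoc times_divide_eq_right times_divide_eq_left)
    finally have TA: "sqrt (ip T T) \<le> sqrt A * sqrt (ip f f)"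
      by (simp add: real_sqrt_mult[symmetric])
    have "\<bar>T x\<bar> \<le> (\<Sum>k<m. \<bar>d k * e k x\<bar>)" unfolding T_def comb_def by (rule sum_abs)
    also have "\<dots> \<le> (\<Sum>k<m. C k * sqrt (ip T T))"
    proof (rule sum_mono)
      fix k assume "k \<in> {..<m}"
      then have k: "k < m" by simp
      show "\<bar>d k * e k x\<bar> \<le> C k * sqrt (ip T T)"
      proof (cases "e k = (\<lambda>_. 0)")
        case True
        then show ?thesis using C0 ip_pos by simp
      next
        case False
        then have 1: "ip (e k) (e k) = 1" using ip_e_self by blast
        then have "d k = ip T (e k)" using ip_comb_e[OF k, of d] by (simp add: T_def)
        moreover have "\<bar>ip T (e k)\<bar> \<le> sqrt (ip T T)"
          using ip_Cauchy_Schwarz_abs[OF TW e_mem, of k] 1 by simp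
        ultimately show ?thesis using C[of k x] C0[of k] ip_pos
          by (simp add: abs_mult mult.commute mult_mono)
      qed
    qed
    also have "\<dots> = (\<Sum>k<m. C k) * sqrt (ip T T)" by (simp add: sum_distrib_right)
    also have "\<dots> \<le> (\<Sum>k<m. C k) * (sqrt A * sqrt (ip f f))"
      using TA C0 by (intro mult_left_mono sum_nonneg) auto
    finally have 1: "\<bar>T x\<bar> \<le> (\<Sum>k<m. C k) * sqrt A * sqrt (ip f f)" by simp
    have "\<bar>f x - T x\<bar> \<le> sqrt (Jf m f f)" using c(1) x by (simp add: Tx)
    also have "\<dots> \<le> 1 / sqrt lam * sqrt (ip f f)" using JJ by (simp add: real_sqrt_divide[symmetric])
    finally show ?thesis using 1 unfolding B_def by (simp add: algebra_simps abs_if split: if_splits)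
  qed
  have "K x x \<le> B\<^sup>2" if x: "x \<in> {0..1}" for x
  proof -
    have "K x x \<le> B * sqrt (K x x)"
      using bd[OF K_mem[OF x] x] K_diag_nonneg[OF x] unfolding K_diag[OF x] cut01_eq[OF x] by simp
    moreover have "K x x = sqrt (K x x) * sqrt (K x x)" using K_diag_nonneg[OF x] by simp
    ultimately have "sqrt (K x x) \<le> B \<or> sqrt (K x x) = 0"
      by (metis mult_le_cancel_right real_sqrt_ge_zero K_diag_nonneg[OF x] less_eq_real_def not_less)
    then show ?thesis
    proof
      assume "sqrt (K x x) \<le> B"
      then show ?thesis using power_mono[of "sqrt (K x x)" B 2] K_diag_nonneg[OF x] by simp
    qed simp
  qed
  then show ?thesis by blast
qed

text \<open>The coefficients of \<open>K x\<close> along the sequence are the values e k x, so this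
  is Bessel's inequality for the kernel.\<close>

lemma sum_e_square_le:
  assumes "x \<in> {0..1}"
  shows "(\<Sum>k<N. (e k x)\<^sup>2) \<le> K x x"
  using Bessel[OF K_mem[OF assms], of N] unfolding reproducing[OF assms e_mem] K_diag[OF assms] .

end

section \<open>Concentration over the sample\<close>

text \<open>Markov's inequality for exp (a * F) on the event P alone. For the noise, P is the event
  of a good design, on which the exponential moment is controlled.\<close>

lemma emeasure_exp_Markov:
  assumes [measurable]: "F \<in> borel_measurable M" "Measurable.pred M P" and a: "0 \<le> a" and C: "0 \<le> C"
    and le: "(\<integral>\<^sup>+x. (if P x then ennreal (exp (a * F x)) else 0) \<partial>M) \<le> ennreal C"
  shows "emeasure M {x \<in> space M. P x \<and> F x > t} \<le> ennreal (exp (- (a * t)) * C)"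
proof -
  have "emeasure M {x \<in> space M. P x \<and> F x > t} = (\<integral>\<^sup>+x. indicator {x \<in> space M. P x \<and> F x > t} x \<partial>M)"
    by simp
  also have "\<dots> \<le> (\<integral>\<^sup>+x. ennreal (exp (- (a * t))) * (if P x then ennreal (exp (a * F x)) else 0) \<partial>M)"
  proof (rule nn_integral_mono)
    fix x assume x: "x \<in> space M"
    show "indicator {x \<in> space M. P x \<and> F x > t} x \<le> ennreal (exp (- (a * t))) * (if P x then ennreal (exp (a * F x)) else 0)"
    proof (cases "P x \<and> F x > t")
      case True
      have "a * t \<le> a * F x" using True a by (intro mult_left_mono) auto
      then have "1 \<le> exp (- (a * t)) * exp (a * F x)" unfolding exp_add[symmetric] by simp
      then have "ennreal 1 \<le> ennreal (exp (- (a * t)) * exp (a * F x))" by (rule ennreal_leI)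
      with True x show ?thesis by (simp add: ennreal_mult)
    qed auto
  qed
  also have "\<dots> = ennreal (exp (- (a * t))) * (\<integral>\<^sup>+x. (if P x then ennreal (exp (a * F x)) else 0) \<partial>M)"
    by (rule nn_integral_cmult) measurable
  also have "\<dots> \<le> ennreal (exp (- (a * t))) * ennreal C" by (intro mult_left_mono le) simp
  finally show ?thesis using C by (simp add: ennreal_mult)
qed

abbreviation gauss :: "real measure" where
  "gauss \<equiv> density lborel std_normal_density"

lemma prob_space_gauss: "prob_space gauss"
  by (rule prob_space_normal_density) simp

lemma prob_space_obs_dist: "prob_space obs_dist"
  unfolding obs_dist_def by (intro prob_space_pair prob_space_unifI prob_space_gauss)

lemma sets_obs_dist [measurable_cong]: "sets obs_dist = sets (borel \<Otimes>\<^sub>M borel)"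
  unfolding obs_dist_def by (intro sets_pair_measure_cong) auto

lemma prob_space_sample_space: "prob_space (sample_space n)"
  unfolding sample_space_def by (intro prob_space_PiM prob_space_obs_dist)

lemma measurable_sample_fst [measurable]: "i < n \<Longrightarrow> (\<lambda>\<omega>. fst (\<omega> i)) \<in> sample_space n \<rightarrow>\<^sub>M borel"
  and measurable_sample_snd [measurable]: "i < n \<Longrightarrow> (\<lambda>\<omega>. snd (\<omega> i)) \<in> sample_space n \<rightarrow>\<^sub>M borel"
proof -
  assume i: "i < n"
  have c: "(\<lambda>\<omega>. \<omega> i) \<in> sample_space n \<rightarrow>\<^sub>M borel \<Otimes>\<^sub>M borel"
    unfolding sample_space_def using i sets_obs_dist
    by (subst measurable_cong_sets[OF refl sets_obs_dist[symmetric]]) (rule measurable_component_singleton, simp)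
  show "(\<lambda>\<omega>. fst (\<omega> i)) \<in> sample_space n \<rightarrow>\<^sub>M borel" "(\<lambda>\<omega>. snd (\<omega> i)) \<in> sample_space n \<rightarrow>\<^sub>M borel"
    by (rule measurable_compose[OF c], measurable)+
qed

lemma distr_obs_dist_fst: "distr obs_dist unifI fst = unifI"
proof (rule measure_eqI)
  interpret B: prob_space gauss by (rule prob_space_gauss)
  fix X assume "X \<in> sets (distr obs_dist unifI fst)"
  then have X: "X \<in> sets unifI" by simp
  then have "fst -` X \<inter> space (unifI \<Otimes>\<^sub>M gauss) = X \<times> space gauss" by (auto simp: space_pair_measure)
  then have "emeasure (distr obs_dist unifI fst) X = emeasure (unifI \<Otimes>\<^sub>M gauss) (X \<times> space gauss)"
    using X unfolding obs_dist_def by (simp only: emeasure_distr[OF measurable_fst X])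
  also have "\<dots> = emeasure unifI X * emeasure gauss (space gauss)"
    by (rule B.emeasure_pair_measure_Times[OF X sets.top])
  finally show "emeasure (distr obs_dist unifI fst) X = emeasure unifI X"
    unfolding B.emeasure_space_1 by simp
qed simp

lemma measurable_obs_dist_fst: "fst \<in> obs_dist \<rightarrow>\<^sub>M unifI"
  unfolding obs_dist_def by (rule measurable_fst)

lemma integral_obs_dist_fst:
  fixes f :: "real \<Rightarrow> real"
  assumes [measurable]: "f \<in> borel_measurable borel"
  shows "(\<integral>z. f (fst z) \<partial>obs_dist) = (\<integral>x. f x \<partial>unifI)"
proof -
  have "(\<integral>x. f x \<partial>unifI) = (\<integral>x. f x \<partial>distr obs_dist unifI fst)" by (simp add: distr_obs_dist_fst)
  also have "\<dots> = (\<integral>z. f (fst z) \<partial>obs_dist)"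
    by (rule integral_distr[OF measurable_obs_dist_fst]) measurable
  finally show ?thesis by simp
qed

lemma AE_sample_space_fst: "AE \<omega> in sample_space n. \<forall>i<n. fst (\<omega> i) \<in> {0..1}"
proof -
  have "AE x in distr obs_dist unifI fst. x \<in> {0..1}" unfolding distr_obs_dist_fst by (rule AE_unifI)
  then have ae: "AE z in obs_dist. fst z \<in> {0..1}"
    by (subst (asm) AE_distr_iff[OF measurable_obs_dist_fst]) auto
  have "AE \<omega> in sample_space n. fst (\<omega> i) \<in> {0..1}" if "i < n" for i
    unfolding sample_space_def by (rule AE_PiM_component[OF prob_space_obs_dist _ ae]) (use that in auto)
  then have "AE \<omega> in sample_space n. \<forall>i\<in>{..<n}. fst (\<omega> i) \<in> {0..1}"
    by (intro AE_finite_allI) auto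
  then show ?thesis by (auto elim!: eventually_mono)
qed

section \<open>Design deviation and noise norm on finite-dimensional projections\<close>

locale spline_sample = spline_basis +
  fixes \<kappa> :: real and n :: nat
  assumes kappa: "x \<in> {0..1} \<Longrightarrow> K x x \<le> \<kappa>\<^sup>2" and kappa_pos: "\<kappa> > 0" and n_pos: "n \<ge> 1"
begin

lemma e_measurable [measurable]: "e k \<in> borel_measurable borel"
  by (rule sobolev0_measurable[OF e_mem m])

lemma sum_e_le: "(\<Sum>k<N. (e k x)\<^sup>2) \<le> \<kappa>\<^sup>2"
proof (cases "x \<in> {0..1}")
  case True
  from sum_e_square_le[OF this, of N] kappa[OF this] show ?thesis by linarith
next
  case False
  then show ?thesis using sobolev0D(2)[OF e_mem False] by simp
qed

definition y :: "nat \<times> nat \<Rightarrow> real \<Rightarrow> real" where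
  "y p x = e (fst p) x * e (snd p) x - Vf (e (fst p)) (e (snd p))"

text \<open>\<open>n\<^sup>2\<close> times the squared Hilbert-Schmidt distance, on the span of the first \<open>N\<close> basis vectors,
  between the empirical second moment operator at the design points and its expectation.\<close>

definition hs :: "nat \<Rightarrow> (nat \<Rightarrow> real) \<Rightarrow> real" where
  "hs N x = (\<Sum>p\<in>{..<N} \<times> {..<N}. (\<Sum>i<n. y p (x i))\<^sup>2)"

text \<open>The squared norm of the projection of \<open>\<Sum>i<n. v i * K (x i)\<close>.\<close>

definition noise :: "nat \<Rightarrow> (nat \<Rightarrow> real) \<Rightarrow> (nat \<Rightarrow> real) \<Rightarrow> real" where
  "noise N x v = (\<Sum>k<N. (\<Sum>i<n. v i * e k (x i))\<^sup>2)"

lemma y_measurable [measurable]: "y p \<in> borel_measurable borel"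
  unfolding y_def[abs_def] by measurable

lemma sum_ee_le: "(\<Sum>p\<in>{..<N} \<times> {..<N}. (e (fst p) x * e (snd p) x)\<^sup>2) \<le> \<kappa> ^ 4"
proof -
  have "(\<Sum>p\<in>{..<N} \<times> {..<N}. (e (fst p) x * e (snd p) x)\<^sup>2) = (\<Sum>k<N. (e k x)\<^sup>2) * (\<Sum>k<N. (e k x)\<^sup>2)"
    by (simp add: sum.cartesian_product' sum_product power_mult_distrib)
  also have "\<dots> \<le> \<kappa>\<^sup>2 * \<kappa>\<^sup>2" by (intro mult_mono sum_e_le sum_nonneg) auto
  finally show ?thesis by (simp add: power2_eq_square power4_eq_xxxx mult.assoc)
qed

lemma integrable_ee: "integrable unifI (\<lambda>x. e j x * e k x)"
  by (rule sobolev0_integrable_mult[OF e_mem e_mem m])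

text \<open>Each squared mean is at most the mean of the square, by nonnegativity of the variance,
  and the squares add up to at most \<kappa>^4 pointwise, whatever N is.\<close>

lemma sum_V_le: "(\<Sum>p\<in>{..<N} \<times> {..<N}. (Vf (e (fst p)) (e (snd p)))\<^sup>2) \<le> \<kappa> ^ 4"
proof -
  interpret U: prob_space unifI by (rule prob_space_unifI)
  have int2: "integrable unifI (\<lambda>x. (e j x * e k x)\<^sup>2)" for j k
  proof (rule U.integrable_const_bound[of _ "\<kappa> ^ 4"])
    show "AE x in unifI. norm ((e j x * e k x)\<^sup>2) \<le> \<kappa> ^ 4"
    proof (rule AE_I2)
      fix x
      have "(e j x * e k x)\<^sup>2 \<le> (\<Sum>p\<in>{..<Suc (max j k)} \<times> {..<Suc (max j k)}. (e (fst p) x * e (snd p) x)\<^sup>2)"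
        using member_le_sum[of "(j, k)" "{..<Suc (max j k)} \<times> {..<Suc (max j k)}" "\<lambda>p. (e (fst p) x * e (snd p) x)\<^sup>2"]
        by (auto simp: less_Suc_eq_le)
      with sum_ee_le[where x = x and N = "Suc (max j k)"] show "norm ((e j x * e k x)\<^sup>2) \<le> \<kappa> ^ 4" by simp
    qed
  qed measurable
  have "(Vf (e j) (e k))\<^sup>2 \<le> U.expectation (\<lambda>x. (e j x * e k x)\<^sup>2)" for j k
    using U.variance_eq[OF integrable_ee int2, of j k] U.variance_positive[of "\<lambda>x. e j x * e k x"]
    by (simp add: Vf_def)
  then have "(\<Sum>p\<in>{..<N} \<times> {..<N}. (Vf (e (fst p)) (e (snd p)))\<^sup>2)
      \<le> (\<Sum>p\<in>{..<N} \<times> {..<N}. U.expectation (\<lambda>x. (e (fst p) x * e (snd p) x)\<^sup>2))"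
    by (intro sum_mono)
  also have "\<dots> = U.expectation (\<lambda>x. \<Sum>p\<in>{..<N} \<times> {..<N}. (e (fst p) x * e (snd p) x)\<^sup>2)"
    by (subst Bochner_Integration.integral_sum) (auto simp: int2)
  also have "\<dots> \<le> U.expectation (\<lambda>_. \<kappa> ^ 4)"
    by (intro integral_mono Bochner_Integration.integrable_sum int2 sum_ee_le) auto
  also have "\<dots> = \<kappa> ^ 4" using U.prob_space by simp
  finally show ?thesis .
qed

lemma sum_y_le: "(\<Sum>p\<in>{..<N} \<times> {..<N}. (y p x)\<^sup>2) \<le> 4 * \<kappa> ^ 4"
proof -
  have "(\<Sum>p\<in>{..<N} \<times> {..<N}. (y p x)\<^sup>2)
     \<le> (\<Sum>p\<in>{..<N} \<times> {..<N}. 2 * (e (fst p) x * e (snd p) x)\<^sup>2 + 2 * (Vf (e (fst p)) (e (snd p)))\<^sup>2)"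
  proof (rule sum_mono)
    fix p
    have "(a - b)\<^sup>2 \<le> 2 * a\<^sup>2 + 2 * b\<^sup>2" for a b :: real
      using zero_le_power2[of "a + b"] by (simp add: power2_eq_square algebra_simps)
    then show "(y p x)\<^sup>2 \<le> 2 * (e (fst p) x * e (snd p) x)\<^sup>2 + 2 * (Vf (e (fst p)) (e (snd p)))\<^sup>2"
      unfolding y_def .
  qed
  also have "\<dots> = 2 * (\<Sum>p\<in>{..<N} \<times> {..<N}. (e (fst p) x * e (snd p) x)\<^sup>2) + 2 * (\<Sum>p\<in>{..<N} \<times> {..<N}. (Vf (e (fst p)) (e (snd p)))\<^sup>2)"
    by (simp only: sum.distrib sum_distrib_left)
  finally show ?thesis using sum_ee_le[where x = x and N = N] sum_V_le[of N] by linarith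
qed

lemma emeasure_hs_le:
  "emeasure (sample_space n) {\<omega> \<in> space (sample_space n). hs N (\<lambda>i. fst (\<omega> i)) > (real n / 8)\<^sup>2}
     \<le> ennreal (sqrt 2 * exp (- real n / (1024 * \<kappa> ^ 4)))"
proof -
  interpret O: prob_space obs_dist by (rule prob_space_obs_dist)
  \<comment> \<open>Half of the critical value: 2 * n * a * B = 1/2 for the bound B = 4 * \<kappa>^4
    on one summand, so the exponential moment is at most sqrt 2.\<close>
  define a where "a = 1 / (16 * real n * \<kappa> ^ 4)"
  have a: "a \<ge> 0" by (simp add: a_def)
  have k4: "\<kappa> ^ 4 > 0" using kappa_pos by simp
  have nn: "real n > 0" using n_pos by simp
  have aB: "2 * real n * a * (4 * \<kappa> ^ 4) = 1 / 2" using k4 nn by (simp add: a_def field_simps)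
  have "(\<integral>\<^sup>+\<omega>. ennreal (exp (a * (\<Sum>p\<in>{..<N} \<times> {..<N}. (\<Sum>i<n. y p (fst (\<omega> i)))\<^sup>2))) \<partial>PiM {..<n} (\<lambda>_. obs_dist))
      \<le> ennreal (1 / sqrt (1 - 2 * real n * a * (4 * \<kappa> ^ 4)))"
  proof (rule O.exp_square_norm_sum_le[where y = "\<lambda>p z. y p (fst z)"])
    show "(\<lambda>z. y p (fst z)) \<in> borel_measurable obs_dist" for p by measurable
    show "O.expectation (\<lambda>z. y p (fst z)) = 0" for p
    proof -
      interpret U: prob_space unifI by (rule prob_space_unifI)
      have "O.expectation (\<lambda>z. y p (fst z)) = (\<integral>x. y p x \<partial>unifI)"
        by (rule integral_obs_dist_fst[OF y_measurable])
      also have "\<dots> = 0" unfolding y_def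
        by (subst Bochner_Integration.integral_diff[OF integrable_ee]) (use U.prob_space in \<open>auto simp: Vf_def\<close>)
      finally show ?thesis .
    qed
    show "2 * real n * a * (4 * \<kappa> ^ 4) < 1" using aB by simp
  qed (auto simp: sum_y_le a)
  then have "(\<integral>\<^sup>+\<omega>. (if True then ennreal (exp (a * hs N (\<lambda>i. fst (\<omega> i)))) else 0) \<partial>sample_space n) \<le> ennreal (sqrt 2)"
    unfolding aB by (simp add: hs_def sample_space_def real_sqrt_divide)
  then have "emeasure (sample_space n) {\<omega> \<in> space (sample_space n). True \<and> hs N (\<lambda>i. fst (\<omega> i)) > (real n / 8)\<^sup>2}
      \<le> ennreal (exp (- (a * (real n / 8)\<^sup>2)) * sqrt 2)"
    by (intro emeasure_exp_Markov) (auto simp: a hs_def)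
  also have "a * (real n / 8)\<^sup>2 = real n / (1024 * \<kappa> ^ 4)"
    using k4 nn by (simp add: a_def field_simps power2_eq_square)
  finally show ?thesis by (simp add: mult.commute)
qed

lemma Vf_comb: "f \<in> W \<Longrightarrow> Vf (comb N c) f = (\<Sum>k<N. c k * Vf (e k) f)"
proof (induction N)
  case 0
  then show ?case by (simp add: comb_def Vf_def)
next
  case (Suc N)
  have "comb (Suc N) c = (\<lambda>x. comb N c x + c N * e N x)" by (simp add: comb_def fun_eq_iff)
  then show ?case using Vf_lincomb[OF comb_mem e_mem Suc.prems m, of N c "c N" N] Suc by simp
qed

text \<open>The operator norm is at most the Hilbert-Schmidt norm: the form pairs the tensor with
  entries c j * c k, whose norm is the sum of the (c k)^2, with the matrix of summed
  deviations.\<close>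

lemma empirical_quadratic_form_le:
  assumes "hs N x \<le> (real n / 8)\<^sup>2"
  shows "\<bar>(\<Sum>i<n. (comb N c (x i))\<^sup>2) - real n * Vf (comb N c) (comb N c)\<bar> \<le> real n / 8 * (\<Sum>k<N. (c k)\<^sup>2)"
proof -
  let ?P = "{..<N} \<times> {..<N}"
  define S where "S = (\<Sum>k<N. (c k)\<^sup>2)"
  have S0: "S \<ge> 0" by (simp add: S_def sum_nonneg)
  have sq: "(comb N c z)\<^sup>2 = (\<Sum>p\<in>?P. c (fst p) * c (snd p) * (e (fst p) z * e (snd p) z))" for z
    by (simp add: comb_def power2_eq_square sum_product sum.cartesian_product' mult_ac)
  have "Vf (comb N c) (comb N c) = (\<Sum>j<N. c j * Vf (e j) (comb N c))"
    by (rule Vf_comb[OF comb_mem])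
  also have "\<dots> = (\<Sum>j<N. c j * (\<Sum>k<N. c k * Vf (e k) (e j)))"
    by (simp only: Vf_commute[of "e _" "comb N c"] Vf_comb[OF e_mem])
  also have "\<dots> = (\<Sum>p\<in>?P. c (fst p) * c (snd p) * Vf (e (fst p)) (e (snd p)))"
    by (simp add: sum.cartesian_product' sum_distrib_left mult.assoc Vf_commute[of "e _" "e _"])
  finally have V: "Vf (comb N c) (comb N c) = (\<Sum>p\<in>?P. c (fst p) * c (snd p) * Vf (e (fst p)) (e (snd p)))" .
  have "(\<Sum>i<n. (comb N c (x i))\<^sup>2) - real n * Vf (comb N c) (comb N c)
      = (\<Sum>i<n. (comb N c (x i))\<^sup>2 - Vf (comb N c) (comb N c))" by (simp add: sum_subtractf)
  also have "\<dots> = (\<Sum>i<n. \<Sum>p\<in>?P. c (fst p) * c (snd p) * y p (x i))"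
    unfolding sq V sum_subtractf[symmetric] y_def by (simp add: right_diff_distrib)
  also have "\<dots> = (\<Sum>p\<in>?P. (c (fst p) * c (snd p)) * (\<Sum>i<n. y p (x i)))"
    by (subst sum.swap) (simp add: sum_distrib_left)
  finally have eq: "(\<Sum>i<n. (comb N c (x i))\<^sup>2) - real n * Vf (comb N c) (comb N c)
      = (\<Sum>p\<in>?P. (c (fst p) * c (snd p)) * (\<Sum>i<n. y p (x i)))" .
  have "(\<Sum>p\<in>?P. (c (fst p) * c (snd p)) * (\<Sum>i<n. y p (x i)))\<^sup>2
      \<le> (\<Sum>p\<in>?P. (c (fst p) * c (snd p))\<^sup>2) * hs N x"
    unfolding hs_def by (rule Cauchy_Schwarz_ineq_sum)
  also have "(\<Sum>p\<in>?P. (c (fst p) * c (snd p))\<^sup>2) = S\<^sup>2"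
    unfolding S_def by (simp add: sum.cartesian_product' sum_product power_mult_distrib power2_eq_square[of "sum _ _"])
  also have "S\<^sup>2 * hs N x \<le> S\<^sup>2 * (real n / 8)\<^sup>2" by (intro mult_left_mono assms) simp
  also have "\<dots> = (real n / 8 * S)\<^sup>2" by (simp only: power_mult_distrib mult.commute)
  finally have "\<bar>\<Sum>p\<in>?P. (c (fst p) * c (snd p)) * (\<Sum>i<n. y p (x i))\<bar> \<le> real n / 8 * S"
    using S0 by (simp add: abs_le_square_iff[symmetric])
  then show ?thesis unfolding eq S_def .
qed

text \<open>The Gram matrix of the projected kernels and the unnormalised empirical second moment
  operator share their operator norm, here at most n * (1 + 1/8). Concretely, the noise form Q
  equals the sum of the v i * comb N c (x i); Cauchy-Schwarz brings in the empirical quadratic form,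
  which is at most 9 * n / 8 * Q, and one factor Q cancels.\<close>

lemma noise_le:
  assumes "hs N x \<le> (real n / 8)\<^sup>2"
  shows "noise N x v \<le> 9 * real n / 8 * (\<Sum>i<n. (v i)\<^sup>2)"
proof -
  define c where "c = (\<lambda>k. \<Sum>i<n. v i * e k (x i))"
  define Q where "Q = (\<Sum>k<N. (c k)\<^sup>2)"
  have Q0: "Q \<ge> 0" by (simp add: Q_def sum_nonneg)
  have Q: "noise N x v = Q" by (simp add: noise_def Q_def c_def)
  have "Q = (\<Sum>k<N. c k * (\<Sum>i<n. v i * e k (x i)))" by (simp add: Q_def c_def power2_eq_square)
  also have "\<dots> = (\<Sum>i<n. v i * comb N c (x i))"
    unfolding comb_def sum_distrib_left by (subst sum.swap) (simp add: mult_ac)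
  finally have "Q\<^sup>2 = (\<Sum>i<n. v i * comb N c (x i))\<^sup>2" by simp
  also have "\<dots> \<le> (\<Sum>i<n. (v i)\<^sup>2) * (\<Sum>i<n. (comb N c (x i))\<^sup>2)" by (rule Cauchy_Schwarz_ineq_sum)
  also have "\<dots> \<le> (\<Sum>i<n. (v i)\<^sup>2) * (9 * real n / 8 * Q)"
  proof (intro mult_left_mono sum_nonneg)
    have "Vf (comb N c) (comb N c) \<le> Q"
      using Vf_le_ip[of "comb N c"] ip_comb_self_le[of N c] by (simp add: Q_def)
    then have "real n * Vf (comb N c) (comb N c) \<le> real n * Q" by (intro mult_left_mono) auto
    with abs_le_D1[OF empirical_quadratic_form_le[OF assms, of c]] show "(\<Sum>i<n. (comb N c (x i))\<^sup>2) \<le> 9 * real n / 8 * Q"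
      unfolding Q_def[symmetric] by (simp add: field_simps)
  qed auto
  finally have "Q * Q \<le> (9 * real n / 8 * (\<Sum>i<n. (v i)\<^sup>2)) * Q" by (simp add: power2_eq_square mult_ac)
  then show ?thesis using Q0 n_pos unfolding Q
    by (cases "Q = 0") (auto intro!: mult_nonneg_nonneg sum_nonneg)
qed

lemma nn_integral_exp_noise_le:
  assumes "hs N x \<le> (real n / 8)\<^sup>2"
  shows "(\<integral>\<^sup>+v. ennreal (exp (2 / (9 * real n) * noise N x v)) \<partial>PiM {..<n} (\<lambda>_. gauss)) \<le> ennreal (exp (4 * \<kappa>\<^sup>2 / 9))"
proof -
  define G where "G = (\<lambda>i j. \<Sum>k<N. e k (x i) * e k (x j))"
  have noise: "noise N x v = (\<Sum>i<n. \<Sum>j<n. G i j * v i * v j)" for v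
  proof -
    have "noise N x v = (\<Sum>k<N. \<Sum>i<n. \<Sum>j<n. (v i * e k (x i)) * (v j * e k (x j)))"
      by (simp add: noise_def power2_eq_square sum_product)
    also have "\<dots> = (\<Sum>i<n. \<Sum>k<N. \<Sum>j<n. (v i * e k (x i)) * (v j * e k (x j)))" by (rule sum.swap)
    also have "\<dots> = (\<Sum>i<n. \<Sum>j<n. \<Sum>k<N. (v i * e k (x i)) * (v j * e k (x j)))"
      by (intro sum.cong refl sum.swap)
    finally show ?thesis by (simp add: G_def sum_distrib_left sum_distrib_right mult_ac)
  qed
  \<comment> \<open>Half of the critical value for the operator norm bound L, so 1 - 2 * a * L =
    1/2. The trace is at most n * \<kappa>^2, whence the exponent 2 * a * n * \<kappa>^2 = 4 *
    \<kappa>^2 / 9.\<close>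
  define a where "a = 2 / (9 * real n)"
  define L where "L = 9 * real n / 8"
  have nn: "real n > 0" using n_pos by simp
  have aL: "2 * a * L = 1 / 2" using nn by (simp add: a_def L_def)
  have "(\<integral>\<^sup>+v. ennreal (exp (a * (\<Sum>i<n. \<Sum>j<n. G i j * v i * v j))) \<partial>PiM {..<n} (\<lambda>_. gauss))
      \<le> ennreal (exp (a * (\<Sum>i<n. G i i) / (1 - 2 * a * L)))"
  proof (rule gaussian_quadratic_form_exp_le)
    show "G i j = G j i" for i j by (simp add: G_def mult.commute)
    show "0 \<le> (\<Sum>i<n. \<Sum>j<n. G i j * v i * v j)" for v
      unfolding noise[symmetric] noise_def by (intro sum_nonneg) simp
    show "(\<Sum>i<n. \<Sum>j<n. G i j * v i * v j) \<le> L * (\<Sum>i<n. (v i)\<^sup>2)" for v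
      unfolding noise[symmetric] L_def by (rule noise_le[OF assms])
    show "0 < L" using nn by (simp add: L_def)
    show "0 \<le> a" by (simp add: a_def)
    show "2 * a * L < 1" unfolding aL by simp
  qed
  also have "\<dots> \<le> ennreal (exp (4 * \<kappa>\<^sup>2 / 9))"
  proof (rule ennreal_leI)
    have "(\<Sum>i<n. G i i) \<le> (\<Sum>i<n. \<kappa>\<^sup>2)"
      unfolding G_def power2_eq_square[symmetric] by (intro sum_mono sum_e_le)
    also have "\<dots> = real n * \<kappa>\<^sup>2" by simp
    finally have "a * (\<Sum>i<n. G i i) \<le> a * (real n * \<kappa>\<^sup>2)" by (intro mult_left_mono) (simp_all add: a_def)
    also have "\<dots> = 2 * \<kappa>\<^sup>2 / 9" using nn by (simp add: a_def)
    finally show "exp (a * (\<Sum>i<n. G i i) / (1 - 2 * a * L)) \<le> exp (4 * \<kappa>\<^sup>2 / 9)" unfolding aL by simp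
  qed
  finally show ?thesis by (simp add: noise a_def)
qed

text \<open>The condition on \<open>hs\<close> depends on the design alone, so it stays fixed while
  the noise is integrated out. Where it fails, the integrand is 0.\<close>

lemma emeasure_noise_le:
  "emeasure (sample_space n) {\<omega> \<in> space (sample_space n). hs N (\<lambda>i. fst (\<omega> i)) \<le> (real n / 8)\<^sup>2 \<and>
       noise N (\<lambda>i. fst (\<omega> i)) (\<lambda>i. snd (\<omega> i)) > t}
     \<le> ennreal (exp (4 * \<kappa>\<^sup>2 / 9 - 2 * t / (9 * real n)))"
proof -
  define a where "a = 2 / (9 * real n)"
  define F where "F = (\<lambda>\<omega>. noise N (\<lambda>i. fst (\<omega> i)) (\<lambda>i. snd (\<omega> i)))"
  define P where "P = (\<lambda>\<omega> :: nat \<Rightarrow> real \<times> real. hs N (\<lambda>i. fst (\<omega> i)) \<le> (real n / 8)\<^sup>2)"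
  have [measurable]: "F \<in> borel_measurable (sample_space n)" unfolding F_def noise_def by measurable
  have [measurable]: "Measurable.pred (sample_space n) P" unfolding P_def hs_def by measurable
  have fg: "(\<lambda>\<omega>. if P \<omega> then ennreal (exp (a * F \<omega>)) else 0) \<in> borel_measurable (PiM {..<n} (\<lambda>_. unifI \<Otimes>\<^sub>M gauss))"
    unfolding obs_dist_def[symmetric] sample_space_def[symmetric] by measurable
  have PF: "P (\<lambda>i\<in>{..<n}. (x i, v i)) = (hs N x \<le> (real n / 8)\<^sup>2)" "F (\<lambda>i\<in>{..<n}. (x i, v i)) = noise N x v" for x v
    by (simp_all add: P_def F_def hs_def noise_def)
  interpret X: prob_space "PiM {..<n} (\<lambda>_. unifI)" by (intro prob_space_PiM prob_space_unifI)
  have "(\<integral>\<^sup>+\<omega>. (if P \<omega> then ennreal (exp (a * F \<omega>)) else 0) \<partial>sample_space n)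
     = (\<integral>\<^sup>+x. \<integral>\<^sup>+v. (if hs N x \<le> (real n / 8)\<^sup>2 then ennreal (exp (a * noise N x v)) else 0) \<partial>PiM {..<n} (\<lambda>_. gauss) \<partial>PiM {..<n} (\<lambda>_. unifI))"
    unfolding sample_space_def obs_dist_def
    by (subst nn_integral_PiM_pair[OF prob_space_unifI prob_space_gauss fg]) (simp only: PF)
  also have "\<dots> \<le> (\<integral>\<^sup>+x. ennreal (exp (4 * \<kappa>\<^sup>2 / 9)) \<partial>PiM {..<n} (\<lambda>_. unifI))"
  proof (rule nn_integral_mono)
    fix x
    show "(\<integral>\<^sup>+v. (if hs N x \<le> (real n / 8)\<^sup>2 then ennreal (exp (a * noise N x v)) else 0) \<partial>PiM {..<n} (\<lambda>_. gauss)) \<le> ennreal (exp (4 * \<kappa>\<^sup>2 / 9))"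
      using nn_integral_exp_noise_le[of N x] by (cases "hs N x \<le> (real n / 8)\<^sup>2") (auto simp: a_def)
  qed
  also have "\<dots> = ennreal (exp (4 * \<kappa>\<^sup>2 / 9))" by (simp add: X.emeasure_space_1)
  finally have "(\<integral>\<^sup>+\<omega>. (if P \<omega> then ennreal (exp (a * F \<omega>)) else 0) \<partial>sample_space n) \<le> ennreal (exp (4 * \<kappa>\<^sup>2 / 9))" .
  then have "emeasure (sample_space n) {\<omega> \<in> space (sample_space n). P \<omega> \<and> F \<omega> > t} \<le> ennreal (exp (- (a * t)) * exp (4 * \<kappa>\<^sup>2 / 9))"
    by (intro emeasure_exp_Markov) (auto simp: a_def)
  also have "exp (- (a * t)) * exp (4 * \<kappa>\<^sup>2 / 9) = exp (4 * \<kappa>\<^sup>2 / 9 - 2 * t / (9 * real n))"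
    unfolding exp_add[symmetric] by (simp add: a_def)
  finally show ?thesis by (simp add: P_def F_def)
qed

end

section \<open>The error of the smoothing spline\<close>

text \<open>The discriminant criterion, allowing a vanishing leading coefficient. It yields
  Cauchy-Schwarz for semidefinite forms; \<open>Jf\<close> vanishes on polynomials of low
  degree.\<close>

lemma quadratic_nonneg_imp:
  fixes a b c :: real
  assumes "\<And>t. 0 \<le> a + 2 * t * b + t\<^sup>2 * c" "0 \<le> c"
  shows "b\<^sup>2 \<le> a * c"
proof (cases "c = 0")
  case True
  have "b = 0"
  proof (rule ccontr)
    assume "b \<noteq> 0"
    then have "2 * (- (a + 1) / (2 * b)) * b = - (a + 1)" by simp
    with assms(1)[of "- (a + 1) / (2 * b)"] True show False by simp
  qed
  with True show ?thesis by simp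
next
  case False
  with assms have c: "c > 0" by simp
  have "0 \<le> a + 2 * (- b / c) * b + (- b / c)\<^sup>2 * c" by (rule assms)
  also have "\<dots> = (a * c - b\<^sup>2) / c" using c by (simp add: field_simps power2_eq_square)
  finally show ?thesis using c by (simp add: zero_le_divide_iff)
qed

text \<open>The value s = B / (A + 1) already gives B^2 * (A + 1) \<le> B^2 * A. This stands in for
  differentiating the objective at its maximum.\<close>

lemma linear_le_quadratic_imp_zero:
  fixes A B :: real
  assumes "\<And>s. s * B \<le> s\<^sup>2 * A" "0 \<le> A"
  shows "B = 0"
proof -
  define d where "d = A + 1"
  have d: "d > 0" using assms(2) by (simp add: d_def)
  have "B / d * B \<le> (B / d)\<^sup>2 * A" by (rule assms)
  then have "B\<^sup>2 * d \<le> B\<^sup>2 * A" using d by (simp add: field_simps power2_eq_square)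
  then have "B\<^sup>2 \<le> 0" by (simp add: d_def algebra_simps)
  then show ?thesis by simp
qed

lemma Jf_Cauchy_Schwarz:
  assumes f: "f \<in> sobolev m" and g: "g \<in> sobolev m"
  shows "(Jf m f g)\<^sup>2 \<le> Jf m f f * Jf m g g"
proof (rule quadratic_nonneg_imp)
  fix t
  define u where "u = (\<lambda>x. f x + t * g x)"
  have u: "u \<in> sobolev m" unfolding u_def by (rule sobolev_lincomb[OF f g])
  have "Jf m u u = Jf m u f + t * Jf m u g"
    using Jf_lincomb[OF f g u, of t] by (simp add: u_def[symmetric] Jf_commute[of m f u] Jf_commute[of m g u])
  also have "Jf m u f = Jf m f f + t * Jf m f g"
    using Jf_lincomb[OF f g f, of t] by (simp add: u_def[symmetric] Jf_commute[of m g f])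
  also have "Jf m u g = Jf m f g + t * Jf m g g"
    using Jf_lincomb[OF f g g, of t] by (simp add: u_def[symmetric])
  finally show "0 \<le> Jf m f f + 2 * t * Jf m f g + t\<^sup>2 * Jf m g g"
    using Jf_nonneg[of m u] by (simp add: power2_eq_square algebra_simps)
qed (rule Jf_nonneg)

lemma Vf_Cauchy_Schwarz:
  assumes f: "f \<in> sobolev0 m" and g: "g \<in> sobolev0 m" and m: "m \<ge> 1"
  shows "(Vf f g)\<^sup>2 \<le> Vf f f * Vf g g"
proof (rule quadratic_nonneg_imp)
  fix t
  define u where "u = (\<lambda>x. f x + t * g x)"
  have u: "u \<in> sobolev0 m" unfolding u_def by (rule sobolev0_lincomb[OF f g])
  have "Vf u u = Vf u f + t * Vf u g"
    using Vf_lincomb[OF f g u m, of t] by (simp add: u_def[symmetric] Vf_commute[of f u] Vf_commute[of g u])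
  also have "Vf u f = Vf f f + t * Vf f g"
    using Vf_lincomb[OF f g f m, of t] by (simp add: u_def[symmetric] Vf_commute[of g f])
  also have "Vf u g = Vf f g + t * Vf g g"
    using Vf_lincomb[OF f g g m, of t] by (simp add: u_def[symmetric])
  finally show "0 \<le> Vf f f + 2 * t * Vf f g + t\<^sup>2 * Vf g g"
    using Vf_nonneg[of u] by (simp add: power2_eq_square algebra_simps)
qed (rule Vf_nonneg)

context spline_sample
begin

text \<open>Neither \<open>f\<close> nor the estimator occurs here. The set is therefore measurable,
  and its union over N is one exceptional event for all regression functions.\<close>

definition bad :: "real \<Rightarrow> nat \<Rightarrow> (nat \<Rightarrow> real \<times> real) set" where
  "bad t N = {\<omega> \<in> space (sample_space n). hs N (\<lambda>i. fst (\<omega> i)) > (real n / 8)\<^sup>2 \<or>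
       noise N (\<lambda>i. fst (\<omega> i)) (\<lambda>i. snd (\<omega> i)) > t}"

lemma bad_sets [measurable]: "bad t N \<in> sets (sample_space n)"
  unfolding bad_def hs_def noise_def by measurable

lemma incseq_bad: "incseq (bad t)"
proof (rule incseq_SucI)
  fix N
  have "hs N x \<le> hs (Suc N) x" "noise N x v \<le> noise (Suc N) x v" for x v
    unfolding hs_def noise_def by (intro sum_mono2; auto)+
  then show "bad t N \<subseteq> bad t (Suc N)"
    unfolding bad_def by (auto intro: order_less_le_trans)
qed

text \<open>Both tail bounds are free of N and the events increase with N, so continuity from below
  passes the bound to the union without loss.\<close>

lemma measure_Union_bad_le:
  assumes "sqrt 2 * exp (- real n / (1024 * \<kappa> ^ 4)) \<le> p" "exp (4 * \<kappa>\<^sup>2 / 9 - 2 * t / (9 * real n)) \<le> p"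
  shows "measure (sample_space n) (\<Union>N. bad t N) \<le> 2 * p"
proof -
  interpret S: prob_space "sample_space n" by (rule prob_space_sample_space)
  have p0: "p \<ge> 0" using assms(2) by (rule order_trans[rotated]) simp
  have le: "measure (sample_space n) (bad t N) \<le> 2 * p" for N
  proof -
    let ?A = "{\<omega> \<in> space (sample_space n). hs N (\<lambda>i. fst (\<omega> i)) > (real n / 8)\<^sup>2}"
    let ?B = "{\<omega> \<in> space (sample_space n). hs N (\<lambda>i. fst (\<omega> i)) \<le> (real n / 8)\<^sup>2 \<and>
       noise N (\<lambda>i. fst (\<omega> i)) (\<lambda>i. snd (\<omega> i)) > t}"
    have [measurable]: "?A \<in> sets (sample_space n)" "?B \<in> sets (sample_space n)"
      unfolding hs_def noise_def by measurable
    have "bad t N \<subseteq> ?A \<union> ?B" by (auto simp: bad_def)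
    then have "measure (sample_space n) (bad t N) \<le> measure (sample_space n) (?A \<union> ?B)"
      by (intro S.finite_measure_mono) auto
    also have "\<dots> \<le> measure (sample_space n) ?A + measure (sample_space n) ?B"
      by (intro measure_Un_le) auto
    also have "measure (sample_space n) ?A \<le> p"
    proof -
      have "ennreal (measure (sample_space n) ?A) \<le> ennreal p"
        unfolding S.emeasure_eq_measure[symmetric]
        using emeasure_hs_le[of N] ennreal_leI[OF assms(1)] by (rule order_trans)
      then show ?thesis using p0 by simp
    qed
    also have "measure (sample_space n) ?B \<le> p"
    proof -
      have "ennreal (measure (sample_space n) ?B) \<le> ennreal p"
        unfolding S.emeasure_eq_measure[symmetric]
        using emeasure_noise_le[of N t] ennreal_leI[OF assms(2)] by (rule order_trans)
      then show ?thesis using p0 by simp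
    qed
    finally show ?thesis by simp
  qed
  have "(\<lambda>N. measure (sample_space n) (bad t N)) \<longlonglongrightarrow> measure (sample_space n) (\<Union>N. bad t N)"
    by (rule S.finite_Lim_measure_incseq) (auto simp: incseq_bad)
  then show ?thesis by (rule LIMSEQ_le_const2) (use le in auto)
qed

lemma proj_tendsto:
  assumes g: "g \<in> W" and x: "x \<in> {0..1}"
  shows "(\<lambda>N. proj N g x) \<longlonglongrightarrow> g x"
proof -
  let ?r = "\<lambda>N. ip (\<lambda>x. g x - proj N g x) (\<lambda>x. g x - proj N g x)"
  have "(\<lambda>N. sqrt (K x x) * sqrt (?r N)) \<longlonglongrightarrow> sqrt (K x x) * sqrt 0"
    by (intro tendsto_intros ip_diff_proj_tendsto[OF g])
  then have lim: "(\<lambda>N. sqrt (K x x) * sqrt (?r N)) \<longlonglongrightarrow> 0" by simp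
  have "(\<lambda>N. g x - proj N g x) \<longlonglongrightarrow> 0"
  proof (rule Lim_null_comparison[OF _ lim], rule always_eventually, rule allI)
    fix N
    have "(\<lambda>x. g x - proj N g x) \<in> W" unfolding proj_def by (intro diff_mem g comb_mem)
    from point_evaluation_le[OF x this] show "norm (g x - proj N g x) \<le> sqrt (K x x) * sqrt (?r N)" by simp
  qed
  from tendsto_diff[OF tendsto_const[of "g x"] this] show ?thesis by simp
qed

text \<open>The sum is the inner product of g with the sum of the kernels weighted by v. For
  projections of g the bound is Cauchy-Schwarz in coordinates with Bessel; the limit involves only
  point evaluations.\<close>

lemma noise_inner_le:
  assumes noise: "\<And>N. noise N x v \<le> t" and x: "\<And>i. i < n \<Longrightarrow> x i \<in> {0..1}" and g: "g \<in> W"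
  shows "(\<Sum>i<n. v i * g (x i)) \<le> sqrt t * sqrt (ip g g)"
proof (rule LIMSEQ_le_const2)
  show "(\<lambda>N. \<Sum>i<n. v i * proj N g (x i)) \<longlonglongrightarrow> (\<Sum>i<n. v i * g (x i))"
    by (intro tendsto_intros proj_tendsto g x) auto
  show "\<exists>N. \<forall>n'\<ge>N. (\<Sum>i<n. v i * proj n' g (x i)) \<le> sqrt t * sqrt (ip g g)"
  proof (intro exI allI impI)
    fix N
    have t0: "0 \<le> t" using noise[of 0] by (simp add: noise_def)
    have eq: "(\<Sum>i<n. v i * proj N g (x i)) = (\<Sum>k<N. ip g (e k) * (\<Sum>i<n. v i * e k (x i)))"
      unfolding proj_def comb_def sum_distrib_left by (subst sum.swap) (simp add: mult_ac)
    have "(\<Sum>i<n. v i * proj N g (x i))\<^sup>2 \<le> (\<Sum>k<N. (ip g (e k))\<^sup>2) * noise N x v"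
      unfolding noise_def eq by (rule Cauchy_Schwarz_ineq_sum)
    also have "\<dots> \<le> ip g g * t"
      by (rule mult_mono[OF Bessel[OF g] noise[of N] ip_pos]) (simp add: noise_def sum_nonneg)
    also have "\<dots> = (sqrt t * sqrt (ip g g))\<^sup>2" using t0 ip_pos by (simp add: power_mult_distrib)
    finally have "\<bar>\<Sum>i<n. v i * proj N g (x i)\<bar> \<le> \<bar>sqrt t * sqrt (ip g g)\<bar>" by (simp only: abs_le_square_iff)
    moreover have "0 \<le> sqrt t * sqrt (ip g g)" using t0 ip_pos by simp
    ultimately show "(\<Sum>i<n. v i * proj N g (x i)) \<le> sqrt t * sqrt (ip g g)" by linarith
  qed
qed

text \<open>The deviation bound holds for each projection, with Bessel estimating its coefficients
  by the norm of g. In the limit the point values converge, and \<open>Vf\<close> of the projection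
  falls below that of g by at most twice the norm of g times the norm of the remainder.\<close>

lemma empirical_norm_ge:
  assumes hs: "\<And>N. hs N x \<le> (real n / 8)\<^sup>2" and x: "\<And>i. i < n \<Longrightarrow> x i \<in> {0..1}" and g: "g \<in> W"
  shows "real n * Vf g g - real n / 8 * ip g g \<le> (\<Sum>i<n. (g (x i))\<^sup>2)"
proof (rule LIMSEQ_le)
  let ?d = "\<lambda>N x. g x - proj N g x"
  let ?r = "\<lambda>N. ip (?d N) (?d N)"
  have d: "?d N \<in> W" for N unfolding proj_def by (intro diff_mem g comb_mem)
  have pW: "proj N g \<in> W" for N by (simp add: proj_def comb_mem)
  show "(\<lambda>N. \<Sum>i<n. (proj N g (x i))\<^sup>2) \<longlonglongrightarrow> (\<Sum>i<n. (g (x i))\<^sup>2)"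
    by (intro tendsto_intros proj_tendsto g x) auto
  have "(\<lambda>N. real n * (Vf g g - 2 * (sqrt (ip g g) * sqrt (?r N))) - real n / 8 * ip g g)
      \<longlonglongrightarrow> real n * (Vf g g - 2 * (sqrt (ip g g) * sqrt 0)) - real n / 8 * ip g g"
    by (intro tendsto_intros ip_diff_proj_tendsto[OF g])
  then show "(\<lambda>N. real n * (Vf g g - 2 * (sqrt (ip g g) * sqrt (?r N))) - real n / 8 * ip g g)
      \<longlonglongrightarrow> real n * Vf g g - real n / 8 * ip g g" by simp
  show "\<exists>N0. \<forall>N\<ge>N0. real n * (Vf g g - 2 * (sqrt (ip g g) * sqrt (?r N))) - real n / 8 * ip g g \<le> (\<Sum>i<n. (proj N g (x i))\<^sup>2)"
  proof (intro exI allI impI)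
    fix N
    have "(Vf g (?d N))\<^sup>2 \<le> Vf g g * Vf (?d N) (?d N)" by (rule Vf_Cauchy_Schwarz[OF g d m])
    also have "\<dots> \<le> ip g g * ?r N" by (intro mult_mono Vf_le_ip ip_pos Vf_nonneg)
    finally have "\<bar>Vf g (?d N)\<bar> \<le> sqrt (ip g g * ?r N)" by (metis real_sqrt_abs real_sqrt_le_mono)
    then have cs: "Vf g (?d N) \<le> sqrt (ip g g) * sqrt (?r N)" by (simp add: real_sqrt_mult)
    have "proj N g = (\<lambda>x. g x + (- 1) * ?d N x)" by (simp add: fun_eq_iff)
    then have VV: "Vf (proj N g) k = Vf g k - Vf (?d N) k" if "k \<in> W" for k
      using Vf_lincomb[OF g d that m, of "- 1" N] by simp
    have "Vf (proj N g) (proj N g) = Vf g (proj N g) - Vf (?d N) (proj N g)" by (rule VV[OF pW])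
    also have "\<dots> = Vf g g - 2 * Vf g (?d N) + Vf (?d N) (?d N)"
      using VV[OF g] VV[OF d, of N] Vf_commute[of g "proj N g"] Vf_commute[of "?d N" "proj N g"] Vf_commute[of "?d N" g] by simp
    finally have "Vf g g - 2 * (sqrt (ip g g) * sqrt (?r N)) \<le> Vf (proj N g) (proj N g)"
      using cs Vf_nonneg[of "?d N"] by linarith
    then have 1: "real n * (Vf g g - 2 * (sqrt (ip g g) * sqrt (?r N))) \<le> real n * Vf (proj N g) (proj N g)"
      by (intro mult_left_mono) auto
    have "real n / 8 * (\<Sum>k<N. (ip g (e k))\<^sup>2) \<le> real n / 8 * ip g g"
      by (intro mult_left_mono Bessel[OF g]) auto
    with 1 abs_le_D2[OF empirical_quadratic_form_le[OF hs, of N "\<lambda>k. ip g (e k)"]]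
    show "real n * (Vf g g - 2 * (sqrt (ip g g) * sqrt (?r N))) - real n / 8 * ip g g \<le> (\<Sum>i<n. (proj N g (x i))\<^sup>2)"
      unfolding proj_def[symmetric] by linarith
  qed
qed

text \<open>Along F + s * g the objective is a quadratic polynomial in s with its maximum at 0.
  Multiplied by n, the comparison with s = 0 reads s * B \<le> s^2 * A, where B is the difference of
  the two sides.\<close>

lemma spline_first_order:
  assumes F: "F \<in> sobolev m" and g: "g \<in> sobolev m"
    and opt: "\<And>u. u \<in> sobolev m \<Longrightarrow> pls_objective m n lam d u \<le> pls_objective m n lam d F"
  shows "(\<Sum>i<n. (fst (d i) - F (snd (d i))) * g (snd (d i))) = real n * lam * Jf m F g"
proof -
  define R where "R = (\<lambda>i. fst (d i) - F (snd (d i)))"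
  define G where "G = (\<lambda>i. g (snd (d i)))"
  define B where "B = (\<Sum>i<n. R i * G i) - real n * lam * Jf m F g"
  define A where "A = ((\<Sum>i<n. (G i)\<^sup>2) + real n * lam * Jf m g g) / 2"
  have nn: "real n > 0" using n_pos by simp
  have "s * B \<le> s\<^sup>2 * A" for s
  proof -
    define u where "u = (\<lambda>x. F x + s * g x)"
    have u: "u \<in> sobolev m" unfolding u_def by (rule sobolev_lincomb[OF F g])
    have "Jf m u u = Jf m u F + s * Jf m u g"
      using Jf_lincomb[OF F g u, of s] by (simp add: u_def[symmetric] Jf_commute[of m F u] Jf_commute[of m g u])
    also have "Jf m u F = Jf m F F + s * Jf m F g"
      using Jf_lincomb[OF F g F, of s] by (simp add: u_def[symmetric] Jf_commute[of m g F])
    also have "Jf m u g = Jf m F g + s * Jf m g g"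
      using Jf_lincomb[OF F g g, of s] by (simp add: u_def[symmetric])
    finally have Ju: "Jf m u u = Jf m F F + 2 * s * Jf m F g + s\<^sup>2 * Jf m g g"
      by (simp add: power2_eq_square algebra_simps)
    have Su: "(\<Sum>i<n. (fst (d i) - u (snd (d i)))\<^sup>2) = (\<Sum>i<n. (R i)\<^sup>2) - 2 * s * (\<Sum>i<n. R i * G i) + s\<^sup>2 * (\<Sum>i<n. (G i)\<^sup>2)"
      unfolding sum_distrib_left sum_subtractf[symmetric] sum.distrib[symmetric]
      by (intro sum.cong refl) (simp add: u_def R_def G_def power2_eq_square algebra_simps)
    have "- 1 / (2 * real n) * (\<Sum>i<n. (fst (d i) - u (snd (d i)))\<^sup>2) - lam / 2 * Jf m u u
        \<le> - 1 / (2 * real n) * (\<Sum>i<n. (R i)\<^sup>2) - lam / 2 * Jf m F F"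
      using opt[OF u] unfolding pls_objective_def R_def .
    then have le: "real n * (- 1 / (2 * real n) * (\<Sum>i<n. (fst (d i) - u (snd (d i)))\<^sup>2) - lam / 2 * Jf m u u)
        \<le> real n * (- 1 / (2 * real n) * (\<Sum>i<n. (R i)\<^sup>2) - lam / 2 * Jf m F F)"
      using nn by (intro mult_left_mono) auto
    have eq: "real n * (- 1 / (2 * real n) * p - lam / 2 * q) = - p / 2 - real n * lam * q / 2" for p q
      using nn by (simp add: field_simps)
    show ?thesis using le unfolding eq Su Ju A_def B_def by (simp add: field_simps)
  qed
  moreover have "0 \<le> A" unfolding A_def using lam Jf_nonneg[of m g] by (simp add: sum_nonneg)
  ultimately have "B = 0" by (rule linear_le_quadratic_imp_zero)
  then show ?thesis by (simp add: B_def R_def G_def)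
qed

text \<open>The first-order condition is tested with the error itself. Replacing the empirical
  second moment by V costs an eighth of the squared norm and leaves the factor 7/8; noise and bias
  are linear in the norm E, and one factor E is divided out.\<close>

lemma spline_error_le:
  assumes f: "f \<in> sobolev m" and J1: "Jf m f f \<le> 1" and fhat: "is_smoothing_spline m n lam fhat"
    and x: "\<And>i. i < n \<Longrightarrow> fst (\<omega> i) \<in> {0..1}"
    and hs: "\<And>N. hs N (\<lambda>i. fst (\<omega> i)) \<le> (real n / 8)\<^sup>2"
    and noise: "\<And>N. noise N (\<lambda>i. fst (\<omega> i)) (\<lambda>i. snd (\<omega> i)) \<le> t"
  shows "7 / 8 * snorm m lam (\<lambda>x. fhat (data_of f \<omega>) x - f x) \<le> sqrt t / real n + sqrt lam"
proof -
  define F where "F = fhat (data_of f \<omega>)"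
  define g0 where "g0 = (\<lambda>x. F x - f x)"
  define g where "g = cut01 g0"
  have dx: "snd (data_of f \<omega> i) \<in> {0..1}" if "i < n" for i using x[OF that] by (simp add: data_of_def)
  have F: "F \<in> sobolev m" and opt: "\<And>u. u \<in> sobolev m \<Longrightarrow> pls_objective m n lam (data_of f \<omega>) u \<le> pls_objective m n lam (data_of f \<omega>) F"
    using fhat dx unfolding is_smoothing_spline_def F_def by blast+
  have g0: "g0 \<in> sobolev m" using sobolev_lincomb[OF F f, of "- 1"] by (simp add: g0_def)
  have g: "g \<in> W" unfolding g_def by (rule cut01_in_sobolev0[OF g0])
  note gs = sobolev0D(1)[OF g]
  have gx: "g y = F y - f y" if "y \<in> {0..1}" for y using that by (simp add: g_def g0_def)
  have nn: "real n > 0" using n_pos by simp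
  define E where "E = sqrt (ip g g)"
  have E0: "E \<ge> 0" and E2: "E\<^sup>2 = ip g g" using ip_pos by (simp_all add: E_def)
  have fo: "(\<Sum>i<n. (fst (data_of f \<omega> i) - F (snd (data_of f \<omega> i))) * g (snd (data_of f \<omega> i))) = real n * lam * Jf m F g"
    by (rule spline_first_order[OF F gs opt])
  have "(\<Sum>i<n. (fst (data_of f \<omega> i) - F (snd (data_of f \<omega> i))) * g (snd (data_of f \<omega> i)))
     = (\<Sum>i<n. (snd (\<omega> i) - g (fst (\<omega> i))) * g (fst (\<omega> i)))"
    by (intro sum.cong refl) (simp add: data_of_def gx[OF x])
  also have "\<dots> = (\<Sum>i<n. snd (\<omega> i) * g (fst (\<omega> i))) - (\<Sum>i<n. (g (fst (\<omega> i)))\<^sup>2)"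
    by (simp add: sum_subtractf left_diff_distrib power2_eq_square)
  finally have 1: "(\<Sum>i<n. snd (\<omega> i) * g (fst (\<omega> i))) - (\<Sum>i<n. (g (fst (\<omega> i)))\<^sup>2) = real n * lam * Jf m F g"
    using fo by simp
  have "Jf m F g = Jf m (\<lambda>x. f x + 1 * g x) g"
    by (rule Jf_cong[OF sobolev_lincomb[OF f gs] gs]) (simp_all add: gx)
  also have "\<dots> = Jf m f g + Jf m g g" using Jf_lincomb[OF f gs gs, of 1] by simp
  finally have 2: "Jf m F g = Jf m f g + Jf m g g" .
  have 3: "- (lam * Jf m f g) \<le> sqrt lam * E"
  proof -
    have "(Jf m f g)\<^sup>2 \<le> Jf m f f * Jf m g g" by (rule Jf_Cauchy_Schwarz[OF f gs])
    also have "\<dots> \<le> 1 * Jf m g g" by (intro mult_right_mono J1 Jf_nonneg)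
    finally have "(lam * Jf m f g)\<^sup>2 \<le> lam\<^sup>2 * Jf m g g" using lam by (simp add: power_mult_distrib)
    also have "\<dots> = lam * (lam * Jf m g g)" by (simp add: power2_eq_square)
    also have "\<dots> \<le> lam * ip g g" using lam by (intro mult_left_mono Jf_le_ip) auto
    also have "\<dots> = (sqrt lam * E)\<^sup>2" using lam by (simp add: power_mult_distrib E2)
    finally have "\<bar>lam * Jf m f g\<bar> \<le> \<bar>sqrt lam * E\<bar>" by (simp only: abs_le_square_iff)
    moreover have "0 \<le> sqrt lam * E" using lam E0 by simp
    ultimately show ?thesis by linarith
  qed
  have 4: "(\<Sum>i<n. snd (\<omega> i) * g (fst (\<omega> i))) \<le> sqrt t * E"
    unfolding E_def by (rule noise_inner_le[OF noise x g])
  have 5: "real n * Vf g g - real n / 8 * ip g g \<le> (\<Sum>i<n. (g (fst (\<omega> i)))\<^sup>2)"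
    by (rule empirical_norm_ge[OF hs x g])
  have "real n * (- (lam * Jf m f g)) \<le> real n * (sqrt lam * E)" using 3 nn by (intro mult_left_mono) auto
  moreover have "real n * ip g g = real n * Vf g g + real n * lam * Jf m g g" by (simp add: sinner_def algebra_simps)
  moreover have "real n * lam * Jf m F g = real n * (lam * Jf m f g) + real n * lam * Jf m g g"
    unfolding 2 by (simp add: algebra_simps)
  ultimately have "7 / 8 * real n * ip g g \<le> sqrt t * E + real n * (sqrt lam * E)"
    using 1 4 5 by linarith
  then have "(7 / 8 * E * real n) * E \<le> (sqrt t + real n * sqrt lam) * E"
    unfolding E2[symmetric] by (simp add: power2_eq_square algebra_simps)
  then have "7 / 8 * E * real n \<le> sqrt t + real n * sqrt lam"
  proof (cases "E = 0")
    case True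
    have "0 \<le> t" using noise[of 0] by (simp add: noise_def)
    with True show ?thesis using lam by simp
  next
    case False
    with E0 have "E > 0" by simp
    with \<open>(7 / 8 * E * real n) * E \<le> (sqrt t + real n * sqrt lam) * E\<close> show ?thesis
      by (simp only: mult_le_cancel_right_pos)
  qed
  then have 6: "7 / 8 * E \<le> sqrt t / real n + sqrt lam" using nn by (simp add: field_simps)
  \<comment> \<open>The claim is about the uncut error, whose \<open>Vf\<close> may be a default
    value but never exceeds that of the cut-off.\<close>
  have "Jf m g0 g0 = Jf m g g" by (rule Jf_cong[OF gs gs]) (simp_all add: g_def)
  then have "ip g0 g0 \<le> ip g g" using Vf_le_cut01[OF g0 m] by (simp add: sinner_def g_def)
  then have "snorm m lam g0 \<le> E" by (simp add: snorm_def E_def)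
  then show ?thesis using 6 by (simp add: g0_def F_def)
qed

end

section \<open>Lower bounds for the kernel on the diagonal\<close>

lemma integral_unifI:
  fixes f :: "real \<Rightarrow> real"
  assumes [measurable]: "f \<in> borel_measurable borel"
  shows "(\<integral>x. f x \<partial>unifI) = (\<integral>x. indicator {0..1} x * f x \<partial>lborel)"
proof -
  have eq: "unifI = density lborel (\<lambda>x. ennreal (indicator {0..1} x))"
    unfolding unifI_def uniform_measure_def by (simp add: ennreal_indicator divide_ennreal_def)
  show ?thesis unfolding eq by (subst integral_density) auto
qed

context spline_kernel
begin

text \<open>The constant 1 has norm at most 1 and value 1 at the point 0. This is the source of
  \<kappa> \<ge> 1.\<close>

lemma K_diag_0_ge: "1 \<le> K 0 0"
proof -
  have x: "(0::real) \<in> {0..1}" by simp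
  have "Vf (monomial01 0) (monomial01 0) \<le> 1\<^sup>2"
    by (rule Vf_le_square[OF monomial01_mem m]) (simp add: monomial01_def)
  moreover have "Jf m (monomial01 0) (monomial01 0) = 0"
    unfolding monomial01_def power_eq_poly_monom
    using m sobolev0D(1)[OF cut01_in_sobolev0[OF poly_in_sobolev]] by (intro Jf_cut01_poly_eq_0) (auto simp: degree_monom_eq)
  ultimately have "ip (monomial01 0) (monomial01 0) \<le> 1" by (simp add: sinner_def)
  then have "sqrt (K 0 0) * sqrt (ip (monomial01 0) (monomial01 0)) \<le> sqrt (K 0 0) * 1"
    using K_diag_nonneg[OF x] by (intro mult_left_mono) auto
  moreover have "\<bar>monomial01 0 0\<bar> \<le> sqrt (K 0 0) * sqrt (ip (monomial01 0) (monomial01 0))"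
    by (rule point_evaluation_le[OF x monomial01_mem])
  moreover have "monomial01 0 0 = 1" by (simp add: monomial01_def cut01_def)
  ultimately have "1 \<le> sqrt (K 0 0)" by linarith
  then show ?thesis by simp
qed

text \<open>Point evaluation of x^2 at 1. Its m-th derivative is 2 * x, 2 or 0, so the energy is at
  most 4 for every m. The square is suitable because V = 1/5 lies below 1/4: with K 1 1 \<le> 4 a
  positive lower bound for \<open>lam\<close> results. For x itself V would be 1/3.\<close>

lemma K_diag_1_ge: "1 \<le> K 1 1 * (1 / 5 + 4 * lam)"
proof -
  have x: "(1::real) \<in> {0..1}" by simp
  define f where "f = monomial01 2"
  have f: "f \<in> W" by (simp add: f_def monomial01_mem)
  have [measurable]: "f \<in> borel_measurable borel" by (rule sobolev0_measurable[OF f m])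
  have "Vf f f = (\<integral>x. indicator {0..1} x * (f x * f x) \<partial>lborel)"
    unfolding Vf_def by (rule integral_unifI) measurable
  also have "\<dots> = (\<integral>x. x ^ 4 * indicator {0..1} x \<partial>lborel)"
    by (intro Bochner_Integration.integral_cong refl)
       (simp add: f_def monomial01_def cut01_def indicator_def power2_eq_square power4_eq_xxxx)
  also have "\<dots> = 1 / 5" by (subst integral_power) auto
  finally have V: "Vf f f = 1 / 5" .
  let ?p = "monom (1::real) 2"
  have bd: "\<bar>poly ((pderiv ^^ m) ?p) x\<bar> \<le> 2" if "x \<in> {0..1}" for x
  proof -
    consider "m = 1" | "m = 2" | "m > 2" using m by linarith
    then show ?thesis
    proof cases
      case 1
      then show ?thesis using that by (simp add: pderiv_monom poly_monom)
    next
      case 2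
      then show ?thesis by (simp add: pderiv_monom poly_monom numeral_2_eq_2)
    next
      case 3
      then have "(pderiv ^^ m) ?p = 0" by (intro higher_pderiv_eq_0) (simp add: degree_monom_eq)
      then show ?thesis by simp
    qed
  qed
  have wit: "sobolev_witness m f (\<lambda>j. poly ((pderiv ^^ j) ?p))"
    by (rule sobolev_witness_cong[OF poly_sobolev_witness]) (simp add: f_def monomial01_def poly_monom)
  have "Jf m f f = (LINT x:{0..1}|lborel. poly ((pderiv ^^ m) ?p) x * poly ((pderiv ^^ m) ?p) x)"
    by (rule Jf_eq_integral[OF wit wit])
  also have "\<dots> \<le> (LINT x:{0..1::real}|lborel. 4)"
  proof (rule set_integral_mono)
    show "set_integrable lborel {0..1} (\<lambda>x. poly ((pderiv ^^ m) ?p) x * poly ((pderiv ^^ m) ?p) x)"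
      by (intro borel_integrable_atLeastAtMost' continuous_intros)
    show "set_integrable lborel {0..1::real} (\<lambda>x. 4 :: real)"
      by (intro borel_integrable_atLeastAtMost' continuous_intros)
    fix x :: real assume "x \<in> {0..1}"
    from power_mono[OF bd[OF this], of 2] show "poly ((pderiv ^^ m) ?p) x * poly ((pderiv ^^ m) ?p) x \<le> 4"
      by (simp add: power2_eq_square)
  qed
  also have "\<dots> = 4" by (simp add: set_lebesgue_integral_def)
  finally have "lam * Jf m f f \<le> lam * 4" using lam by simp
  then have I: "ip f f \<le> 1 / 5 + 4 * lam" by (simp add: sinner_def V)
  have "\<bar>f 1\<bar> \<le> sqrt (K 1 1) * sqrt (ip f f)" by (rule point_evaluation_le[OF x f])
  moreover have "f 1 = 1" by (simp add: f_def monomial01_def cut01_def)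
  ultimately have "1 \<le> sqrt (K 1 1 * ip f f)" by (simp add: real_sqrt_mult)
  then have "1 \<le> K 1 1 * ip f f" by simp
  also have "\<dots> \<le> K 1 1 * (1 / 5 + 4 * lam)" using I K_diag_nonneg[OF x] by (intro mult_left_mono) auto
  finally show ?thesis .
qed

end

section \<open>Numerical constants and the final bound\<close>

lemma outer_prob_le:
  assumes "A \<subseteq> B" "B \<in> sets M"
  shows "outer_prob M A \<le> measure M B"
  unfolding outer_prob_def by (rule cINF_lower) (use assms in \<open>auto intro!: bdd_belowI2[of _ 0]\<close>)

text \<open>Since \<tau>^2 = ln 1.5 \<le> ln 2, the last square root is at least \<tau>, so at eps =
  2 the second summand is at least 40 * sqrt 6 \<ge> 96. The first summand is nonnegative, even
  where the integral in \<open>Psi\<close> is the default value 0.\<close>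

lemma Afun_ge:
  assumes "c > 0" "c0 > 0"
  shows "96 \<le> Afun m c c0 h 2"
proof -
  have Psi: "0 \<le> Psi m r" for r
  proof (cases "(\<lambda>x. sqrt (ln (1 + exp (x powr (- 1 / real m))))) integrable_on {0..r}")
    case True
    then show ?thesis unfolding Psi_def by (rule integral_nonneg) (simp add: add_increasing)
  qed (simp add: Psi_def not_integrable_integral)
  define Z where "Z = 2 * c0 * (c * h powr ((2 * real m - 1) / 2) * 2) powr (- 1 / real m)"
  have Z: "0 \<le> Z" using assms by (simp add: Z_def)
  have ln15: "0 < ln (1.5::real)" by simp
  have "ln 1.5 \<le> ln (1 + exp Z)"
    using Z one_le_exp_iff[of Z] by (subst ln_le_cancel_iff) (auto intro: add_pos_pos simp del: one_le_exp_iff)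
  then have ratio: "1 \<le> sqrt (ln (1 + exp Z)) / sqrt (ln 1.5)" using ln15 by simp
  have "(2.4::real) \<le> sqrt 6" by (rule real_le_rsqrt) (simp add: power2_eq_square)
  then have "96 \<le> 20 * sqrt 6 * 2 * 1" by simp
  also have "\<dots> \<le> 20 * sqrt 6 * 2 * (sqrt (ln (1 + exp Z)) / sqrt (ln 1.5))"
    by (intro mult_left_mono ratio) auto
  also have "\<dots> = 20 * sqrt 6 * 2 / sqrt (ln 1.5) * sqrt (ln (1 + exp Z))" by simp
  finally have 2: "96 \<le> 20 * sqrt 6 * 2 / sqrt (ln 1.5) * sqrt (ln (1 + exp Z))" .
  have "0 \<le> 32 * sqrt 6 / sqrt (ln 1.5) * (1 / c) * c0 ^ m * h powr (- (2 * real m - 1) / 2)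
       * Psi m (1 / 2 * c * c0 powr (- real m) * h powr ((2 * real m - 1) / 2) * 2)"
    using assms Psi ln15 by (intro mult_nonneg_nonneg divide_nonneg_nonneg) auto
  with 2 show ?thesis unfolding Afun_def Z_def by linarith
qed

text \<open>As 36864 = 36 * 1024, the exponent n / (1024 * k) is at least 36 * X, while the factor
  sqrt 2 = exp (ln 2 / 2) costs at most X / 2.\<close>

lemma sqrt2_exp_tail_le:
  fixes X k :: real
  assumes X: "0 \<le> X" "ln 2 \<le> X" and n: "36864 * k * X \<le> real n" and k: "k > 0"
  shows "sqrt 2 * exp (- real n / (1024 * k)) \<le> exp (- X)"
proof -
  have "ln (sqrt 2) = ln (2::real) / 2" by (rule ln_sqrt) simp
  then have "sqrt 2 = exp (ln (2::real) / 2)" by (metis exp_ln real_sqrt_gt_zero zero_less_numeral)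
  then have "sqrt 2 * exp (- real n / (1024 * k)) = exp (ln 2 / 2 + - real n / (1024 * k))"
    unfolding exp_add by (simp only:)
  moreover have "36 * X \<le> real n / (1024 * k)" using n k by (simp add: field_simps)
  ultimately show ?thesis using X by simp
qed

text \<open>The threshold makes sqrt t / n equal to 7/8 of the noise part of the radius. With s =
  sqrt (2 * X) the exponent becomes - \<kappa>^2 * B, and for \<kappa>^2 \<ge> 4 the coefficient of
  s^2 in 4 * B is 49/72, above the 1/2 that X = s^2 / 2 requires.\<close>

lemma noise_tail_large_kernel:
  fixes X \<kappa> :: real
  assumes X: "ln 2 \<le> X" and k: "4 \<le> \<kappa>\<^sup>2" and n: "n \<ge> 1"
  shows "4 * \<kappa>\<^sup>2 / 9 - 2 * (real n * (7 / 8 * \<kappa> * (1 + sqrt (2 * X)))\<^sup>2) / (9 * real n) \<le> - X"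
proof -
  define s where "s = sqrt (2 * X)"
  have "(2 / 3 :: real) \<le> ln 2" by (rule ln2_ge_two_thirds)
  then have X1: "1 \<le> 2 * X" using X by linarith
  then have s: "1 \<le> s" "s\<^sup>2 = 2 * X" by (auto simp: s_def)
  define B where "B = 49 / 288 * (1 + s)\<^sup>2 - 4 / 9"
  have "2\<^sup>2 \<le> (1 + s)\<^sup>2" using s by (intro power_mono) auto
  then have "0 \<le> B" by (simp add: B_def)
  then have "4 * B \<le> \<kappa>\<^sup>2 * B" using k by (intro mult_right_mono) auto
  moreover have "s\<^sup>2 / 2 \<le> 4 * B"
  proof -
    have "4 * B - s\<^sup>2 / 2 = (13 * s\<^sup>2 + 98 * s - 79) / 72" by (simp add: B_def power2_eq_square field_simps)
    also have "\<dots> \<ge> 0"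
    proof (rule divide_nonneg_pos)
      have "0 \<le> 13 * s\<^sup>2" by simp
      moreover have "98 * 1 \<le> 98 * s" using s(1) by simp
      ultimately show "0 \<le> 13 * s\<^sup>2 + 98 * s - 79" by linarith
    qed simp
    finally show ?thesis by (simp only: diff_ge_0_iff_ge)
  qed
  ultimately have "X \<le> \<kappa>\<^sup>2 * B" using s(2) by linarith
  moreover have "4 * \<kappa>\<^sup>2 / 9 - 2 * (real n * (7 / 8 * \<kappa> * (1 + s))\<^sup>2) / (9 * real n) = - (\<kappa>\<^sup>2 * B)"
    using n by (simp add: B_def power2_eq_square field_simps)
  ultimately show ?thesis by (simp add: s_def)
qed

text \<open>A threshold of order n^2 gives the exponent n / 648. The lower bound on n makes this
  exceed X + 4 * \<kappa>^2 / 9, because \<kappa> \<ge> 1 and X \<ge> 1/2.\<close>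

lemma noise_tail_small_kernel:
  fixes X \<kappa> :: real
  assumes X: "ln 2 \<le> X" and k: "1 \<le> \<kappa>" and n: "36864 * \<kappa> ^ 4 * X \<le> real n" "n \<ge> 1"
  shows "4 * \<kappa>\<^sup>2 / 9 - 2 * ((real n / 12)\<^sup>2) / (9 * real n) \<le> - X"
proof -
  have "(2 / 3 :: real) \<le> ln 2" by (rule ln2_ge_two_thirds)
  then have X1: "1 / 2 \<le> X" using X by linarith
  have k2: "1 \<le> \<kappa>\<^sup>2" using k by simp
  have k4: "\<kappa> ^ 4 = \<kappa>\<^sup>2 * \<kappa>\<^sup>2" by (simp add: power2_eq_square power4_eq_xxxx)
  have k24: "\<kappa>\<^sup>2 \<le> \<kappa> ^ 4" unfolding k4 using mult_left_mono[OF k2, of "\<kappa>\<^sup>2"] by simp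
  have "1 * X \<le> \<kappa> ^ 4 * X" using k2 k24 X1 by (intro mult_right_mono) auto
  moreover have "\<kappa>\<^sup>2 * (1 / 2) \<le> \<kappa> ^ 4 * X" using k24 X1 k2 by (intro mult_mono) auto
  moreover have "2 * ((real n / 12)\<^sup>2) / (9 * real n) = real n / 648"
    using n(2) by (simp add: power2_eq_square field_simps)
  ultimately show ?thesis using n(1) by (simp add: algebra_simps)
qed

theorem theorem3p1:
  fixes m n :: nat and h r M c0 :: real
    and K :: "real \<Rightarrow> real \<Rightarrow> real"
    and fhat :: "(nat \<Rightarrow> real \<times> real) \<Rightarrow> real \<Rightarrow> real"
  assumes "m \<ge> 1" and "n \<ge> 1"
    and "assumption_A1 m (h ^ (2 * m))"
    and "h > 0" and "r > 0" and "M > 0"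
    and "is_rep_kernel m (h ^ (2 * m)) K"
    and "entropy_const m h (cK h K) c0"
    and "(cK h K)\<^sup>2 * sqrt M * r * h powr (- 1 / 2) * Afun m (cK h K) c0 h 2 \<le> 1 / 2"
    and "is_smoothing_spline m n (h ^ (2 * m)) fhat"
  shows "\<forall>f\<in>Hm1 m.
           outer_prob (sample_space n)
             {\<omega> \<in> space (sample_space n).
                snorm m (h ^ (2 * m)) (\<lambda>x. fhat (data_of f \<omega>) x - f x)
                  \<ge> 2 * h ^ m + cK h K * (sqrt (2 * M) * r + (real n * h) powr (- 1 / 2))}
           \<le> 2 * exp (- M * real n * h * r\<^sup>2)"
proof
  fix f assume f: "f \<in> Hm1 m"
  define lam where "lam = h ^ (2 * m)"
  define \<kappa> where "\<kappa> = cK h K / sqrt h"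
  \<comment> \<open>Chosen so that \<kappa>^2 * u is the factor of A(h) in the hypothesis and n *
    u^2 the exponent of the claim.\<close>
  define u where "u = sqrt M * sqrt h * r"
  define X where "X = real n * u\<^sup>2"
  define \<delta> where "\<delta> = 2 * h ^ m + cK h K * (sqrt (2 * M) * r + (real n * h) powr (- 1 / 2))"
  let ?S = "sample_space n"
  let ?E = "{\<omega> \<in> space ?S. snorm m lam (\<lambda>x. fhat (data_of f \<omega>) x - f x) \<ge> \<delta>}"
  note h = \<open>h > 0\<close>
  interpret S: prob_space ?S by (rule prob_space_sample_space)
  have lam: "lam > 0" using h by (simp add: lam_def)
  have lam_eq: "lam = (h ^ m)\<^sup>2" by (simp add: lam_def power_mult[symmetric] mult.commute)
  have sqrt_lam: "sqrt lam = h ^ m" unfolding lam_eq using h by simp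
  have Xeq: "M * real n * h * r\<^sup>2 = X" using h \<open>M > 0\<close> by (simp add: X_def u_def power_mult_distrib)
  interpret spline_kernel m lam K
    using assms lam by unfold_locales (simp_all add: lam_def)
  obtain b where b: "\<And>k. b k \<in> W" "\<And>k. k < m \<Longrightarrow> b k = monomial01 k"
    "\<And>g \<delta>. g \<in> W \<Longrightarrow> \<delta> > 0 \<Longrightarrow> \<exists>N c. ip (\<lambda>x. g x - (\<Sum>k<N. c k * b k x)) (\<lambda>x. g x - (\<Sum>k<N. c k * b k x)) < \<delta>"
    using ex_dense_sequence by blast
  interpret spline_basis m lam K b
    using b by unfold_locales (simp_all add: monomial01_def)
  have bdd: "bdd_above ((\<lambda>x. sqrt (h * K x x)) ` {0..1})"
  proof -
    obtain C where "\<forall>x\<in>{0..1}. K x x \<le> C" using K_diag_bounded by blast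
    then show ?thesis using h by (intro bdd_aboveI2[of _ _ "sqrt (h * C)"]) simp
  qed
  have cK: "sqrt (h * K x x) \<le> cK h K" if "x \<in> {0..1}" for x
    unfolding cK_def by (rule cSUP_upper[OF that bdd])
  have kap: "sqrt (K x x) \<le> \<kappa>" if "x \<in> {0..1}" for x
    using cK[OF that] h by (simp add: \<kappa>_def real_sqrt_mult field_simps)
  have kap1: "1 \<le> \<kappa>" by (rule order_trans[OF real_sqrt_ge_one[OF K_diag_0_ge] kap]) simp
  have kap2: "K x x \<le> \<kappa>\<^sup>2" if "x \<in> {0..1}" for x
    using kap[OF that] kap1 by (simp add: sqrt_le_D)
  have cKeq: "cK h K = \<kappa> * sqrt h" using h by (simp add: \<kappa>_def)
  interpret spline_sample m lam K b \<kappa> n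
    using kap2 kap1 \<open>n \<ge> 1\<close> by unfold_locales auto
  have nn: "real n > 0" using \<open>n \<ge> 1\<close> by simp
  have u0: "u > 0" using h \<open>r > 0\<close> \<open>M > 0\<close> by (simp add: u_def)
  have hh: "h powr (- 1 / 2) = 1 / sqrt h" "(real n * h) powr (- 1 / 2) = 1 / (sqrt (real n) * sqrt h)"
    using h nn by (simp_all add: powr_minus_divide powr_half_sqrt real_sqrt_mult)
  have \<delta>: "\<delta> = 2 * h ^ m + \<kappa> * (1 + sqrt (2 * X)) / sqrt (real n)"
  proof -
    have "sqrt (2 * X) = sqrt 2 * sqrt (real n) * u" using u0 by (simp add: X_def real_sqrt_mult)
    then show ?thesis unfolding \<delta>_def hh cKeq u_def using h nn \<open>M > 0\<close>
      by (simp add: real_sqrt_mult field_simps)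
  qed
  have "\<kappa>\<^sup>2 * u * 96 \<le> 1 / 2"
  proof -
    have "c0 > 0" using assms(8) by (simp add: entropy_const_def)
    moreover have "cK h K > 0" using kap1 h by (simp add: cKeq)
    ultimately have "96 \<le> Afun m (cK h K) c0 h 2" by (intro Afun_ge)
    then have "\<kappa>\<^sup>2 * u * 96 \<le> \<kappa>\<^sup>2 * u * Afun m (cK h K) c0 h 2" using u0 by (intro mult_left_mono) auto
    moreover have "\<kappa>\<^sup>2 * u = (cK h K)\<^sup>2 * sqrt M * r * h powr (- 1 / 2)"
    proof -
      have "\<kappa>\<^sup>2 * (sqrt M * sqrt h * r) = (\<kappa> * sqrt h)\<^sup>2 * sqrt M * r * (1 / sqrt h)"
        using h by (simp add: power2_eq_square)
      then show ?thesis unfolding hh u_def cKeq .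
    qed
    ultimately show ?thesis using assms(9) by simp
  qed
  then have "(\<kappa>\<^sup>2 * u)\<^sup>2 \<le> (1 / 192)\<^sup>2" using u0 by (intro power_mono) auto
  then have "\<kappa> ^ 4 * u\<^sup>2 \<le> 1 / 36864" by (simp add: power_mult_distrib power2_eq_square power4_eq_xxxx mult_ac)
  then have "real n * (\<kappa> ^ 4 * u\<^sup>2) \<le> real n * (1 / 36864)" by (intro mult_left_mono) auto
  then have nX: "36864 * \<kappa> ^ 4 * X \<le> real n" by (simp add: X_def mult_ac)
  have X0: "X \<ge> 0" by (simp add: X_def)
  have main: "outer_prob ?S ?E \<le> 2 * exp (- X)"
  \<comment> \<open>Below ln 2 the claimed bound exceeds 1. Otherwise X absorbs the constants in the
    tail bounds.\<close>
  proof (cases "ln 2 \<le> X")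
    case False
    have "outer_prob ?S ?E \<le> measure ?S (space ?S)" by (rule outer_prob_le) auto
    also have "\<dots> \<le> 2 * exp (- X)"
    proof -
      have "exp (- ln 2) \<le> exp (- X)" using False by simp
      then show ?thesis by (simp add: exp_minus S.prob_space)
    qed
    finally show ?thesis .
  next
    case True
    \<comment> \<open>The factor 8/7 inverts the 7/8 of the error bound; strictness is needed
      because the event includes equality with \<delta>.\<close>
    have "\<exists>t. exp (4 * \<kappa>\<^sup>2 / 9 - 2 * t / (9 * real n)) \<le> exp (- X) \<and> 8 / 7 * (sqrt t / real n + sqrt lam) < \<delta>"
    proof (cases "4 \<le> \<kappa>\<^sup>2")
      case k: True
      define t where "t = real n * (7 / 8 * \<kappa> * (1 + sqrt (2 * X)))\<^sup>2"
      have "exp (4 * \<kappa>\<^sup>2 / 9 - 2 * t / (9 * real n)) \<le> exp (- X)"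
        using noise_tail_large_kernel[OF True k \<open>n \<ge> 1\<close>] by (simp add: t_def)
      moreover have "sqrt t / real n = 7 / 8 * (\<kappa> * (1 + sqrt (2 * X)) / sqrt (real n))"
      proof -
        have "sqrt t = sqrt (real n) * (7 / 8 * \<kappa> * (1 + sqrt (2 * X)))"
          using kap1 X0 by (simp add: t_def real_sqrt_mult)
        moreover have "real n = sqrt (real n) * sqrt (real n)" by simp
        ultimately have "sqrt t / real n = 7 / 8 * \<kappa> * (1 + sqrt (2 * X)) / sqrt (real n)"
          using nn by (metis divide_divide_eq_left mult.commute nonzero_mult_div_cancel_left real_sqrt_eq_zero_cancel_iff less_irrefl)
        then show ?thesis by simp
      qed
      moreover have "0 < h ^ m" using h by simp
      moreover have "8 / 7 * (7 / 8 * D + p) < 2 * p + D" if "0 < p" for D p :: real using that by simp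
      ultimately have "8 / 7 * (sqrt t / real n + sqrt lam) < \<delta>" unfolding \<delta> sqrt_lam by metis
      with \<open>exp (4 * \<kappa>\<^sup>2 / 9 - 2 * t / (9 * real n)) \<le> exp (- X)\<close> show ?thesis by blast
    next
      case k: False
      define t where "t = (real n / 12)\<^sup>2"
      have "exp (4 * \<kappa>\<^sup>2 / 9 - 2 * t / (9 * real n)) \<le> exp (- X)"
        using noise_tail_small_kernel[OF True kap1 nX \<open>n \<ge> 1\<close>] by (simp add: t_def)
      moreover have "sqrt t / real n = 1 / 12" using nn by (simp add: t_def)
      \<comment> \<open>The inequality 8/7 * (1/12 + h^m) < 2 * h^m is equivalent to h^m > 1/9. It
        follows from lam \<ge> 1/80 > 1/81.\<close>
      moreover have "1 / 9 < h ^ m"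
      proof -
        have "K 1 1 \<le> \<kappa>\<^sup>2" by (rule kap2) simp
        then have "K 1 1 * (1 / 5 + 4 * lam) \<le> 4 * (1 / 5 + 4 * lam)"
          using k lam by (intro mult_right_mono) auto
        with K_diag_1_ge have "1 / 80 \<le> lam" by simp
        then have "(1 / 9)\<^sup>2 < (h ^ m)\<^sup>2" unfolding lam_eq[symmetric] by (simp add: power2_eq_square)
        then show ?thesis by (rule power_less_imp_less_base) (use h in simp)
      qed
      moreover have "0 < \<kappa> * (1 + sqrt (2 * X)) / sqrt (real n)"
        using kap1 X0 nn by (intro divide_pos_pos mult_pos_pos add_pos_nonneg) auto
      ultimately show ?thesis unfolding \<delta> sqrt_lam by (intro exI[of _ t]) simp
    qed
    then obtain t where t: "exp (4 * \<kappa>\<^sup>2 / 9 - 2 * t / (9 * real n)) \<le> exp (- X)"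
      "8 / 7 * (sqrt t / real n + sqrt lam) < \<delta>" by blast
    have hsX: "sqrt 2 * exp (- real n / (1024 * \<kappa> ^ 4)) \<le> exp (- X)"
      using kap1 by (intro sqrt2_exp_tail_le[OF X0 True nX]) auto
    \<comment> \<open>Off this null set all design points lie in the interval, where the estimator
      is required to maximise the objective.\<close>
    obtain Z where Z: "\<And>\<omega>. \<omega> \<in> space ?S - Z \<Longrightarrow> \<forall>i<n. fst (\<omega> i) \<in> {0..1}" "Z \<in> null_sets ?S"
      by (rule AE_E3[OF AE_sample_space_fst]) blast
    have "?E \<subseteq> (\<Union>N. bad t N) \<union> Z"
    proof
      fix \<omega> assume w: "\<omega> \<in> ?E"
      show "\<omega> \<in> (\<Union>N. bad t N) \<union> Z"
      proof (rule ccontr)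
        assume "\<omega> \<notin> (\<Union>N. bad t N) \<union> Z"
        with w have nb: "\<And>N. \<omega> \<notin> bad t N" and x: "\<And>i. i < n \<Longrightarrow> fst (\<omega> i) \<in> {0..1}" using Z(1) by auto
        have hs: "hs N (\<lambda>i. fst (\<omega> i)) \<le> (real n / 8)\<^sup>2" and ns: "noise N (\<lambda>i. fst (\<omega> i)) (\<lambda>i. snd (\<omega> i)) \<le> t" for N
          using nb[of N] w by (auto simp: bad_def not_less)
        have "7 / 8 * snorm m lam (\<lambda>x. fhat (data_of f \<omega>) x - f x) \<le> sqrt t / real n + sqrt lam"
          using f assms(10) by (intro spline_error_le x hs ns) (auto simp: Hm1_def lam_def)
        with t(2) w show False by auto
      qed
    qed
    then have "outer_prob ?S ?E \<le> measure ?S ((\<Union>N. bad t N) \<union> Z)"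
      using Z(2) by (intro outer_prob_le) auto
    also have "\<dots> = measure ?S (\<Union>N. bad t N)" by (rule measure_Un_null_set[OF _ Z(2)]) auto
    also have "\<dots> \<le> 2 * exp (- X)" by (rule measure_Union_bad_le[OF hsX t(1)])
    finally show ?thesis .
  qed
  have "- M * real n * h * r\<^sup>2 = - X" using Xeq by simp
  with main show "outer_prob (sample_space n)
             {\<omega> \<in> space (sample_space n).
                snorm m (h ^ (2 * m)) (\<lambda>x. fhat (data_of f \<omega>) x - f x)
                  \<ge> 2 * h ^ m + cK h K * (sqrt (2 * M) * r + (real n * h) powr (- 1 / 2))}
           \<le> 2 * exp (- M * real n * h * r\<^sup>2)"
    by (simp only: \<delta>_def lam_def)
qed

end
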